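(* Assume that (a) there exist constants $M\ge m$ and $L>0$ such that $\ell_{\mathrm{UB}}(f(\boldsymbol{x}),y)\le M$ for every $f\in\mathcal{F}$ and every $(\boldsymbol{x},y)\in\mathcal{X}\times\mathcal{Y}$, and for every fixed $y'\in\mathcal{Y}$ the map $y\mapsto\ell_{\mathrm{UB}}(y,y')$ is $L$-Lipschitz on the set of values $\{f(\boldsymbol{x}) : f\in\mathcal{F},\boldsymbol{x}\in\mathcal{X}\}$; (b) there exists a constant $G\ge1$ such that $g(\boldsymbol{x})\le G$ for every $g\in\mathcal{G}_+$ and every $\boldsymbol{x}\in\mathcal{X}$. Let $\mathcal{G}=\mathcal{G}_+\cup-\mathcal{G}_+$, and let $(\widehat f,\widehat g)=\operatorname{arg\,min}_{(f,g)\in\mathcal{F}\times\mathcal{G}_+}\widehat J_{\mathrm{UB}}(f,g;S)$. Then for any $\delta\in(0,1]$, with probability at least $1-\delta$ over the draw of $S$, $$\begin{aligned}\frac12R^2(\widehat f)\le{}&\min_{f\in\mathcal{F},\,g\in\mathcal{G}_+}J_{\mathrm{UB}}(f,g)+8MG(M+G)\left(L\,\mathfrak{R}^{\mathrm{tr}}_{n_{\mathrm{tr}}}(\mathcal{F})+\mathfrak{R}^{\mathrm{tr}}_{n_{\mathrm{tr}}}(\mathcal{G})\right)\\&+4M^2\,\mathfrak{R}^{\mathrm{te}}_{n_{\mathrm{te}}}(\mathcal{G})+10M^2G^2\sqrt{\frac{\log\frac1\delta}{2}}\left(\frac1{\sqrt{n_{\mathrm{tr}}}}+\frac1{\sqr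t{n_{\mathrm{te}}}}\right)+\frac{M^2G^2}{n_{\mathrm{tr}}}.\end{aligned}$$
   Context: Setting. $\mathcal{X}\subset\mathbb{R}^d$ is the input space, and the output space is $\mathcal{Y}\subset\mathbb{R}$ or $\mathcal{Y}=\{-1,+1\}$. The training distribution has density $p_{\mathrm{tr}}(\boldsymbol{x},y)=p_{\mathrm{tr}}(\boldsymbol{x})p_{\mathrm{tr}}(y|\boldsymbol{x})$ and the test distribution has density $p_{\mathrm{te}}(\boldsymbol{x},y)=p_{\mathrm{te}}(\boldsymbol{x})p_{\mathrm{te}}(y|\boldsymbol{x})$ on $\mathcal{X}\times\mathcal{Y}$. Covariate shift is assumed: the input densities may differ, $\operatorname{supp}(p_{\mathrm{tr}})=\operatorname{supp}(p_{\mathrm{te}})$ for the input densities (support understood as the set where the density is positive), and $p_{\mathrm{tr}}(y|\boldsymbol{x})=p_{\mathrm{te}}(y|\boldsymbol{x})$. The importance is $r(\boldsymbol{x})=p_{\mathrm{te}}(\boldsymbol{x})/p_{\mathrm{tr}}(\boldsymbol{x})$. Losses and risk. $\ell\colon\mathbb{R}\times\mathcal{Y}\to\mathbb{R}_+$ is a loss, $\mathcal{F}$ is a set of functions $\mathcal{X}\to\mathbb{R}$, and $m$ is a constant with $\ell(f(\boldsymbol{x}),y)\le m$ for all $f\in\mathcal{F}$, $(\boldsymbol{x},y)\in\mathcal{X}\times\mathcal{Y}$. $\ell_{\mathrm{UB}}\colon\mathbb{R}\times\mathcal{Y}\to\mathbb{R}_+$ satisfies $\ell\le\ell_{\mathrm{UB}}$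 pointwise. $\mathcal{G}_+$ is a set of non-negative functions $\mathcal{X}\to\mathbb{R}$, and $-\mathcal{G}_+=\{-g:g\in\mathcal{G}_+\}$. The test risk is $R(f):=\mathbb{E}_{(\boldsymbol{x},y)\sim p_{\mathrm{te}}(\boldsymbol{x},y)}[\ell(f(\boldsymbol{x}),y)]$, and $R^2(f)=(R(f))^2$. All functions are measurable, the suprema involved are assumed measurable, and the minimizers appearing are assumed to exist. Objectives. $$J_{\mathrm{UB}}(f,g):=\left(\mathbb{E}_{(\boldsymbol{x},y)\sim p_{\mathrm{tr}}(\boldsymbol{x},y)}[\ell_{\mathrm{UB}}(f(\boldsymbol{x}),y)g(\boldsymbol{x})]\right)^2+m^2\,\mathbb{E}_{\boldsymbol{x}\sim p_{\mathrm{tr}}(\boldsymbol{x})}[(g(\boldsymbol{x})-r(\boldsymbol{x}))^2].$$ The sample $S=\{(\boldsymbol{x}^{\mathrm{tr}}_i,y^{\mathrm{tr}}_i)\}_{i=1}^{n_{\mathrm{tr}}}\cup\{\boldsymbol{x}^{\mathrm{te}}_i\}_{i=1}^{n_{\mathrm{te}}}$ consists of independent points, $(\boldsymbol{x}^{\mathrm{tr}}_i,y^{\mathrm{tr}}_i)\sim p_{\mathrm{tr}}(\boldsymbol{x},y)$ and $\boldsymbol{x}^{\mathrm{te}}_i\sim p_{\mathrm{te}}(\boldsymbol{x})$, and $$\widehat J_{\mathrm{UB}}(f,g;S):=\left(\frac1{n_{\mathrm{tr}}}\sum_{i=1}^{n_{\mathrm{tr}}}\ell_{\mathrm{UB}}(f(\boldsymbol{x}^{\mathrm{tr}}_i),y^{\mathrm{tr}}_i)g(\boldsymbol{x}^{\mathrm{tr}}_i)\right)^2+m^2\left(\frac1{n_{\mathrm{tr}}}\sum_{i=1}^{n_{\mathrm{tr}}}g^2(\boldsymbol{x}^{\mathrm{tr}}_i)-\frac2{n_{\mathrm{te}}}\sum_{i=1}^{n_{\mathrm{te}}}g(\boldsymbol{x}^{\mathrm{te}}_i)+C\right),$$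 where $C=\mathbb{E}_{\boldsymbol{x}\sim p_{\mathrm{tr}}}[r(\boldsymbol{x})^2]$ (assumed finite) is the constant for which $\mathbb{E}_{p_{\mathrm{tr}}}[(g-r)^2]=\mathbb{E}_{p_{\mathrm{tr}}}[g^2]-2\mathbb{E}_{p_{\mathrm{te}}}[g]+C$. Rademacher complexity. For a class $\mathcal{H}$ of functions $\mathcal{X}\to\mathbb{R}$, $\mathfrak{R}^{\mathrm{tr}}_{n}(\mathcal{H})=\mathbb{E}\left[\sup_{h\in\mathcal{H}}\frac1n\sum_{i=1}^n\sigma_ih(\boldsymbol{x}_i)\right]$, where $\boldsymbol{x}_1,\dots,\boldsymbol{x}_n$ are i.i.d. from $p_{\mathrm{tr}}(\boldsymbol{x})$ and $\sigma_1,\dots,\sigma_n$ are independent uniform $\{-1,+1\}$ variables independent of the $\boldsymbol{x}_i$; $\mathfrak{R}^{\mathrm{te}}_n(\mathcal{H})$ is the same with $\boldsymbol{x}_i$ i.i.d. from $p_{\mathrm{te}}(\boldsymbol{x})$. *)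

theory Defs
  imports "HOL-Probability.Probability"
begin

text \<open>
  Densities are taken with respect to a sigma-finite reference measure on the Borel sets of the
  space in question. Lebesgue measure on a Borel set (inputs, real-valued outputs) and counting
  measure on \<open>{-1, 1}\<close> (binary outputs) are the two intended instances.
\<close>

definition reference_measure :: "'a::topological_space set \<Rightarrow> 'a measure \<Rightarrow> bool" where
  "reference_measure A \<mu> \<longleftrightarrow>
     sigma_finite_measure \<mu> \<and> sets \<mu> = sets (restrict_space borel A)"

lemma space_reference_measure: "reference_measure A \<mu> \<Longrightarrow> space \<mu> = A"
  by (metis reference_measure_def sets_eq_imp_space_eq space_restrict_space Int_UNIV_right
      space_borel inf_commute)

lemma reference_measure_lebesgue:
  fixes A :: "'a::euclidean_space set"
  assumes "A \<in> sets borel"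
  shows "reference_measure A (restrict_space lborel A)"
  using assms unfolding reference_measure_def
  by (auto intro!: sigma_finite_measure_restrict_space lborel.sigma_finite_measure_axioms
      simp: sets_restrict_space)

lemma reference_measure_binary:
  "reference_measure {-1, 1::real} (count_space {-1, 1})"
proof -
  have "sets (restrict_space borel {-1, 1::real}) = Pow {-1, 1}"
  proof
    show "Pow {-1, 1::real} \<subseteq> sets (restrict_space borel {-1, 1})"
    proof
      fix B :: "real set"
      assume "B \<in> Pow {-1, 1}"
      then have "finite B" "B \<subseteq> {-1, 1}"
        using finite_subset by auto
      then have "B \<in> sets borel" "B = {-1, 1} \<inter> B"
        by (auto intro: borel_closed finite_imp_closed)
      then show "B \<in> sets (restrict_space borel {-1, 1})"
        unfolding sets_restrict_space by blast
    qed
  qed (auto simp: sets_restrict_space)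
  then show ?thesis
    unfolding reference_measure_def
    by (simp add: sigma_finite_measure_count_space_finite)
qed

definition prob_density :: "'a measure \<Rightarrow> ('a \<Rightarrow> real) \<Rightarrow> bool" where
  "prob_density \<mu> p \<longleftrightarrow>
     p \<in> borel_measurable \<mu> \<and> (\<forall>x\<in>space \<mu>. 0 \<le> p x) \<and> (\<integral>\<^sup>+x. ennreal (p x) \<partial>\<mu>) = 1"

text \<open>
  \<open>c x y\<close> stands for \<open>p(y|x)\<close>. It is constrained only where \<open>p(x) > 0\<close>, since the conditional
  density has no meaning elsewhere.
\<close>

definition conditional_density ::
  "'a measure \<Rightarrow> 'b measure \<Rightarrow> ('a \<Rightarrow> real) \<Rightarrow> ('a \<Rightarrow> 'b \<Rightarrow> real) \<Rightarrow> bool" where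
  "conditional_density \<mu> \<nu> p c \<longleftrightarrow>
     (\<lambda>(x, y). c x y) \<in> borel_measurable (\<mu> \<Otimes>\<^sub>M \<nu>) \<and>
     (\<forall>x\<in>space \<mu>. 0 < p x \<longrightarrow> prob_density \<nu> (c x))"

definition input_dist :: "'a measure \<Rightarrow> ('a \<Rightarrow> real) \<Rightarrow> 'a measure" where
  "input_dist \<mu> p = density \<mu> (\<lambda>x. ennreal (p x))"

definition joint_dist ::
  "'a measure \<Rightarrow> 'b measure \<Rightarrow> ('a \<Rightarrow> real) \<Rightarrow> ('a \<Rightarrow> 'b \<Rightarrow> real) \<Rightarrow> ('a \<times> 'b) measure" where
  "joint_dist \<mu> \<nu> p c = density (\<mu> \<Otimes>\<^sub>M \<nu>) (\<lambda>(x, y). ennreal (p x * c x y))"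

definition covariate_shift ::
  "'a measure \<Rightarrow> 'b measure \<Rightarrow> ('a \<Rightarrow> real) \<Rightarrow> ('a \<Rightarrow> 'b \<Rightarrow> real) \<Rightarrow>
   ('a \<Rightarrow> real) \<Rightarrow> ('a \<Rightarrow> 'b \<Rightarrow> real) \<Rightarrow> bool" where
  "covariate_shift \<mu> \<nu> ptr ctr pte cte \<longleftrightarrow>
     prob_density \<mu> ptr \<and> conditional_density \<mu> \<nu> ptr ctr \<and>
     prob_density \<mu> pte \<and> conditional_density \<mu> \<nu> pte cte \<and>
     {x \<in> space \<mu>. 0 < ptr x} = {x \<in> space \<mu>. 0 < pte x} \<and>
     (\<forall>x\<in>space \<mu>. 0 < ptr x \<longrightarrow> (\<forall>y\<in>space \<nu>. ctr x y = cte x y))"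

definition importance :: "('a \<Rightarrow> real) \<Rightarrow> ('a \<Rightarrow> real) \<Rightarrow> 'a \<Rightarrow> real" where
  "importance ptr pte x = pte x / ptr x"

definition test_risk ::
  "'a measure \<Rightarrow> 'b measure \<Rightarrow> ('a \<Rightarrow> real) \<Rightarrow> ('a \<Rightarrow> 'b \<Rightarrow> real) \<Rightarrow>
   (real \<Rightarrow> 'b \<Rightarrow> real) \<Rightarrow> ('a \<Rightarrow> real) \<Rightarrow> real" where
  "test_risk \<mu> \<nu> pte cte l f = (\<integral>(x, y). l (f x) y \<partial>joint_dist \<mu> \<nu> pte cte)"

definition J_UB ::
  "'a measure \<Rightarrow> 'b measure \<Rightarrow> ('a \<Rightarrow> real) \<Rightarrow> ('a \<Rightarrow> 'b \<Rightarrow> real) \<Rightarrow> ('a \<Rightarrow> real) \<Rightarrow>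
   real \<Rightarrow> (real \<Rightarrow> 'b \<Rightarrow> real) \<Rightarrow> ('a \<Rightarrow> real) \<Rightarrow> ('a \<Rightarrow> real) \<Rightarrow> real" where
  "J_UB \<mu> \<nu> ptr ctr pte m lUB f g =
     (\<integral>(x, y). lUB (f x) y * g x \<partial>joint_dist \<mu> \<nu> ptr ctr)\<^sup>2
     + m\<^sup>2 * (\<integral>x. (g x - importance ptr pte x)\<^sup>2 \<partial>input_dist \<mu> ptr)"

type_synonym ('a, 'b) sample = "(nat \<Rightarrow> 'a \<times> 'b) \<times> (nat \<Rightarrow> 'a)"

text \<open>
  Law of the sample: \<open>ntr\<close> labelled training points and \<open>nte\<close> unlabelled test points, all
  independent, indexed from \<open>0\<close>.
\<close>

definition sample_dist ::
  "'a measure \<Rightarrow> 'b measure \<Rightarrow> ('a \<Rightarrow> real) \<Rightarrow> ('a \<Rightarrow> 'b \<Rightarrow> real) \<Rightarrow> ('a \<Rightarrow> real) \<Rightarrow>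
   nat \<Rightarrow> nat \<Rightarrow> ('a, 'b) sample measure" where
  "sample_dist \<mu> \<nu> ptr ctr pte ntr nte =
     (\<Pi>\<^sub>M i\<in>{..<ntr}. joint_dist \<mu> \<nu> ptr ctr) \<Otimes>\<^sub>M (\<Pi>\<^sub>M i\<in>{..<nte}. input_dist \<mu> pte)"

definition J_UB_emp ::
  "'a measure \<Rightarrow> ('a \<Rightarrow> real) \<Rightarrow> ('a \<Rightarrow> real) \<Rightarrow> real \<Rightarrow> (real \<Rightarrow> 'b \<Rightarrow> real) \<Rightarrow>
   nat \<Rightarrow> nat \<Rightarrow> ('a \<Rightarrow> real) \<Rightarrow> ('a \<Rightarrow> real) \<Rightarrow> ('a, 'b) sample \<Rightarrow> real" where
  "J_UB_emp \<mu> ptr pte m lUB ntr nte f g S =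
     ((\<Sum>i<ntr. lUB (f (fst (fst S i))) (snd (fst S i)) * g (fst (fst S i))) / real ntr)\<^sup>2
     + m\<^sup>2 * ((\<Sum>i<ntr. (g (fst (fst S i)))\<^sup>2) / real ntr
             - 2 / real nte * (\<Sum>i<nte. g (snd S i))
             + (\<integral>x. (importance ptr pte x)\<^sup>2 \<partial>input_dist \<mu> ptr))"

text \<open>
  Suprema and their expectations are taken in the extended reals, so that a class with an
  unbounded or non-integrable supremum has complexity \<open>\<infinity>\<close>; \<open>real\<close>-valued suprema and integrals
  would return meaningless values there. If both the positive and the negative part have infinite
  integral, the expectation below is \<open>\<infinity> - \<infinity> = \<infinity>\<close>.
\<close>

definition ereal_expectation :: "'a measure \<Rightarrow> ('a \<Rightarrow> ereal) \<Rightarrow> ereal" where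
  "ereal_expectation M f =
     enn2ereal (\<integral>\<^sup>+x. e2ennreal (f x) \<partial>M) - enn2ereal (\<integral>\<^sup>+x. e2ennreal (- f x) \<partial>M)"

definition rademacher_space ::
  "nat \<Rightarrow> 'a measure \<Rightarrow> ((nat \<Rightarrow> real) \<times> (nat \<Rightarrow> 'a)) measure" where
  "rademacher_space n D =
     (\<Pi>\<^sub>M i\<in>{..<n}. uniform_count_measure {-1, 1}) \<Otimes>\<^sub>M (\<Pi>\<^sub>M i\<in>{..<n}. D)"

definition rademacher_sup ::
  "nat \<Rightarrow> ('a \<Rightarrow> real) set \<Rightarrow> (nat \<Rightarrow> real) \<times> (nat \<Rightarrow> 'a) \<Rightarrow> ereal" where
  "rademacher_sup n H = (\<lambda>(\<sigma>, xs). SUP h\<in>H. ereal (1 / real n * (\<Sum>i<n. \<sigma> i * h (xs i))))"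

definition rademacher :: "nat \<Rightarrow> 'a measure \<Rightarrow> ('a \<Rightarrow> real) set \<Rightarrow> ereal" where
  "rademacher n D H = ereal_expectation (rademacher_space n D) (rademacher_sup n H)"

definition rademacher_measurable :: "nat \<Rightarrow> 'a measure \<Rightarrow> ('a \<Rightarrow> real) set \<Rightarrow> bool" where
  "rademacher_measurable n D H \<longleftrightarrow> rademacher_sup n H \<in> borel_measurable (rademacher_space n D)"

definition symmetrized :: "('a \<Rightarrow> real) set \<Rightarrow> ('a \<Rightarrow> real) set" where
  "symmetrized H = H \<union> (\<lambda>h x. - h x) ` H"

text \<open>
  The event need not be known to be measurable: it has to contain a measurable event of the
  required probability.
\<close>

definition with_prob_at_least :: "'a measure \<Rightarrow> real \<Rightarrow> ('a \<Rightarrow> bool) \<Rightarrow> bool" where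
  "with_prob_at_least M p Q \<longleftrightarrow> (\<exists>A\<in>sets M. p \<le> measure M A \<and> (\<forall>x\<in>A. Q x))"

lemma with_prob_at_least_iff:
  assumes "prob_space M" "{x \<in> space M. Q x} \<in> sets M"
  shows "with_prob_at_least M p Q \<longleftrightarrow> p \<le> measure M {x \<in> space M. Q x}"
proof
  interpret prob_space M by fact
  assume "with_prob_at_least M p Q"
  then obtain A where A: "A \<in> sets M" "p \<le> measure M A" "\<forall>x\<in>A. Q x"
    unfolding with_prob_at_least_def by blast
  then have "A \<subseteq> {x \<in> space M. Q x}"
    using sets.sets_into_space by blast
  then have "measure M A \<le> measure M {x \<in> space M. Q x}"
    using assms(2) by (rule finite_measure_mono)
  with A show "p \<le> measure M {x \<in> space M. Q x}" by simp
next
  assume "p \<le> measure M {x \<in> space M. Q x}"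
  then show "with_prob_at_least M p Q"
    unfolding with_prob_at_least_def using assms(2) by blast
qed

end

(*
  Splitting E[l r] = E[l g] + E[l (r - g)] and applying Cauchy-Schwarz gives R(f)^2 / 2 <= J(f, g),
  so it suffices to bound J at the empirical minimizer. Since the empirical objective there is at
  most its value at the population minimizer, the excess is at most the supremum of J - J_emp plus
  the deviation of J_emp at one fixed pair. McDiarmid's inequality is applied once, to the sum of
  these two quantities. The expectation of the fixed deviation is a variance, at most
  M^2 G^2 / ntr; that of the supremum is bounded by symmetrization, where
  A^2 - B^2 = (A + B) (A - B) linearizes the squared mean and the class G symmetrized under sign
  change absorbs the absolute value. The contraction principle and the polarization identity for
  products reduce the resulting complexities to those of F and G.
*)
theory Submission
  imports Defs
begin

text \<open>\<open>F\<close> has no bound of its own: only the losses of its members are bounded,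
  and they are Lipschitz in the prediction. On a given sample the supremum over \<open>F\<close> may
  therefore be infinite, and so may the complexity of \<open>F\<close>; for M > 0 the claim is then
  trivial. If the complexity is finite, \<open>F\<close> is bounded at the points of almost every
  sample. There all suprema are real, and contraction and polarization compare complexities sample
  by sample, as averages over finitely many sign vectors; integration comes afterwards.
  Measurability shapes the symmetrization. It is assumed for the suprema over signs and for the
  supremum of \<open>J_UB - J_UB_emp\<close>, but not for suprema of deviations of empirical means.
  For each class, symmetrization therefore delivers a measurable function of the sample that
  dominates the deviations of all members at once and whose integral is twice the complexity; only
  these functions are integrated.\<close>

section \<open>Averages over signs and the contraction principle\<close>

text \<open>
  \<open>rad_avg n H c a\<close> is the average of \<open>SUP h\<in>H. c h + (\<Sum>i<n. \<sigma> i * a h i)\<close> over all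
  \<open>\<sigma> \<in> {-1, 1}\<^sup>n\<close> (see \<open>rad_avg_eq_sum\<close>). The offset \<open>c\<close> makes induction on \<open>n\<close> possible.
\<close>

fun rad_avg :: "nat \<Rightarrow> 'h set \<Rightarrow> ('h \<Rightarrow> real) \<Rightarrow> ('h \<Rightarrow> nat \<Rightarrow> real) \<Rightarrow> real" where
  "rad_avg 0 H c a = (SUP h\<in>H. c h)"
| "rad_avg (Suc n) H c a =
     (rad_avg n H (\<lambda>h. c h + a h n) a + rad_avg n H (\<lambda>h. c h - a h n) a) / 2"

text \<open>Real-valued suprema are meaningful only under a bound. It is two-sided because the sign
  recursion both adds and subtracts coordinates.\<close>

definition bounded_on :: "'h set \<Rightarrow> ('h \<Rightarrow> real) \<Rightarrow> bool" where
  "bounded_on H c \<longleftrightarrow> (\<exists>B. \<forall>h\<in>H. \<bar>c h\<bar> \<le> B)"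

lemma bounded_onI: "(\<And>h. h \<in> H \<Longrightarrow> \<bar>c h\<bar> \<le> B) \<Longrightarrow> bounded_on H c"
  unfolding bounded_on_def by blast

lemma bounded_on_const [simp]: "bounded_on H (\<lambda>h. k)"
  by (rule bounded_onI[of _ _ "\<bar>k\<bar>"]) simp

lemma bounded_on_add: "bounded_on H c \<Longrightarrow> bounded_on H d \<Longrightarrow> bounded_on H (\<lambda>h. c h + d h)"
  unfolding bounded_on_def by (metis abs_triangle_ineq add_mono order_trans)

lemma bounded_on_cmult: "bounded_on H c \<Longrightarrow> bounded_on H (\<lambda>h. k * c h)"
  unfolding bounded_on_def by (metis abs_mult abs_ge_zero mult_left_mono)

lemma bounded_on_uminus: "bounded_on H c \<Longrightarrow> bounded_on H (\<lambda>h. - c h)"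
  using bounded_on_cmult[of H c "-1"] by simp

lemma bounded_on_diff: "bounded_on H c \<Longrightarrow> bounded_on H d \<Longrightarrow> bounded_on H (\<lambda>h. c h - d h)"
  using bounded_on_add[OF _ bounded_on_uminus] by fastforce

lemma bounded_on_sum:
  "(\<And>i. i \<in> I \<Longrightarrow> bounded_on H (\<lambda>h. c h i)) \<Longrightarrow> bounded_on H (\<lambda>h. \<Sum>i\<in>I. c h i)"
  by (induction I rule: infinite_finite_induct) (auto intro: bounded_on_add)

lemma bounded_on_bdd_above: "bounded_on H c \<Longrightarrow> bdd_above (c ` H)"
  unfolding bounded_on_def bdd_above_def by (auto dest: abs_le_D1)

lemmas bounded_on_intros =
  bounded_on_add bounded_on_diff bounded_on_uminus bounded_on_cmult bounded_on_sum

text \<open>The left side is the supremum over pairs of \<open>c h + c h' + (u h - u h')\<close>. On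
  the right each pair may be taken in either order, which yields
  \<open>c h + c h' + \<bar>v h - v h'\<bar>\<close>, so only the sizes of the differences
  matter.\<close>

lemma SUP_add_SUP_diff_le:
  fixes c u v :: "'h \<Rightarrow> real"
  assumes H: "H \<noteq> {}" and b: "bounded_on H c" "bounded_on H v"
    and uv: "\<And>h h'. h \<in> H \<Longrightarrow> h' \<in> H \<Longrightarrow> \<bar>u h - u h'\<bar> \<le> \<bar>v h - v h'\<bar>"
  shows "(SUP h\<in>H. c h + u h) + (SUP h\<in>H. c h - u h)
         \<le> (SUP h\<in>H. c h + v h) + (SUP h\<in>H. c h - v h)" (is "?A + ?B \<le> ?R")
proof -
  have bp: "bdd_above ((\<lambda>h. c h + v h) ` H)" "bdd_above ((\<lambda>h. c h - v h) ` H)"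
    using b by (auto intro!: bounded_on_bdd_above bounded_on_intros)
  have pair: "(c h + u h) + (c h' - u h') \<le> ?R" if "h \<in> H" "h' \<in> H" for h h'
  proof -
    have "c h + v h + (c h' - v h') \<le> ?R" "c h' + v h' + (c h - v h) \<le> ?R"
      using that by (auto intro!: add_mono cSUP_upper bp)
    then show ?thesis using uv[OF that] by (auto simp: abs_if split: if_splits)
  qed
  have "?A \<le> ?R - (c h' - u h')" if "h' \<in> H" for h'
    using pair that H by (intro cSUP_least) (auto simp: algebra_simps)
  then have "c h' - u h' \<le> ?R - ?A" if "h' \<in> H" for h'
    using that by (auto simp: algebra_simps)
  then have "?B \<le> ?R - ?A"
    using H by (intro cSUP_least) auto
  then show ?thesis by simp
qed

text \<open>The comparison concerns the sum over both signs of the perturbation, not either sign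
  alone, so both branches are carried through the recursion together. The remaining coordinates are
  common to both sides and are absorbed by the offset \<open>c\<close>.\<close>

lemma rad_avg_perturb_le:
  assumes "H \<noteq> {}" "bounded_on H v" "\<And>i. i < n \<Longrightarrow> bounded_on H (\<lambda>h. a h i)"
    and "\<And>h h'. h \<in> H \<Longrightarrow> h' \<in> H \<Longrightarrow> \<bar>u h - u h'\<bar> \<le> \<bar>v h - v h'\<bar>"
    and "bounded_on H c"
  shows "rad_avg n H (\<lambda>h. c h + u h) a + rad_avg n H (\<lambda>h. c h - u h) a
         \<le> rad_avg n H (\<lambda>h. c h + v h) a + rad_avg n H (\<lambda>h. c h - v h) a"
  using assms
proof (induction n arbitrary: c)
  case 0
  then show ?case using SUP_add_SUP_diff_le[of H c v u] by simp
next
  case (Suc n)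
  have b: "bounded_on H (\<lambda>h. c h + a h n)" "bounded_on H (\<lambda>h. c h - a h n)"
    using Suc.prems by (auto intro: bounded_on_intros)
  have "rad_avg n H (\<lambda>h. c h + u h + a h n) a + rad_avg n H (\<lambda>h. c h - u h + a h n) a
      \<le> rad_avg n H (\<lambda>h. c h + v h + a h n) a + rad_avg n H (\<lambda>h. c h - v h + a h n) a"
    using Suc.IH[OF Suc.prems(1,2) _ Suc.prems(4) b(1)] Suc.prems(3) by (simp add: algebra_simps)
  moreover have "rad_avg n H (\<lambda>h. c h + u h - a h n) a + rad_avg n H (\<lambda>h. c h - u h - a h n) a
      \<le> rad_avg n H (\<lambda>h. c h + v h - a h n) a + rad_avg n H (\<lambda>h. c h - v h - a h n) a"
    using Suc.IH[OF Suc.prems(1,2) _ Suc.prems(4) b(2)] Suc.prems(3) by (simp add: algebra_simps)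
  ultimately show ?case by (simp add: field_simps)
qed

text \<open>The contraction principle of Ledoux and Talagrand, replacing one coordinate at a time.\<close>

lemma rad_avg_contraction:
  assumes "H \<noteq> {}" "\<And>i. i < n \<Longrightarrow> bounded_on H (\<lambda>h. a h i)"
    and "\<And>h h' i. h \<in> H \<Longrightarrow> h' \<in> H \<Longrightarrow> i < n \<Longrightarrow> \<bar>b h i - b h' i\<bar> \<le> \<bar>a h i - a h' i\<bar>"
    and "bounded_on H c"
  shows "rad_avg n H c b \<le> rad_avg n H c a"
  using assms
proof (induction n arbitrary: c)
  case 0
  then show ?case by simp
next
  case (Suc n)
  \<comment> \<open>\<open>b\<close> inherits boundedness from \<open>a\<close>, since its
    differences from a fixed member \<open>h0\<close> are dominated; this allows
    \<open>b h n\<close> to enter the offset.\<close>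
  have bn: "bounded_on H (\<lambda>h. b h n)"
  proof -
    obtain h0 where h0: "h0 \<in> H" using Suc.prems by blast
    obtain B where B: "\<And>h. h \<in> H \<Longrightarrow> \<bar>a h n\<bar> \<le> B"
      using Suc.prems(2)[of n] unfolding bounded_on_def by auto
    show ?thesis
    proof (rule bounded_onI[of _ _ "2 * B + \<bar>b h0 n\<bar>"])
      fix h assume h: "h \<in> H"
      have "\<bar>b h n - b h0 n\<bar> \<le> \<bar>a h n - a h0 n\<bar>" using Suc.prems(3) h h0 by simp
      also have "\<dots> \<le> 2 * B" using B[OF h] B[OF h0] by linarith
      finally show "\<bar>b h n\<bar> \<le> 2 * B + \<bar>b h0 n\<bar>" by linarith
    qed
  qed
  \<comment> \<open>Coordinates below \<open>n\<close> are exchanged at a fixed sign of coordinate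
    \<open>n\<close>; the exchange at \<open>n\<close> itself needs both signs together.\<close>
  have "rad_avg n H (\<lambda>h. c h + b h n) b \<le> rad_avg n H (\<lambda>h. c h + b h n) a"
    "rad_avg n H (\<lambda>h. c h - b h n) b \<le> rad_avg n H (\<lambda>h. c h - b h n) a"
    using Suc.prems bn by (auto intro!: Suc.IH bounded_on_intros)
  moreover have "rad_avg n H (\<lambda>h. c h + b h n) a + rad_avg n H (\<lambda>h. c h - b h n) a
      \<le> rad_avg n H (\<lambda>h. c h + a h n) a + rad_avg n H (\<lambda>h. c h - a h n) a"
    using Suc.prems by (intro rad_avg_perturb_le) auto
  ultimately show ?case by simp
qed

lemma rad_avg_add_le:
  assumes "H \<noteq> {}" "\<And>i. i < n \<Longrightarrow> bounded_on H (\<lambda>h. a h i)"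
    "\<And>i. i < n \<Longrightarrow> bounded_on H (\<lambda>h. b h i)" "bounded_on H c" "bounded_on H d"
  shows "rad_avg n H (\<lambda>h. c h + d h) (\<lambda>h i. a h i + b h i) \<le> rad_avg n H c a + rad_avg n H d b"
  using assms
proof (induction n arbitrary: c d)
  case 0
  have "bdd_above (c ` H)" "bdd_above (d ` H)"
    using 0 by (auto intro: bounded_on_bdd_above)
  then show ?case
    using 0 by (auto intro!: cSUP_least add_mono cSUP_upper)
next
  case (Suc n)
  have b: "bounded_on H (\<lambda>h. c h + a h n)" "bounded_on H (\<lambda>h. c h - a h n)"
    "bounded_on H (\<lambda>h. d h + b h n)" "bounded_on H (\<lambda>h. d h - b h n)"
    using Suc.prems by (auto intro: bounded_on_intros)
  have "rad_avg n H (\<lambda>h. c h + d h + (a h n + b h n)) (\<lambda>h i. a h i + b h i)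
      \<le> rad_avg n H (\<lambda>h. c h + a h n) a + rad_avg n H (\<lambda>h. d h + b h n) b"
    using Suc.IH[OF Suc.prems(1) _ _ b(1,3)] Suc.prems(2,3) by (simp add: algebra_simps)
  moreover have "rad_avg n H (\<lambda>h. c h + d h - (a h n + b h n)) (\<lambda>h i. a h i + b h i)
      \<le> rad_avg n H (\<lambda>h. c h - a h n) a + rad_avg n H (\<lambda>h. d h - b h n) b"
    using Suc.IH[OF Suc.prems(1) _ _ b(2,4)] Suc.prems(2,3) by (simp add: algebra_simps)
  ultimately show ?case by (simp add: field_simps)
qed

lemma rad_avg_uminus: "rad_avg n H c (\<lambda>h i. - a h i) = rad_avg n H c a"
  by (induction n arbitrary: c) (simp_all add: add.commute)

lemma SUP_cmult_real:
  fixes c :: "'h \<Rightarrow> real"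
  assumes "H \<noteq> {}" "bounded_on H c" "0 \<le> k"
  shows "(SUP h\<in>H. k * c h) = k * (SUP h\<in>H. c h)"
proof (cases "k = 0")
  case True
  then show ?thesis using assms by simp
next
  case False
  then have k: "0 < k" using assms by simp
  show ?thesis
  proof (rule antisym)
    show "(SUP h\<in>H. k * c h) \<le> k * (SUP h\<in>H. c h)"
      using assms by (intro cSUP_least mult_left_mono cSUP_upper bounded_on_bdd_above) auto
    have "(SUP h\<in>H. c h) \<le> (SUP h\<in>H. k * c h) / k"
    proof (rule cSUP_least[OF assms(1)])
      fix h assume "h \<in> H"
      then have "k * c h \<le> (SUP h\<in>H. k * c h)"
        using assms by (intro cSUP_upper bounded_on_bdd_above bounded_on_cmult)
      then show "c h \<le> (SUP h\<in>H. k * c h) / k" using k by (simp add: field_simps)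
    qed
    then show "k * (SUP h\<in>H. c h) \<le> (SUP h\<in>H. k * c h)" using k by (simp add: field_simps)
  qed
qed

lemma rad_avg_cmult:
  assumes "H \<noteq> {}" "\<And>i. i < n \<Longrightarrow> bounded_on H (\<lambda>h. a h i)" "bounded_on H c" "0 \<le> k"
  shows "rad_avg n H (\<lambda>h. k * c h) (\<lambda>h i. k * a h i) = k * rad_avg n H c a"
  using assms
proof (induction n arbitrary: c)
  case 0
  then show ?case by (simp add: SUP_cmult_real)
next
  case (Suc n)
  have "bounded_on H (\<lambda>h. c h + a h n)" "bounded_on H (\<lambda>h. c h - a h n)"
    using Suc.prems by (auto intro: bounded_on_intros)
  then show ?case
    using Suc.IH[of "\<lambda>h. c h + a h n"] Suc.IH[of "\<lambda>h. c h - a h n"] Suc.prems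
    by (simp add: algebra_simps)
qed

text \<open>Only members of \<open>H'\<close> of the form \<open>q h\<close> enter the left side.
  With \<open>q\<close> a projection this discards one factor of a product class; with
  \<open>q = id\<close> it is an inclusion of classes.\<close>

lemma rad_avg_subset:
  assumes "H \<noteq> {}" "q ` H \<subseteq> H'" "\<And>i. i < n \<Longrightarrow> bounded_on H' (\<lambda>h. a h i)" "bounded_on H' c"
  shows "rad_avg n H (\<lambda>h. c (q h)) (\<lambda>h. a (q h)) \<le> rad_avg n H' c a"
  using assms
proof (induction n arbitrary: c)
  case 0
  have "c (q h) \<le> (SUP h\<in>H'. c h)" if "h \<in> H" for h
    using 0 that by (intro cSUP_upper bounded_on_bdd_above) auto
  then show ?case using 0 by (auto intro!: cSUP_least)
next
  case (Suc n)
  have "bounded_on H' (\<lambda>h. c h + a h n)" "bounded_on H' (\<lambda>h. c h - a h n)"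
    using Suc.prems by (auto intro: bounded_on_intros)
  then show ?case
    using Suc.IH[of "\<lambda>h. c h + a h n"] Suc.IH[of "\<lambda>h. c h - a h n"] Suc.prems
    by simp
qed

lemma rad_avg_lipschitz:
  assumes "H \<noteq> {}" "\<And>i. i < n \<Longrightarrow> bounded_on H (\<lambda>h. a h i)" "0 \<le> L"
    and "\<And>h h' i. h \<in> H \<Longrightarrow> h' \<in> H \<Longrightarrow> i < n \<Longrightarrow> \<bar>b h i - b h' i\<bar> \<le> L * \<bar>a h i - a h' i\<bar>"
  shows "rad_avg n H (\<lambda>h. 0) b \<le> L * rad_avg n H (\<lambda>h. 0) a"
proof -
  have "rad_avg n H (\<lambda>h. 0) b \<le> rad_avg n H (\<lambda>h. 0) (\<lambda>h i. L * a h i)"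
    using assms
    by (intro rad_avg_contraction)
       (auto intro: bounded_on_intros simp: abs_mult simp flip: right_diff_distrib)
  also have "\<dots> = L * rad_avg n H (\<lambda>h. 0) a"
    using rad_avg_cmult[of H n a "\<lambda>h. 0" L] assms by simp
  finally show ?thesis .
qed

text \<open>Squaring is \<open>2 * B\<close>-Lipschitz on \<open>[-B, B]\<close>.\<close>

lemma rad_avg_square:
  assumes "H \<noteq> {}" "0 \<le> B" "\<And>h i. h \<in> H \<Longrightarrow> i < n \<Longrightarrow> \<bar>a h i\<bar> \<le> B"
  shows "rad_avg n H (\<lambda>h. 0) (\<lambda>h i. (a h i)\<^sup>2) \<le> 2 * B * rad_avg n H (\<lambda>h. 0) a"
proof (rule rad_avg_lipschitz)
  fix h h' i assume h: "h \<in> H" "h' \<in> H" "i < n"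
  have "(a h i)\<^sup>2 - (a h' i)\<^sup>2 = (a h i + a h' i) * (a h i - a h' i)"
    by (simp add: power2_eq_square algebra_simps)
  moreover have "\<bar>a h i + a h' i\<bar> \<le> 2 * B"
    using assms(3)[OF h(1,3)] assms(3)[OF h(2,3)] by linarith
  ultimately show "\<bar>(a h i)\<^sup>2 - (a h' i)\<^sup>2\<bar> \<le> 2 * B * \<bar>a h i - a h' i\<bar>"
    by (simp add: abs_mult mult_right_mono)
qed (use assms in \<open>auto intro: bounded_onI[of _ _ B]\<close>)

text \<open>Products are reduced to squares by polarization, \<open>4ab = (a + b)\<^sup>2 - (a - b)\<^sup>2\<close>.\<close>

lemma rad_avg_mult_le:
  assumes H: "H \<noteq> {}" and A: "0 \<le> A" "\<And>h i. h \<in> H \<Longrightarrow> i < n \<Longrightarrow> \<bar>a h i\<bar> \<le> A"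
    and B: "0 \<le> B" "\<And>h i. h \<in> H \<Longrightarrow> i < n \<Longrightarrow> \<bar>b h i\<bar> \<le> B"
  shows "rad_avg n H (\<lambda>h. 0) (\<lambda>h i. a h i * b h i)
         \<le> (A + B) * (rad_avg n H (\<lambda>h. 0) a + rad_avg n H (\<lambda>h. 0) b)"
proof -
  let ?r = "rad_avg n H (\<lambda>h. 0)"
  have ba: "bounded_on H (\<lambda>h. a h i)" "bounded_on H (\<lambda>h. b h i)" if "i < n" for i
    using A(2) B(2) that by (auto intro: bounded_onI[of _ _ A] bounded_onI[of _ _ B])
  have plus: "?r (\<lambda>h i. a h i + b h i) \<le> ?r a + ?r b"
    using rad_avg_add_le[of H n a b "\<lambda>_. 0" "\<lambda>_. 0"] ba H by simp
  \<comment> \<open>The average over signs does not see the sign of \<open>b\<close>.\<close>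
  have minus: "?r (\<lambda>h i. a h i - b h i) \<le> ?r a + ?r b"
    using rad_avg_add_le[of H n a "\<lambda>h i. - b h i" "\<lambda>_. 0" "\<lambda>_. 0"] ba H
    by (simp add: rad_avg_uminus bounded_on_uminus)
  have bnd: "\<bar>a h i + b h i\<bar> \<le> A + B" "\<bar>a h i - b h i\<bar> \<le> A + B" if "h \<in> H" "i < n" for h i
    using A(2)[OF that] B(2)[OF that] by linarith+
  let ?p = "\<lambda>h i. (a h i + b h i)\<^sup>2" and ?q = "\<lambda>h i. (a h i - b h i)\<^sup>2"
  have bpq: "bounded_on H (\<lambda>h. ?p h i)" "bounded_on H (\<lambda>h. ?q h i)" if "i < n" for i
  proof -
    show "bounded_on H (\<lambda>h. ?p h i)" 
      using bnd(1) that A B by (intro bounded_onI[of _ _ "(A + B)\<^sup>2"]) (simp add: abs_le_square_iff[symmetric])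
    show "bounded_on H (\<lambda>h. ?q h i)" 
      using bnd(2) that A B by (intro bounded_onI[of _ _ "(A + B)\<^sup>2"]) (simp add: abs_le_square_iff[symmetric])
  qed
  have "?r (\<lambda>h i. a h i * b h i) = ?r (\<lambda>h i. (1 / 4) * (?p h i + - ?q h i))"
    by (intro arg_cong[where f = ?r] ext) (simp add: power2_eq_square algebra_simps)
  also have "\<dots> = 1 / 4 * ?r (\<lambda>h i. ?p h i + - ?q h i)"
    using rad_avg_cmult[of H n "\<lambda>h i. ?p h i + - ?q h i" "\<lambda>_. 0" "1 / 4"] H bpq
    by (simp add: bounded_on_diff)
  also have "\<dots> \<le> 1 / 4 * (?r ?p + ?r ?q)"
    using rad_avg_add_le[of H n ?p "\<lambda>h i. - ?q h i" "\<lambda>_. 0" "\<lambda>_. 0"] H bpq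
    by (simp add: bounded_on_uminus rad_avg_uminus[of n H _ ?q])
  \<comment> \<open>Sum and difference lie in \<open>[-(A + B), A + B]\<close>, so each square costs
    \<open>2 * (A + B)\<close>; two squares and the factor \<open>1 / 4\<close> leave
    \<open>A + B\<close>.\<close>
  also have "\<dots> \<le> 1 / 4 * (2 * (A + B) * (?r a + ?r b) + 2 * (A + B) * (?r a + ?r b))"
  proof (intro mult_left_mono add_mono)
    have "?r ?p \<le> 2 * (A + B) * ?r (\<lambda>h i. a h i + b h i)"
      using H A(1) B(1) bnd by (intro rad_avg_square) auto
    also have "\<dots> \<le> 2 * (A + B) * (?r a + ?r b)"
      using plus A B by (intro mult_left_mono) auto
    finally show "?r ?p \<le> 2 * (A + B) * (?r a + ?r b)" .
    have "?r ?q \<le> 2 * (A + B) * ?r (\<lambda>h i. a h i - b h i)"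
      using H A(1) B(1) bnd by (intro rad_avg_square) auto
    also have "\<dots> \<le> 2 * (A + B) * (?r a + ?r b)"
      using minus A B by (intro mult_left_mono) auto
    finally show "?r ?q \<le> 2 * (A + B) * (?r a + ?r b)" .
  qed simp
  also have "\<dots> = (A + B) * (?r a + ?r b)" by (simp add: algebra_simps)
  finally show ?thesis .
qed

text \<open>Lets a class given as an image be handled as a family over its index set, which is where
  contraction compares two families.\<close>

lemma rad_avg_image: "rad_avg n (q ` H) c a = rad_avg n H (\<lambda>h. c (q h)) (\<lambda>h. a (q h))"
  by (induction n arbitrary: c) (simp_all add: image_image)

lemma rad_avg_cong:
  assumes "\<And>h. h \<in> H \<Longrightarrow> c h = d h" "\<And>h i. h \<in> H \<Longrightarrow> i < n \<Longrightarrow> a h i = b h i"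
  shows "rad_avg n H c a = rad_avg n H d b"
  using assms
proof (induction n arbitrary: c d)
  case 0
  then show ?case by (auto intro!: SUP_cong)
next
  case (Suc n)
  have "rad_avg n H (\<lambda>h. c h + a h n) a = rad_avg n H (\<lambda>h. d h + b h n) b"
    "rad_avg n H (\<lambda>h. c h - a h n) a = rad_avg n H (\<lambda>h. d h - b h n) b"
    using Suc.prems by (auto intro!: Suc.IH)
  then show ?case by simp
qed

text \<open>Polarization needs uniform bounds. The losses \<open>\<phi>\<close> have one, while the
  predictions \<open>a\<close> are bounded at each coordinate with no common constant required. So
  the product is split first, each factor is projected to its own component, and only then does the
  Lipschitz comparison replace \<open>\<phi>\<close> by \<open>a\<close>.\<close>

lemma rad_avg_product_class:
  fixes \<phi> a :: "'f \<Rightarrow> nat \<Rightarrow> real" and b :: "'g \<Rightarrow> nat \<Rightarrow> real"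
  assumes F: "F \<noteq> {}" and G: "G \<noteq> {}" and L: "0 \<le> L" and A: "0 \<le> A" and B: "0 \<le> B"
    and lip: "\<And>f f' i. f \<in> F \<Longrightarrow> f' \<in> F \<Longrightarrow> i < n \<Longrightarrow> \<bar>\<phi> f i - \<phi> f' i\<bar> \<le> L * \<bar>a f i - a f' i\<bar>"
    and \<phi>: "\<And>f i. f \<in> F \<Longrightarrow> i < n \<Longrightarrow> \<bar>\<phi> f i\<bar> \<le> A"
    and b: "\<And>g i. g \<in> G \<Longrightarrow> i < n \<Longrightarrow> \<bar>b g i\<bar> \<le> B"
    and a: "\<And>i. i < n \<Longrightarrow> bounded_on F (\<lambda>f. a f i)"
  shows "rad_avg n (F \<times> G) (\<lambda>_. 0) (\<lambda>k i. \<phi> (fst k) i * b (snd k) i)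
         \<le> (A + B) * (L * rad_avg n F (\<lambda>_. 0) a + rad_avg n G (\<lambda>_. 0) b)"
proof -
  have ne: "F \<times> G \<noteq> {}" using F G by auto
  have "rad_avg n (F \<times> G) (\<lambda>_. 0) (\<lambda>k i. \<phi> (fst k) i * b (snd k) i)
      \<le> (A + B) * (rad_avg n (F \<times> G) (\<lambda>_. 0) (\<lambda>k. \<phi> (fst k)) + rad_avg n (F \<times> G) (\<lambda>_. 0) (\<lambda>k. b (snd k)))"
    by (rule rad_avg_mult_le[OF ne A _ B]) (use \<phi> b in auto)
  also have "\<dots> \<le> (A + B) * (L * rad_avg n F (\<lambda>_. 0) a + rad_avg n G (\<lambda>_. 0) b)"
  proof (intro mult_left_mono add_mono)
    have "rad_avg n (F \<times> G) (\<lambda>_. 0) (\<lambda>k. \<phi> (fst k)) \<le> rad_avg n F (\<lambda>_. 0) \<phi>"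
      using \<phi> by (intro rad_avg_subset[where c = "\<lambda>_. 0"] ne) (auto intro: bounded_onI[of _ _ A])
    also have "\<dots> \<le> L * rad_avg n F (\<lambda>_. 0) a"
      by (rule rad_avg_lipschitz[OF F a L lip])
    finally show "rad_avg n (F \<times> G) (\<lambda>_. 0) (\<lambda>k. \<phi> (fst k)) \<le> L * rad_avg n F (\<lambda>_. 0) a" .
    show "rad_avg n (F \<times> G) (\<lambda>_. 0) (\<lambda>k. b (snd k)) \<le> rad_avg n G (\<lambda>_. 0) b"
      using b by (intro rad_avg_subset[where c = "\<lambda>_. 0"] ne) (auto intro: bounded_onI[of _ _ B])
  qed (use A B in auto)
  finally show ?thesis .
qed

section \<open>Rademacher complexity as an average over signs\<close>

text \<open>Extensional functions, so that the set is finite and coincides with the underlying set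
  of the product of two-point spaces.\<close>

definition signs :: "nat \<Rightarrow> (nat \<Rightarrow> real) set" where
  "signs n = {..<n} \<rightarrow>\<^sub>E {-1, 1}"

lemma finite_signs [simp]: "finite (signs n)"
  unfolding signs_def by (intro finite_PiE) auto

lemma card_signs: "card (signs n) = 2 ^ n"
  unfolding signs_def by (subst card_PiE) (auto simp: numeral_2_eq_2)

lemma signs_cases: "\<sigma> \<in> signs n \<Longrightarrow> i < n \<Longrightarrow> \<sigma> i = -1 \<or> \<sigma> i = 1"
  unfolding signs_def by (auto simp: PiE_iff)

text \<open>Both measures give a box the product of the relative sizes of its sides. With the signs
  uniform on a finite set, expectations over them become finite averages.\<close>

lemma PiM_signs:
  "(\<Pi>\<^sub>M i\<in>{..<n}. uniform_count_measure {-1, 1::real}) = uniform_count_measure (signs n)"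
    (is "?P = _")
proof -
  let ?U = "uniform_count_measure {-1, 1::real}"
  interpret U: prob_space ?U by (rule prob_space_uniform_count_measure) auto
  interpret product_sigma_finite "\<lambda>_::nat. ?U" by standard
  have sets: "sets (uniform_count_measure (signs n)) = sets ?P"
  proof -
    have "sets ?P = sets (\<Pi>\<^sub>M i\<in>{..<n}. count_space {-1, 1::real})"
      by (intro sets_PiM_cong refl) (simp add: sets_uniform_count_measure)
    also have "\<dots> = sets (count_space (signs n))"
      unfolding signs_def by (subst count_space_PiM_finite) auto
    finally show ?thesis by (simp add: sets_uniform_count_measure)
  qed
  have "uniform_count_measure (signs n) = ?P"
  proof (rule PiM_eqI[OF _ sets])
    fix A assume "\<And>i. i \<in> {..<n} \<Longrightarrow> A i \<in> sets ?U"
    then have A: "A i \<subseteq> {-1, 1}" if "i < n" for i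
      using that by (auto simp: sets_uniform_count_measure)
    then have sub: "Pi\<^sub>E {..<n} A \<subseteq> signs n" unfolding signs_def by (intro PiE_mono) auto
    have "emeasure (uniform_count_measure (signs n)) (Pi\<^sub>E {..<n} A)
        = ennreal ((\<Prod>i<n. real (card (A i))) / 2 ^ n)"
      using sub by (simp add: emeasure_uniform_count_measure card_signs card_PiE)
    also have "\<dots> = ennreal (\<Prod>i<n. real (card (A i)) / 2)"
      by (simp add: prod_dividef)
    also have "\<dots> = (\<Prod>i<n. ennreal (real (card (A i)) / 2))"
      by (subst prod_ennreal) auto
    also have "\<dots> = (\<Prod>i<n. emeasure ?U (A i))"
      using A by (intro prod.cong refl) (subst emeasure_uniform_count_measure, auto)
    finally show "emeasure (uniform_count_measure (signs n)) (Pi\<^sub>E {..<n} A)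
        = (\<Prod>i<n. emeasure ?U (A i))" .
  qed auto
  then show ?thesis ..
qed

lemma signs_Suc: "signs (Suc n) = (\<lambda>(y, \<sigma>). \<sigma>(n := y)) ` ({-1, 1} \<times> signs n)"
  unfolding signs_def lessThan_Suc PiE_insert_eq ..

lemma sum_signs_Suc:
  "(\<Sum>\<sigma>\<in>signs (Suc n). \<phi> \<sigma>) = (\<Sum>\<sigma>\<in>signs n. \<phi> (\<sigma>(n := -1)) + \<phi> (\<sigma>(n := 1)))"
proof -
  have "inj_on (\<lambda>(y, \<sigma>). \<sigma>(n := y)) ({-1, 1} \<times> signs n)"
    unfolding signs_def by (rule inj_combinator) simp
  then have "(\<Sum>\<sigma>\<in>signs (Suc n). \<phi> \<sigma>) = (\<Sum>(y, \<sigma>)\<in>{-1, 1} \<times> signs n. \<phi> (\<sigma>(n := y)))"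
    unfolding signs_Suc by (subst sum.reindex) (auto intro!: sum.cong)
  also have "\<dots> = (\<Sum>y\<in>{-1, 1}. \<Sum>\<sigma>\<in>signs n. \<phi> (\<sigma>(n := y)))"
    by (rule sum.cartesian_product[symmetric])
  finally show ?thesis by (simp add: sum.distrib)
qed

lemma sum_fun_upd_lessThan:
  fixes n :: nat
  shows "(\<Sum>i<n. (\<sigma>(n := y)) i * u i) = (\<Sum>i<n. \<sigma> i * (u i :: real))"
  by (intro sum.cong) auto

lemma rad_avg_eq_sum:
  "rad_avg n H c a = (\<Sum>\<sigma>\<in>signs n. SUP h\<in>H. c h + (\<Sum>i<n. \<sigma> i * a h i)) / 2 ^ n"
proof (induction n arbitrary: c)
  case 0
  show ?case by (simp add: signs_def)
next
  case (Suc n)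
  show ?case
    by (simp add: sum_signs_Suc Suc.IH sum_fun_upd_lessThan sum.distrib field_simps
        del: fun_upd_apply) (simp add: algebra_simps)
qed

text \<open>Flipping all signs is an involution of \<open>signs n\<close>; the restricted
  abstraction keeps the flipped vector extensional. This symmetry compares negative with positive
  parts and identifies the two halves of the symmetrized deviation.\<close>

lemma sum_signs_uminus: "(\<Sum>\<sigma>\<in>signs n. \<phi> (\<lambda>i\<in>{..<n}. - \<sigma> i)) = (\<Sum>\<sigma>\<in>signs n. \<phi> \<sigma>)"
proof -
  have inv: "(\<lambda>i\<in>{..<n}. - (\<lambda>i\<in>{..<n}. - \<sigma> i) i) = \<sigma>" if "\<sigma> \<in> signs n" for \<sigma>
    using that unfolding signs_def by (auto simp: PiE_iff extensional_def restrict_def)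
  have mem: "(\<lambda>i\<in>{..<n}. - \<sigma> i) \<in> signs n" if "\<sigma> \<in> signs n" for \<sigma>
    using that unfolding signs_def by (auto simp: PiE_iff)
  show ?thesis
    by (rule sum.reindex_bij_witness[where i = "\<lambda>\<sigma>. \<lambda>i\<in>{..<n}. - \<sigma> i"
          and j = "\<lambda>\<sigma>. \<lambda>i\<in>{..<n}. - \<sigma> i"])
      (rule inv mem refl | assumption)+
qed

lemma nn_integral_rademacher_space:
  assumes "prob_space D" and [measurable]: "\<phi> \<in> borel_measurable (rademacher_space n D)"
  shows "(\<integral>\<^sup>+z. \<phi> z \<partial>rademacher_space n D)
         = (\<Sum>\<sigma>\<in>signs n. ennreal (1 / 2 ^ n) * (\<integral>\<^sup>+x. \<phi> (\<sigma>, x) \<partial>(\<Pi>\<^sub>M i\<in>{..<n}. D)))"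
proof -
  let ?D = "\<Pi>\<^sub>M i\<in>{..<n}. D"
  interpret D: prob_space D by fact
  interpret DP: prob_space ?D by (intro prob_space_PiM assms)
  have [measurable]: "\<phi> \<in> borel_measurable (uniform_count_measure (signs n) \<Otimes>\<^sub>M ?D)"
    using assms(2) unfolding rademacher_space_def PiM_signs .
  have "(\<integral>\<^sup>+z. \<phi> z \<partial>rademacher_space n D)
      = (\<integral>\<^sup>+\<sigma>. \<integral>\<^sup>+x. \<phi> (\<sigma>, x) \<partial>?D \<partial>uniform_count_measure (signs n))"
    unfolding rademacher_space_def PiM_signs by (subst DP.nn_integral_fst) auto
  also have "\<dots> = (\<Sum>\<sigma>\<in>signs n. ennreal (1 / 2 ^ n) * (\<integral>\<^sup>+x. \<phi> (\<sigma>, x) \<partial>?D))"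
    unfolding uniform_count_measure_def
    by (subst nn_integral_point_measure_finite) (auto simp: card_signs)
  finally show ?thesis .
qed

lemma rademacher_sup_measurable:
  assumes "rademacher_measurable n D H" "\<sigma> \<in> signs n"
  shows "(\<lambda>x. rademacher_sup n H (\<sigma>, x)) \<in> borel_measurable (\<Pi>\<^sub>M i\<in>{..<n}. D)"
proof -
  have "rademacher_sup n H
      \<in> borel_measurable (uniform_count_measure (signs n) \<Otimes>\<^sub>M (\<Pi>\<^sub>M i\<in>{..<n}. D))"
    using assms(1) unfolding rademacher_measurable_def rademacher_space_def PiM_signs .
  from measurable_compose[OF measurable_Pair1' this] show ?thesis
    using assms(2) by (simp add: space_uniform_count_measure)
qed

lemma rademacher_sup_upper:
  "h \<in> H \<Longrightarrow> ereal (1 / real n * (\<Sum>i<n. \<sigma> i * h (x i))) \<le> rademacher_sup n H (\<sigma>, x)"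
  unfolding rademacher_sup_def by (auto intro: SUP_upper)

text \<open>One member \<open>h\<close> suffices: minus its signed mean is its signed mean at the
  flipped vector, and the supremum there dominates it.\<close>

lemma uminus_rademacher_sup_le:
  assumes "H \<noteq> {}"
  shows "- rademacher_sup n H (\<sigma>, x) \<le> rademacher_sup n H (\<lambda>i\<in>{..<n}. - \<sigma> i, x)"
proof -
  obtain h where h: "h \<in> H" using assms by blast
  have "- rademacher_sup n H (\<sigma>, x) \<le> - ereal (1 / real n * (\<Sum>i<n. \<sigma> i * h (x i)))"
    using rademacher_sup_upper[OF h] by (simp only: ereal_minus_le_minus)
  also have "\<dots> = ereal (1 / real n * (\<Sum>i<n. (\<lambda>i\<in>{..<n}. - \<sigma> i) i * h (x i)))"
    by (simp add: sum_negf)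
  also have "\<dots> \<le> rademacher_sup n H (\<lambda>i\<in>{..<n}. - \<sigma> i, x)"
    by (rule rademacher_sup_upper[OF h])
  finally show ?thesis .
qed

text \<open>For \<open>p = q = \<infinity>\<close> the difference is \<open>\<infinity>\<close> by
  convention, so this case is covered as well.\<close>

lemma enn2ereal_diff_nonneg: "q \<le> p \<Longrightarrow> 0 \<le> enn2ereal p - enn2ereal q"
  by (cases p; cases q) (auto simp: enn2ereal_ennreal top_unique)

lemma enn2ereal_diff_finite: "p < \<infinity> \<Longrightarrow> enn2ereal p - enn2ereal q \<noteq> \<infinity>"
  by (cases p; cases q) (auto simp: enn2ereal_ennreal)

text \<open>The empirical complexity of the sample \<open>x\<close>: signs averaged out, sample
  kept. \<open>real_of_ereal\<close> sends infinite suprema to 0, so the value is meaningful only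
  where they are finite.\<close>

definition rad_mean :: "nat \<Rightarrow> ('a \<Rightarrow> real) set \<Rightarrow> (nat \<Rightarrow> 'a) \<Rightarrow> real" where
  "rad_mean n H x = (\<Sum>\<sigma>\<in>signs n. real_of_ereal (rademacher_sup n H (\<sigma>, x))) / 2 ^ n"

text \<open>Positive and negative parts are kept as extended nonnegative integrals, because
  integrability will be a consequence of finite complexity and cannot be presupposed.\<close>

definition rad_pos :: "'a measure \<Rightarrow> nat \<Rightarrow> ('a \<Rightarrow> real) set \<Rightarrow> (nat \<Rightarrow> real) \<Rightarrow> ennreal" where
  "rad_pos D n H \<sigma> = (\<integral>\<^sup>+x. e2ennreal (rademacher_sup n H (\<sigma>, x)) \<partial>(\<Pi>\<^sub>M i\<in>{..<n}. D))"

definition rad_neg :: "'a measure \<Rightarrow> nat \<Rightarrow> ('a \<Rightarrow> real) set \<Rightarrow> (nat \<Rightarrow> real) \<Rightarrow> ennreal" where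
  "rad_neg D n H \<sigma> = (\<integral>\<^sup>+x. e2ennreal (- rademacher_sup n H (\<sigma>, x)) \<partial>(\<Pi>\<^sub>M i\<in>{..<n}. D))"

context
  fixes D :: "'a measure" and n :: nat and H :: "('a \<Rightarrow> real) set"
  assumes D: "prob_space D" and meas: "rademacher_measurable n D H" and H: "H \<noteq> {}"
begin


lemma rademacher_eq_pos_neg:
  "rademacher n D H = enn2ereal (\<Sum>\<sigma>\<in>signs n. ennreal (1 / 2 ^ n) * rad_pos D n H \<sigma>)
                    - enn2ereal (\<Sum>\<sigma>\<in>signs n. ennreal (1 / 2 ^ n) * rad_neg D n H \<sigma>)"
proof -
  have [measurable]: "rademacher_sup n H \<in> borel_measurable (rademacher_space n D)"
    using meas unfolding rademacher_measurable_def .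
  show ?thesis
    unfolding rademacher_def ereal_expectation_def rad_pos_def rad_neg_def
    by (subst (1 2) nn_integral_rademacher_space[OF D]) auto
qed

text \<open>The negative part at \<open>\<sigma>\<close> is dominated by the positive part at the
  flipped vector, and flipping permutes the sign vectors. Hence complexities are nonnegative, and
  finiteness of the difference controls both parts.\<close>

lemma rad_neg_le_pos: 
  "(\<Sum>\<sigma>\<in>signs n. ennreal (1 / 2 ^ n) * rad_neg D n H \<sigma>) \<le> (\<Sum>\<sigma>\<in>signs n. ennreal (1 / 2 ^ n) * rad_pos D n H \<sigma>)"
proof -
  have "rad_neg D n H \<sigma> \<le> rad_pos D n H (\<lambda>i\<in>{..<n}. - \<sigma> i)" for \<sigma>
    unfolding rad_neg_def rad_pos_def
    by (intro nn_integral_mono e2ennreal_mono uminus_rademacher_sup_le H)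
  then have "(\<Sum>\<sigma>\<in>signs n. ennreal (1 / 2 ^ n) * rad_neg D n H \<sigma>)
      \<le> (\<Sum>\<sigma>\<in>signs n. ennreal (1 / 2 ^ n) * rad_pos D n H (\<lambda>i\<in>{..<n}. - \<sigma> i))"
    by (intro sum_mono mult_left_mono) auto
  also have "\<dots> = (\<Sum>\<sigma>\<in>signs n. ennreal (1 / 2 ^ n) * rad_pos D n H \<sigma>)"
    by (rule sum_signs_uminus)
  finally show ?thesis .
qed

lemma rademacher_nonneg: "0 \<le> rademacher n D H"
  unfolding rademacher_eq_pos_neg by (rule enn2ereal_diff_nonneg[OF rad_neg_le_pos])

text \<open>An infinite positive part makes the difference infinite even when the negative part is
  infinite too, so finite complexity forces a finite positive part, and the negative part lies below
  it. All weights are positive, so each summand is finite.\<close>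

lemma rad_pos_neg_finite:
  assumes "rademacher n D H \<noteq> \<infinity>" "\<sigma> \<in> signs n"
  shows "rad_pos D n H \<sigma> \<noteq> \<infinity>" "rad_neg D n H \<sigma> \<noteq> \<infinity>"
proof -
  have P: "(\<Sum>\<sigma>\<in>signs n. ennreal (1 / 2 ^ n) * rad_pos D n H \<sigma>) \<noteq> \<infinity>"
    using assms(1) unfolding rademacher_eq_pos_neg by fastforce
  then have N: "(\<Sum>\<sigma>\<in>signs n. ennreal (1 / 2 ^ n) * rad_neg D n H \<sigma>) \<noteq> \<infinity>"
    using rad_neg_le_pos by (metis infinity_ennreal_def neq_top_trans)
  show "rad_pos D n H \<sigma> \<noteq> \<infinity>"
    using P assms(2) by (auto simp: ennreal_mult_eq_top_iff)
  show "rad_neg D n H \<sigma> \<noteq> \<infinity>"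
    using N assms(2) by (auto simp: ennreal_mult_eq_top_iff)
qed

lemma rademacher_sup_finite_AE:
  assumes "rademacher n D H \<noteq> \<infinity>" "\<sigma> \<in> signs n"
  shows "AE x in (\<Pi>\<^sub>M i\<in>{..<n}. D). \<bar>rademacher_sup n H (\<sigma>, x)\<bar> \<noteq> \<infinity>"
proof -
  have [measurable]: "(\<lambda>x. rademacher_sup n H (\<sigma>, x)) \<in> borel_measurable (\<Pi>\<^sub>M i\<in>{..<n}. D)"
    by (rule rademacher_sup_measurable[OF meas assms(2)])
  have "AE x in (\<Pi>\<^sub>M i\<in>{..<n}. D). e2ennreal (rademacher_sup n H (\<sigma>, x)) \<noteq> \<infinity>"
    using rad_pos_neg_finite[OF assms] unfolding rad_pos_def by (intro nn_integral_PInf_AE) auto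
  moreover have "AE x in (\<Pi>\<^sub>M i\<in>{..<n}. D). e2ennreal (- rademacher_sup n H (\<sigma>, x)) \<noteq> \<infinity>"
    using rad_pos_neg_finite[OF assms] unfolding rad_neg_def by (intro nn_integral_PInf_AE) auto
  ultimately show ?thesis
  proof eventually_elim
    case (elim x)
    then show ?case by (cases "rademacher_sup n H (\<sigma>, x)") (auto simp: ennreal.abs_eq)
  qed
qed

lemma rademacher_sup_integral:
  assumes "rademacher n D H \<noteq> \<infinity>" "\<sigma> \<in> signs n"
  shows "integrable (\<Pi>\<^sub>M i\<in>{..<n}. D) (\<lambda>x. real_of_ereal (rademacher_sup n H (\<sigma>, x)))"
    and "(\<integral>x. real_of_ereal (rademacher_sup n H (\<sigma>, x)) \<partial>(\<Pi>\<^sub>M i\<in>{..<n}. D))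
         = enn2real (rad_pos D n H \<sigma>) - enn2real (rad_neg D n H \<sigma>)"
proof -
  let ?P = "\<Pi>\<^sub>M i\<in>{..<n}. D" and ?f = "\<lambda>x. real_of_ereal (rademacher_sup n H (\<sigma>, x))"
  have [measurable]: "(\<lambda>x. rademacher_sup n H (\<sigma>, x)) \<in> borel_measurable ?P"
    by (rule rademacher_sup_measurable[OF meas assms(2)])
  have pos: "(\<integral>\<^sup>+x. ennreal (?f x) \<partial>?P) = rad_pos D n H \<sigma>"
    unfolding rad_pos_def using rademacher_sup_finite_AE[OF assms]
    by (intro nn_integral_cong_AE) (auto simp: ennreal.abs_eq elim!: eventually_mono)
  have neg: "(\<integral>\<^sup>+x. ennreal (- ?f x) \<partial>?P) = rad_neg D n H \<sigma>"
    unfolding rad_neg_def using rademacher_sup_finite_AE[OF assms]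
    by (intro nn_integral_cong_AE) (auto simp: ennreal.abs_eq elim!: eventually_mono)
  show "integrable ?P ?f"
    using rad_pos_neg_finite[OF assms] pos neg by (intro real_integrable_def[THEN iffD2]) auto
  then show "(\<integral>x. ?f x \<partial>?P) = enn2real (rad_pos D n H \<sigma>) - enn2real (rad_neg D n H \<sigma>)"
    using pos neg by (simp add: real_lebesgue_integral_def)
qed

lemma rademacher_eq_integral:
  assumes "rademacher n D H \<noteq> \<infinity>"
  shows "integrable (\<Pi>\<^sub>M i\<in>{..<n}. D) (rad_mean n H)"
    and "rademacher n D H = ereal (\<integral>x. rad_mean n H x \<partial>(\<Pi>\<^sub>M i\<in>{..<n}. D))"
proof -
  show "integrable (\<Pi>\<^sub>M i\<in>{..<n}. D) (rad_mean n H)"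
    unfolding rad_mean_def[abs_def] using rademacher_sup_integral[OF assms] by auto
  have *: "enn2ereal (\<Sum>\<sigma>\<in>signs n. ennreal (1 / 2 ^ n) * p \<sigma>)
      = ereal ((\<Sum>\<sigma>\<in>signs n. enn2real (p \<sigma>)) / 2 ^ n)"
    if "\<And>\<sigma>. \<sigma> \<in> signs n \<Longrightarrow> p \<sigma> \<noteq> \<infinity>" for p
  proof -
    have "(\<Sum>\<sigma>\<in>signs n. ennreal (1 / 2 ^ n) * p \<sigma>)
        = (\<Sum>\<sigma>\<in>signs n. ennreal (enn2real (p \<sigma>) / 2 ^ n))"
    proof (intro sum.cong refl)
      fix \<sigma> assume "\<sigma> \<in> signs n"
      then have "p \<sigma> = ennreal (enn2real (p \<sigma>))" using that by (simp add: less_top)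
      then show "ennreal (1 / 2 ^ n) * p \<sigma> = ennreal (enn2real (p \<sigma>) / 2 ^ n)"
        by (metis ennreal_mult'' enn2real_nonneg mult.commute mult_1 times_divide_eq_right)
    qed
    also have "\<dots> = ennreal (\<Sum>\<sigma>\<in>signs n. enn2real (p \<sigma>) / 2 ^ n)"
      by (rule sum_ennreal) simp
    finally show ?thesis
      by (simp add: enn2ereal_ennreal sum_nonneg sum_divide_distrib)
  qed
  have "rademacher n D H = ereal ((\<Sum>\<sigma>\<in>signs n. enn2real (rad_pos D n H \<sigma>) - enn2real (rad_neg D n H \<sigma>)) / 2 ^ n)"
    unfolding rademacher_eq_pos_neg
    using rad_pos_neg_finite[OF assms]
    by (subst (1 2) *) (auto simp: sum_subtractf diff_divide_distrib)
  then show "rademacher n D H = ereal (\<integral>x. rad_mean n H x \<partial>(\<Pi>\<^sub>M i\<in>{..<n}. D))"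
    unfolding rad_mean_def using rademacher_sup_integral[OF assms] by simp
qed

end

text \<open>Two sign vectors that agree at \<open>i\<close> and are opposite elsewhere add up to
  twice coordinate \<open>i\<close>. Adding the corresponding suprema therefore bounds
  \<open>h (x i)\<close> from above for sign 1 at \<open>i\<close>, and from below for sign
  -1.\<close>

lemma bounded_on_of_rademacher_sup:
  assumes "0 < n" "H \<noteq> {}" "\<And>\<sigma>. \<sigma> \<in> signs n \<Longrightarrow> \<bar>rademacher_sup n H (\<sigma>, x)\<bar> \<noteq> \<infinity>" "i < n"
  shows "bounded_on H (\<lambda>h. h (x i))"
proof -
  define \<sigma> where "\<sigma> s t = (\<lambda>j\<in>{..<n}. if j = i then s else t)" for s t :: real
  have \<sigma>: "\<sigma> s t \<in> signs n" if "s \<in> {-1, 1}" "t \<in> {-1, 1}" for s t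
    using that unfolding \<sigma>_def signs_def by auto
  define r where "r s t = real_of_ereal (rademacher_sup n H (\<sigma> s t, x))" for s t
  have r: "1 / real n * (\<Sum>j<n. \<sigma> s t j * h (x j)) \<le> r s t"
    if "s \<in> {-1, 1}" "t \<in> {-1, 1}" "h \<in> H" for s t h
    using rademacher_sup_upper[OF that(3), of n "\<sigma> s t" x] assms(3)[OF \<sigma>[OF that(1,2)]]
    unfolding r_def by (metis ereal_less_eq(3) ereal_real')
  have two: "2 * s * h (x i) / real n \<le> r s 1 + r s (-1)" if "s \<in> {-1, 1}" "h \<in> H" for s h
  proof -
    have "(\<Sum>j<n. \<sigma> s 1 j * h (x j)) + (\<Sum>j<n. \<sigma> s (-1) j * h (x j))
        = (\<Sum>j<n. if j = i then 2 * s * h (x j) else 0)"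
      unfolding sum.distrib[symmetric] \<sigma>_def by (intro sum.cong) auto
    also have "\<dots> = 2 * s * h (x i)" using assms(4) by simp
    finally have "2 * s * h (x i) / real n
        = 1 / real n * (\<Sum>j<n. \<sigma> s 1 j * h (x j)) + 1 / real n * (\<Sum>j<n. \<sigma> s (-1) j * h (x j))"
      by (simp add: add_divide_distrib[symmetric])
    moreover have "1 / real n * (\<Sum>j<n. \<sigma> s 1 j * h (x j)) \<le> r s 1"
      "1 / real n * (\<Sum>j<n. \<sigma> s (-1) j * h (x j)) \<le> r s (-1)"
      using that by (auto intro!: r simp del: mult_1 times_divide_eq_left)
    ultimately show ?thesis by linarith
  qed
  show ?thesis
  proof (rule bounded_onI)
    fix h assume h: "h \<in> H"
    show "\<bar>h (x i)\<bar> \<le> real n * (\<bar>r 1 1 + r 1 (-1)\<bar> + \<bar>r (-1) 1 + r (-1) (-1)\<bar>)"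
    proof -
      have "2 * (h (x i) / real n) \<le> r 1 1 + r 1 (-1)" "- (2 * (h (x i) / real n)) \<le> r (-1) 1 + r (-1) (-1)"
        using two[of 1 h] two[of "-1" h] h by simp_all
      then have "\<bar>h (x i) / real n\<bar> \<le> \<bar>r 1 1 + r 1 (-1)\<bar> + \<bar>r (-1) 1 + r (-1) (-1)\<bar>"
        by linarith
      then show ?thesis using assms(1) by (simp add: abs_divide field_simps)
    qed
  qed
qed

text \<open>Boundedness at the sample points makes the extended supremum finite and equal to the
  real one, so that the calculus of \<open>rad_avg\<close> applies.\<close>

lemma rad_mean_eq_rad_avg:
  assumes "0 < n" "H \<noteq> {}" "\<And>i. i < n \<Longrightarrow> bounded_on H (\<lambda>h. h (x i))"
  shows "rad_mean n H x = rad_avg n H (\<lambda>_. 0) (\<lambda>h i. h (x i)) / real n"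
    and "\<And>\<sigma>. rademacher_sup n H (\<sigma>, x) = ereal ((SUP h\<in>H. \<Sum>i<n. \<sigma> i * h (x i)) / real n)"
proof -
  show *: "rademacher_sup n H (\<sigma>, x) = ereal ((SUP h\<in>H. \<Sum>i<n. \<sigma> i * h (x i)) / real n)" for \<sigma>
  proof -
    have b: "bounded_on H (\<lambda>h. \<Sum>i<n. \<sigma> i * h (x i))"
      using assms(3) by (intro bounded_on_intros) auto
    then have b': "bounded_on H (\<lambda>h. 1 / real n * (\<Sum>i<n. \<sigma> i * h (x i)))"
      by (rule bounded_on_cmult)
    obtain B where B: "\<And>h. h \<in> H \<Longrightarrow> \<bar>1 / real n * (\<Sum>i<n. \<sigma> i * h (x i))\<bar> \<le> B"
      using b' unfolding bounded_on_def by blast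
    have "\<bar>SUP h\<in>H. ereal (1 / real n * (\<Sum>i<n. \<sigma> i * h (x i)))\<bar> \<noteq> \<infinity>"
    proof -
      have "(SUP h\<in>H. ereal (1 / real n * (\<Sum>i<n. \<sigma> i * h (x i)))) \<le> ereal B"
        using B by (intro SUP_least) (simp only: ereal_less_eq(3), blast dest: abs_le_D1)
      moreover obtain h where "h \<in> H" using assms by blast
      then have "ereal (1 / real n * (\<Sum>i<n. \<sigma> i * h (x i)))
          \<le> (SUP h\<in>H. ereal (1 / real n * (\<Sum>i<n. \<sigma> i * h (x i))))" by (rule SUP_upper)
      ultimately show ?thesis by auto
    qed
    then have "rademacher_sup n H (\<sigma>, x) = ereal (SUP h\<in>H. 1 / real n * (\<Sum>i<n. \<sigma> i * h (x i)))"
      unfolding rademacher_sup_def prod.case by (rule ereal_SUP[symmetric])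
    also have "\<dots> = ereal (1 / real n * (SUP h\<in>H. \<Sum>i<n. \<sigma> i * h (x i)))"
      using SUP_cmult_real[OF assms(2) b, of "1 / real n"] by simp
    finally show ?thesis by simp
  qed
  show "rad_mean n H x = rad_avg n H (\<lambda>_. 0) (\<lambda>h i. h (x i)) / real n"
    unfolding rad_mean_def * rad_avg_eq_sum by (simp add: sum_divide_distrib mult.commute)
qed

text \<open>Stands in for a uniform bound in the case of a class such as \<open>F\<close>, about
  which only finite complexity is known.\<close>

lemma rademacher_AE:
  assumes "prob_space D" "rademacher_measurable n D H" "H \<noteq> {}" "0 < n" "rademacher n D H \<noteq> \<infinity>"
  shows "AE x in (\<Pi>\<^sub>M i\<in>{..<n}. D). (\<forall>i<n. bounded_on H (\<lambda>h. h (x i)))"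
proof -
  have "AE x in (\<Pi>\<^sub>M i\<in>{..<n}. D). \<forall>\<sigma>\<in>signs n. \<bar>rademacher_sup n H (\<sigma>, x)\<bar> \<noteq> \<infinity>"
    using rademacher_sup_finite_AE[OF assms(1-3,5)] by (intro AE_finite_allI) auto
  then show ?thesis
    by eventually_elim (auto intro!: bounded_on_of_rademacher_sup[OF assms(4,3)])
qed

lemma abs_rademacher_sup_le:
  assumes "0 < n" "H \<noteq> {}" "\<And>h i. h \<in> H \<Longrightarrow> i < n \<Longrightarrow> \<bar>h (x i)\<bar> \<le> B" "\<sigma> \<in> signs n"
  shows "\<bar>rademacher_sup n H (\<sigma>, x)\<bar> \<le> ereal B"
proof -
  have *: "\<bar>1 / real n * (\<Sum>i<n. \<sigma> i * h (x i))\<bar> \<le> B" if "h \<in> H" for h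
  proof -
    have "\<bar>\<Sum>i<n. \<sigma> i * h (x i)\<bar> \<le> (\<Sum>i<n. B)"
    proof (rule order_trans[OF sum_abs sum_mono])
      fix i assume "i \<in> {..<n}"
      then show "\<bar>\<sigma> i * h (x i)\<bar> \<le> B"
        using assms(3)[OF that, of i] signs_cases[OF assms(4), of i] by (auto simp: abs_mult)
    qed
    then show ?thesis using assms(1) by (simp add: abs_mult field_simps)
  qed
  obtain h where h: "h \<in> H" using assms by blast
  have "ereal (- B) \<le> rademacher_sup n H (\<sigma>, x)"
    using rademacher_sup_upper[OF h, of n \<sigma> x] *[OF h]
    by (metis abs_le_D2 ereal_less_eq(3) minus_le_iff order_trans)
  moreover have "rademacher_sup n H (\<sigma>, x) \<le> ereal B"
    unfolding rademacher_sup_def prod.case using * by (intro SUP_least) (metis abs_le_D1 ereal_less_eq(3))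
  ultimately show ?thesis by (cases "rademacher_sup n H (\<sigma>, x)") auto
qed

lemma rademacher_bounded_finite:
  assumes "prob_space D" "rademacher_measurable n D H" "H \<noteq> {}" "0 < n"
    "\<And>h x. h \<in> H \<Longrightarrow> x \<in> space D \<Longrightarrow> \<bar>h x\<bar> \<le> B"
  shows "rademacher n D H \<noteq> \<infinity>"
proof -
  interpret DP: prob_space "\<Pi>\<^sub>M i\<in>{..<n}. D" by (intro prob_space_PiM assms)
  have "rad_pos D n H \<sigma> \<le> ennreal B" if "\<sigma> \<in> signs n" for \<sigma>
  proof -
    have "rad_pos D n H \<sigma> \<le> (\<integral>\<^sup>+x. ennreal B \<partial>(\<Pi>\<^sub>M i\<in>{..<n}. D))"
      unfolding rad_pos_def
    proof (rule nn_integral_mono)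
      fix x assume "x \<in> space (\<Pi>\<^sub>M i\<in>{..<n}. D)"
      then have "\<bar>rademacher_sup n H (\<sigma>, x)\<bar> \<le> ereal B"
        using assms that by (intro abs_rademacher_sup_le) (auto simp: space_PiM PiE_iff)
      then have "e2ennreal (rademacher_sup n H (\<sigma>, x)) \<le> e2ennreal (ereal B)"
        by (intro e2ennreal_mono) (cases "rademacher_sup n H (\<sigma>, x)"; simp)
      then show "e2ennreal (rademacher_sup n H (\<sigma>, x)) \<le> ennreal B" by (simp add: ennreal.abs_eq)
    qed
    then show ?thesis by (simp add: DP.emeasure_space_1)
  qed
  then have "(\<Sum>\<sigma>\<in>signs n. ennreal (1 / 2 ^ n) * rad_pos D n H \<sigma>)
      \<le> (\<Sum>\<sigma>\<in>signs n. ennreal (1 / 2 ^ n) * ennreal B)"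
    by (intro sum_mono mult_left_mono) auto
  also have "\<dots> < \<infinity>" by (auto simp: ennreal_mult_less_top of_nat_less_top)
  finally have "(\<Sum>\<sigma>\<in>signs n. ennreal (1 / 2 ^ n) * rad_pos D n H \<sigma>) < \<infinity>" .
  then show ?thesis
    unfolding rademacher_eq_pos_neg[OF assms(1-3)]
    by (rule enn2ereal_diff_finite)
qed

section \<open>Symmetrization\<close>

text \<open>The preimage of a box under the exchange is a product of two boxes. Coordinate
  \<open>i\<close> contributes \<open>emeasure D (A i)\<close> through exactly one of them and the
  full mass 1 through the other.\<close>

lemma distr_PiM_swap:
  fixes p :: "'i \<Rightarrow> bool" and D :: "'a measure"
  assumes D: "prob_space D" and I: "finite I"
  defines "P \<equiv> \<Pi>\<^sub>M i\<in>I. D"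
  shows "distr (P \<Otimes>\<^sub>M P) P (\<lambda>(x, y). \<lambda>i\<in>I. if p i then y i else x i) = P"
proof -
  interpret D: prob_space D by fact
  interpret product_sigma_finite "\<lambda>_::'i. D" by standard
  interpret P: prob_space P unfolding P_def by (intro prob_space_PiM D)
  let ?z = "\<lambda>(x, y). \<lambda>i\<in>I. if p i then y i else x i"
  have z: "?z \<in> P \<Otimes>\<^sub>M P \<rightarrow>\<^sub>M P"
    unfolding P_def split_beta
  proof (rule measurable_restrict)
    fix i assume "i \<in> I"
    then show "(\<lambda>x. if p i then snd x i else fst x i) \<in> Pi\<^sub>M I (\<lambda>i. D) \<Otimes>\<^sub>M Pi\<^sub>M I (\<lambda>i. D) \<rightarrow>\<^sub>M D"
      by (cases "p i") auto
  qed
  show ?thesis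
    unfolding P_def
  proof (rule PiM_eqI[OF I])
    fix A assume A: "\<And>i. i \<in> I \<Longrightarrow> A i \<in> sets D"
    let ?B = "\<lambda>i. if p i then space D else A i" and ?C = "\<lambda>i. if p i then A i else space D"
    have BC: "\<And>i. i \<in> I \<Longrightarrow> ?B i \<in> sets D" "\<And>i. i \<in> I \<Longrightarrow> ?C i \<in> sets D"
      using A by auto
    have sub: "A i \<subseteq> space D" if "i \<in> I" for i using A[OF that] sets.sets_into_space by blast
    have "?z -` Pi\<^sub>E I A \<inter> space (P \<Otimes>\<^sub>M P) = Pi\<^sub>E I ?B \<times> Pi\<^sub>E I ?C"
    proof -
      have pw: "(\<forall>i\<in>I. (if p i then y i else x i) \<in> A i) \<and> (\<forall>i\<in>I. x i \<in> space D) \<and> (\<forall>i\<in>I. y i \<in> space D)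
          \<longleftrightarrow> (\<forall>i\<in>I. x i \<in> ?B i) \<and> (\<forall>i\<in>I. y i \<in> ?C i)" (is "?l \<longleftrightarrow> ?r") for x y
      proof
        assume ?l then show ?r by auto
      next
        assume r: ?r
        have "(if p i then y i else x i) \<in> A i \<and> x i \<in> space D \<and> y i \<in> space D" if "i \<in> I" for i
          using r[THEN conjunct1, rule_format, OF that] r[THEN conjunct2, rule_format, OF that] sub[OF that]
          by (cases "p i") auto
        then show ?l by blast
      qed
      have zm: "?z (x, y) \<in> Pi\<^sub>E I A \<and> x \<in> (\<Pi>\<^sub>E i\<in>I. space D) \<and> y \<in> (\<Pi>\<^sub>E i\<in>I. space D)
          \<longleftrightarrow> x \<in> Pi\<^sub>E I ?B \<and> y \<in> Pi\<^sub>E I ?C" for x y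
        using pw[of y x] by (simp add: PiE_iff split del: if_split) blast
      show ?thesis
        unfolding P_def space_pair_measure space_PiM
      proof (rule set_eqI)
        fix u :: "('i \<Rightarrow> 'a) \<times> ('i \<Rightarrow> 'a)"
        obtain x y where u: "u = (x, y)" by (cases u)
        show "u \<in> ?z -` Pi\<^sub>E I A \<inter> (\<Pi>\<^sub>E i\<in>I. space D) \<times> (\<Pi>\<^sub>E i\<in>I. space D)
            \<longleftrightarrow> u \<in> Pi\<^sub>E I ?B \<times> Pi\<^sub>E I ?C"
          using zm[of x y] unfolding u by (simp only: vimage_eq Int_iff mem_Sigma_iff)
      qed
    qed
    moreover have "Pi\<^sub>E I A \<in> sets P"
      unfolding P_def using A I by (intro sets_PiM_I_finite) auto
    ultimately have "emeasure (distr (P \<Otimes>\<^sub>M P) P ?z) (Pi\<^sub>E I A)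
        = emeasure (P \<Otimes>\<^sub>M P) (Pi\<^sub>E I ?B \<times> Pi\<^sub>E I ?C)"
      using z by (simp add: emeasure_distr)
    also have "\<dots> = emeasure P (Pi\<^sub>E I ?B) * emeasure P (Pi\<^sub>E I ?C)"
      unfolding P_def using BC I
      by (intro sigma_finite_measure.emeasure_pair_measure_Times sets_PiM_I_finite)
         (auto intro: prob_space_imp_sigma_finite prob_space_PiM D)
    also have "\<dots> = (\<Prod>i\<in>I. emeasure D (?B i)) * (\<Prod>i\<in>I. emeasure D (?C i))"
      unfolding P_def using BC I by (simp add: emeasure_PiM)
    also have "\<dots> = (\<Prod>i\<in>I. emeasure D (A i))"
      unfolding prod.distrib[symmetric]
      by (intro prod.cong refl) (auto simp: D.emeasure_space_1)
    finally show "emeasure (distr (Pi\<^sub>M I (\<lambda>i. D) \<Otimes>\<^sub>M Pi\<^sub>M I (\<lambda>i. D)) (Pi\<^sub>M I (\<lambda>i. D)) ?z) (Pi\<^sub>E I A)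
        = (\<Prod>i\<in>I. emeasure D (A i))" unfolding P_def .
  qed simp
qed

lemma integral_PiM_component:
  fixes h :: "'a \<Rightarrow> real"
  assumes D: "prob_space D" and "finite I" "i \<in> I" and h: "h \<in> borel_measurable D"
  shows "(\<integral>x. h (x i) \<partial>(\<Pi>\<^sub>M i\<in>I. D)) = (\<integral>x. h x \<partial>D)"
proof -
  have "(\<integral>x. h x \<partial>D) = (\<integral>x. h x \<partial>distr (\<Pi>\<^sub>M i\<in>I. D) D (\<lambda>x. x i))"
    using distr_PiM_component[of I "\<lambda>_. D" i] assms by simp
  also have "\<dots> = (\<integral>x. h (x i) \<partial>(\<Pi>\<^sub>M i\<in>I. D))"
    using assms by (intro integral_distr) auto
  finally show ?thesis ..
qed

text \<open>
  For a fixed sign vector \<open>\<sigma>\<close>, exchanging the sample with its ghost copy at the coordinates where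
  \<open>\<sigma> i = 1\<close> preserves the law of the pair. This bounds the deviation of the empirical mean by a
  measurable function of the sample, so the measurability of its supremum is not an issue.
\<close>

lemma symmetrization_signs:
  assumes D: "prob_space D" and meas: "rademacher_measurable n D H" and H: "H \<noteq> {}"
    and n: "0 < n"
    and h_meas: "\<And>h. h \<in> H \<Longrightarrow> h \<in> borel_measurable D"
    and bound: "\<And>h x. h \<in> H \<Longrightarrow> x \<in> space D \<Longrightarrow> \<bar>h x\<bar> \<le> B"
    and \<sigma>: "\<sigma> \<in> signs n"
  defines "P \<equiv> \<Pi>\<^sub>M i\<in>{..<n}. D"
    and "s \<equiv> \<lambda>\<sigma> x. real_of_ereal (rademacher_sup n H (\<sigma>, x))"
  shows "\<exists>U. U \<in> borel_measurable P \<and> (\<forall>x\<in>space P. \<bar>U x\<bar> \<le> 2 * B) \<and>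
      (\<forall>x\<in>space P. \<forall>h\<in>H. (\<integral>t. h t \<partial>D) - (\<Sum>i<n. h (x i)) / real n \<le> U x) \<and>
      (\<integral>x. U x \<partial>P) = (\<integral>x. s \<sigma> x \<partial>P) + (\<integral>x. s (\<lambda>i\<in>{..<n}. - \<sigma> i) x \<partial>P)"
proof -
  interpret D: prob_space D by fact
  interpret P: prob_space P unfolding P_def by (intro prob_space_PiM D)
  interpret PP: pair_prob_space P P by standard
  let ?\<tau> = "\<lambda>i\<in>{..<n}. - \<sigma> i"
  have \<tau>: "?\<tau> \<in> signs n" using \<sigma> unfolding signs_def by (auto simp: PiE_iff)
  have B0: "0 \<le> B" using H D.not_empty bound by (metis abs_ge_zero ex_in_conv order_trans)
  have spaceP: "x i \<in> space D" if "x \<in> space P" "i < n" for x i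
    using that unfolding P_def space_PiM by auto
  have s_meas [measurable]: "s \<sigma> \<in> borel_measurable P" if "\<sigma> \<in> signs n" for \<sigma>
    using rademacher_sup_measurable[OF meas that] unfolding s_def P_def by measurable
  have s_le: "\<bar>s \<sigma> x\<bar> \<le> B" if "\<sigma> \<in> signs n" "x \<in> space P" for \<sigma> x
    using abs_rademacher_sup_le[OF n H _ that(1), of x B] bound spaceP[OF that(2)] unfolding s_def
    by (cases "rademacher_sup n H (\<sigma>, x)") auto
  have s_upper: "1 / real n * (\<Sum>i<n. \<sigma> i * h (x i)) \<le> s \<sigma> x"
    if "\<sigma> \<in> signs n" "x \<in> space P" "h \<in> H" for \<sigma> x h
  proof -
    have "\<bar>rademacher_sup n H (\<sigma>, x)\<bar> \<le> ereal B"
      using abs_rademacher_sup_le[OF n H _ that(1)] bound spaceP[OF that(2)] by blast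
    then show ?thesis
      using rademacher_sup_upper[OF that(3), of n \<sigma> x] unfolding s_def
      by (cases "rademacher_sup n H (\<sigma>, x)") auto
  qed
  have s_int: "integrable P (s \<sigma>)" if "\<sigma> \<in> signs n" for \<sigma>
    using that s_le s_meas by (intro P.integrable_const_bound[where B = B]) auto
  define z where "z p = (\<lambda>(x, y). \<lambda>i\<in>{..<n}. if p i then y i else x i :: 'a)" for p :: "nat \<Rightarrow> bool"
  have z_meas [measurable]: "z p \<in> P \<Otimes>\<^sub>M P \<rightarrow>\<^sub>M P" for p
    unfolding P_def z_def split_beta
  proof (rule measurable_restrict)
    fix i assume "i \<in> {..<n}"
    then show "(\<lambda>x. if p i then snd x i else fst x i)
        \<in> Pi\<^sub>M {..<n} (\<lambda>i. D) \<Otimes>\<^sub>M Pi\<^sub>M {..<n} (\<lambda>i. D) \<rightarrow>\<^sub>M D"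
      by (cases "p i") auto
  qed
  have z_distr: "distr (P \<Otimes>\<^sub>M P) P (z p) = P" for p
    unfolding P_def z_def by (rule distr_PiM_swap[OF D]) simp
  have z_space: "z p (x, y) \<in> space P" if "x \<in> space P" "y \<in> space P" for p x y
    using measurable_space[OF z_meas, of "(x, y)" p] that by (simp add: space_pair_measure)
  \<comment> \<open>\<open>z ?p\<close> takes the ghost point exactly where
    \<open>\<sigma> i = 1\<close>, and \<open>z ?q\<close> exactly where
    \<open>\<sigma> i = -1\<close>. In either case \<open>h (y i) - h (x i)\<close> is
    \<open>\<sigma> i\<close> times \<open>h\<close> at the first mixture plus
    \<open>- \<sigma> i\<close> times \<open>h\<close> at the second, and each mixture has the law
    of a sample.\<close>
  let ?p = "\<lambda>i. \<sigma> i = 1" and ?q = "\<lambda>i. \<sigma> i \<noteq> 1"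
  define V where "V = (\<lambda>u. s \<sigma> (z ?p u) + s ?\<tau> (z ?q u))"
  have V_meas [measurable]: "V \<in> borel_measurable (P \<Otimes>\<^sub>M P)"
    unfolding V_def using s_meas[OF \<sigma>] s_meas[OF \<tau>] by measurable
  have V_le: "\<bar>V (x, y)\<bar> \<le> 2 * B" if "x \<in> space P" "y \<in> space P" for x y
    using s_le[OF \<sigma> z_space[OF that]] s_le[OF \<tau> z_space[OF that]] unfolding V_def by (smt (verit))
  have V_int: "integrable (P \<Otimes>\<^sub>M P) V"
    using V_le by (intro PP.integrable_const_bound[where B = "2 * B"]) (auto simp: space_pair_measure)
  have V_int2: "integrable P (\<lambda>y. V (x, y))" if "x \<in> space P" for x
    using V_le that by (intro P.integrable_const_bound[where B = "2 * B"]) auto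
  \<comment> \<open>Integrating out the ghost sample leaves a function of \<open>x\<close> that is
    measurable by Fubini. The bound by \<open>V\<close> is pointwise for each single
    \<open>h\<close>, so it survives integration for all \<open>h\<close> at once.\<close>
  define U where "U = (\<lambda>x. \<integral>y. V (x, y) \<partial>P)"
  show ?thesis
  proof (intro exI[of _ U] conjI ballI)
    show "U \<in> borel_measurable P" unfolding U_def by measurable
    show "\<bar>U x\<bar> \<le> 2 * B" if "x \<in> space P" for x
    proof -
      have "\<bar>U x\<bar> \<le> (\<integral>y. \<bar>V (x, y)\<bar> \<partial>P)" unfolding U_def by (rule integral_abs_bound)
      also have "\<dots> \<le> (\<integral>y. 2 * B \<partial>P)"
        using V_le[OF that] V_int2[OF that] by (intro integral_mono) auto
      finally show ?thesis by (simp add: P.prob_space)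
    qed
    have "(\<integral>x. U x \<partial>P) = (\<integral>u. V u \<partial>(P \<Otimes>\<^sub>M P))"
      unfolding U_def by (rule PP.integral_fst'[OF V_int])
    also have "\<dots> = (\<integral>u. s \<sigma> (z ?p u) \<partial>(P \<Otimes>\<^sub>M P)) + (\<integral>u. s ?\<tau> (z ?q u) \<partial>(P \<Otimes>\<^sub>M P))"
      unfolding V_def
      by (intro Bochner_Integration.integral_add integrable_distr[OF z_meas])
         (simp_all only: z_distr s_int \<sigma> \<tau>)
    also have "(\<integral>u. s \<sigma> (z ?p u) \<partial>(P \<Otimes>\<^sub>M P)) = (\<integral>x. s \<sigma> x \<partial>P)"
      using integral_distr[OF z_meas s_meas[OF \<sigma>], of ?p] by (simp add: z_distr)
    also have "(\<integral>u. s ?\<tau> (z ?q u) \<partial>(P \<Otimes>\<^sub>M P)) = (\<integral>x. s ?\<tau> x \<partial>P)"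
      using integral_distr[OF z_meas s_meas[OF \<tau>], of ?q] by (simp add: z_distr)
    finally show "(\<integral>x. U x \<partial>P) = (\<integral>x. s \<sigma> x \<partial>P) + (\<integral>x. s ?\<tau> x \<partial>P)" .
    fix x h assume x: "x \<in> space P" and h: "h \<in> H"
    have hc_int: "integrable P (\<lambda>y. h (y i))" if "i < n" for i
      using bound[OF h] spaceP h_meas[OF h] that unfolding P_def
      by (intro P.integrable_const_bound[unfolded P_def, where B = B]) (auto simp: P_def)
    have hc: "(\<integral>y. h (y i) \<partial>P) = (\<integral>t. h t \<partial>D)" if "i < n" for i
      unfolding P_def using that h_meas[OF h] by (intro integral_PiM_component D) auto
    have "(\<integral>t. h t \<partial>D) - (\<Sum>i<n. h (x i)) / real n
        = 1 / real n * (\<Sum>i<n. (\<integral>y. h (y i) \<partial>P) - h (x i))"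
      using n by (simp add: hc sum_subtractf field_simps)
    also have "\<dots> = (\<integral>y. 1 / real n * (\<Sum>i<n. h (y i) - h (x i)) \<partial>P)"
      using hc_int by (simp add: P.prob_space)
    also have "\<dots> \<le> (\<integral>y. V (x, y) \<partial>P)"
    proof (rule integral_mono)
      show "integrable P (\<lambda>y. 1 / real n * (\<Sum>i<n. h (y i) - h (x i)))"
        using hc_int
        by (intro integrable_mult_right Bochner_Integration.integrable_sum
            Bochner_Integration.integrable_diff) auto
      show "integrable P (\<lambda>y. V (x, y))" using V_int2[OF x] .
      fix y assume y: "y \<in> space P"
      have "(\<Sum>i<n. h (y i) - h (x i))
          = (\<Sum>i<n. \<sigma> i * h (z ?p (x, y) i)) + (\<Sum>i<n. ?\<tau> i * h (z ?q (x, y) i))"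
        unfolding sum.distrib[symmetric]
      proof (intro sum.cong refl)
        fix i assume "i \<in> {..<n}"
        then show "h (y i) - h (x i) = \<sigma> i * h (z ?p (x, y) i) + ?\<tau> i * h (z ?q (x, y) i)"
          using signs_cases[OF \<sigma>, of i] by (auto simp: z_def)
      qed
      then show "1 / real n * (\<Sum>i<n. h (y i) - h (x i)) \<le> V (x, y)"
        using s_upper[OF \<sigma> z_space[OF x y] h, of ?p] s_upper[OF \<tau> z_space[OF x y] h, of ?q]
        unfolding V_def by (simp only: distrib_left add_mono)
    qed
    finally show "(\<integral>t. h t \<partial>D) - (\<Sum>i<n. h (x i)) / real n \<le> U x" unfolding U_def .
  qed
qed

text \<open>Averaging the majorants over all sign vectors turns the sign suprema into
  \<open>rad_mean\<close>; the flipped halves have the same total, whence the factor 2.\<close>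

lemma symmetrization:
  assumes D: "prob_space D" and meas: "rademacher_measurable n D H" and H: "H \<noteq> {}"
    and n: "0 < n"
    and h_meas: "H \<subseteq> borel_measurable D"
    and bound: "\<forall>h\<in>H. \<forall>x\<in>space D. \<bar>h x\<bar> \<le> B"
  shows "\<exists>U. U \<in> borel_measurable (\<Pi>\<^sub>M i\<in>{..<n}. D) \<and>
    (\<forall>x\<in>space (\<Pi>\<^sub>M i\<in>{..<n}. D). \<bar>U x\<bar> \<le> 2 * B) \<and>
    (\<forall>x\<in>space (\<Pi>\<^sub>M i\<in>{..<n}. D). \<forall>h\<in>H.
       (\<integral>t. h t \<partial>D) - (\<Sum>i<n. h (x i)) / real n \<le> U x) \<and>
    (\<integral>x. U x \<partial>(\<Pi>\<^sub>M i\<in>{..<n}. D)) = 2 * (\<integral>x. rad_mean n H x \<partial>(\<Pi>\<^sub>M i\<in>{..<n}. D))"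
proof -
  let ?P = "\<Pi>\<^sub>M i\<in>{..<n}. D"
  let ?neg = "\<lambda>\<sigma>. \<lambda>i\<in>{..<n}. - \<sigma> i :: real"
  let ?s = "\<lambda>\<sigma>. \<integral>x. real_of_ereal (rademacher_sup n H (\<sigma>, x)) \<partial>?P"
  interpret P: prob_space ?P by (intro prob_space_PiM D)
  have fin: "rademacher n D H \<noteq> \<infinity>"
    using rademacher_bounded_finite[OF D meas H n, of B] bound by blast
  have "\<forall>\<sigma>\<in>signs n. \<exists>U. U \<in> borel_measurable ?P \<and> (\<forall>x\<in>space ?P. \<bar>U x\<bar> \<le> 2 * B) \<and>
      (\<forall>x\<in>space ?P. \<forall>h\<in>H. (\<integral>t. h t \<partial>D) - (\<Sum>i<n. h (x i)) / real n \<le> U x) \<and>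
      (\<integral>x. U x \<partial>?P) = ?s \<sigma> + ?s (?neg \<sigma>)"
    using symmetrization_signs[OF D meas H n, of B] h_meas bound by blast
  then obtain W where W:
    "\<And>\<sigma>. \<sigma> \<in> signs n \<Longrightarrow> W \<sigma> \<in> borel_measurable ?P"
    "\<And>\<sigma> x. \<sigma> \<in> signs n \<Longrightarrow> x \<in> space ?P \<Longrightarrow> \<bar>W \<sigma> x\<bar> \<le> 2 * B"
    "\<And>\<sigma> x h. \<sigma> \<in> signs n \<Longrightarrow> x \<in> space ?P \<Longrightarrow> h \<in> H \<Longrightarrow>
       (\<integral>t. h t \<partial>D) - (\<Sum>i<n. h (x i)) / real n \<le> W \<sigma> x"
    "\<And>\<sigma>. \<sigma> \<in> signs n \<Longrightarrow> (\<integral>x. W \<sigma> x \<partial>?P) = ?s \<sigma> + ?s (?neg \<sigma>)"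
    unfolding bchoice_iff by blast
  have W_int: "integrable ?P (W \<sigma>)" if "\<sigma> \<in> signs n" for \<sigma>
    using W(1,2)[OF that] by (intro P.integrable_const_bound[where B = "2 * B"]) auto
  define U where "U = (\<lambda>x. (\<Sum>\<sigma>\<in>signs n. W \<sigma> x) / 2 ^ n)"
  have avg: "(\<Sum>\<sigma>\<in>signs n. c) / 2 ^ n = c" for c :: real by (simp add: card_signs)
  show ?thesis
  proof (intro exI[of _ U] conjI ballI)
    show "U \<in> borel_measurable ?P" unfolding U_def using W(1) by measurable
    show "\<bar>U x\<bar> \<le> 2 * B" if "x \<in> space ?P" for x
    proof -
      have "\<bar>\<Sum>\<sigma>\<in>signs n. W \<sigma> x\<bar> \<le> (\<Sum>\<sigma>\<in>signs n. 2 * B)"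
        using W(2) that by (intro order_trans[OF sum_abs] sum_mono) auto
      then have "\<bar>U x\<bar> \<le> (\<Sum>\<sigma>\<in>signs n. 2 * B) / 2 ^ n"
        unfolding U_def abs_divide by (simp add: divide_right_mono)
      then show ?thesis unfolding avg .
    qed
    show "(\<integral>t. h t \<partial>D) - (\<Sum>i<n. h (x i)) / real n \<le> U x" if "x \<in> space ?P" "h \<in> H" for x h
    proof -
      have "(\<Sum>\<sigma>\<in>signs n. (\<integral>t. h t \<partial>D) - (\<Sum>i<n. h (x i)) / real n) / 2 ^ n \<le> U x"
        unfolding U_def using W(3) that by (intro divide_right_mono sum_mono) auto
      then show ?thesis unfolding avg .
    qed
    have "(\<integral>x. U x \<partial>?P) = (\<Sum>\<sigma>\<in>signs n. ?s \<sigma> + ?s (?neg \<sigma>)) / 2 ^ n"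
      unfolding U_def using W_int W(4) by simp
    also have "\<dots> = 2 * ((\<Sum>\<sigma>\<in>signs n. ?s \<sigma>) / 2 ^ n)"
      unfolding sum.distrib sum_signs_uminus[where \<phi> = ?s] by simp
    also have "(\<Sum>\<sigma>\<in>signs n. ?s \<sigma>) / 2 ^ n = (\<integral>x. rad_mean n H x \<partial>?P)"
      unfolding rad_mean_def using rademacher_sup_integral(1)[OF D meas H fin] by simp
    finally show "(\<integral>x. U x \<partial>?P) = 2 * (\<integral>x. rad_mean n H x \<partial>?P)" .
  qed
qed

section \<open>McDiarmid's inequality\<close>

text \<open>Hoeffding's lemma asks for an interval. An oscillation of at most \<open>c\<close>
  places all values within \<open>c\<close> above the infimum of \<open>f\<close>.\<close>

lemma (in prob_space) Hoeffding_mgf_oscillation: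
  assumes f [measurable]: "f \<in> borel_measurable M"
    and osc: "\<And>x y. x \<in> space M \<Longrightarrow> y \<in> space M \<Longrightarrow> f x - f y \<le> c" and l: "0 < l"
  shows "(\<integral>\<^sup>+x. ennreal (exp (l * f x)) \<partial>M) \<le> ennreal (exp (l * (\<integral>x. f x \<partial>M) + l\<^sup>2 * c\<^sup>2 / 8))"
proof -
  define a where "a = (INF x\<in>space M. f x)"
  obtain x0 where x0: "x0 \<in> space M" using not_empty by blast
  have bdd: "bdd_below (f ` space M)"
    using osc[OF x0] by (intro bdd_belowI2[where m = "f x0 - c"]) (simp add: algebra_simps)
  have "f x \<in> {a..a + c}" if x: "x \<in> space M" for x
  proof -
    have "a \<le> f x" unfolding a_def using bdd x by (rule cINF_lower)
    moreover have "f x - c \<le> a"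
      unfolding a_def using x0 osc[OF x] by (intro cINF_greatest) (auto simp: algebra_simps)
    ultimately show ?thesis by auto
  qed
  then interpret interval_bounded_random_variable M f a "a + c"
    by unfold_locales auto
  have "(\<integral>\<^sup>+x. ennreal (exp (l * f x)) \<partial>M)
      = (\<integral>\<^sup>+x. ennreal (exp (l * expectation f)) * ennreal (exp (l * (f x - expectation f))) \<partial>M)"
    by (intro nn_integral_cong) (simp add: ennreal_mult[symmetric] exp_add[symmetric] algebra_simps)
  also have "\<dots> = ennreal (exp (l * expectation f)) * (\<integral>\<^sup>+x. ennreal (exp (l * (f x - expectation f))) \<partial>M)"
    by (rule nn_integral_cmult) measurable
  also have "\<dots> \<le> ennreal (exp (l * expectation f)) * ennreal (exp (l\<^sup>2 * c\<^sup>2 / 8))"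
    using Hoeffdings_lemma_nn_integral[OF l] by (intro mult_left_mono) simp_all
  also have "\<dots> = ennreal (exp (l * expectation f + l\<^sup>2 * c\<^sup>2 / 8))"
    by (simp add: ennreal_mult[symmetric] exp_add)
  finally show ?thesis .
qed

lemma integral_diff_le_of_pointwise:
  assumes "prob_space M" "integrable M f" "integrable M g"
    and "\<And>x. x \<in> space M \<Longrightarrow> f x - g x \<le> (c :: real)"
  shows "(\<integral>x. f x \<partial>M) - (\<integral>x. g x \<partial>M) \<le> c"
proof -
  interpret prob_space M by fact
  have "(\<integral>x. f x \<partial>M) - (\<integral>x. g x \<partial>M) = (\<integral>x. f x - g x \<partial>M)"
    using assms by simp
  also have "\<dots> \<le> (\<integral>x. c \<partial>M)" using assms by (intro integral_mono) auto
  finally show ?thesis by (simp add: prob_space)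
qed

text \<open>The martingale argument in inductive form. With the other coordinates fixed,
  \<open>f\<close> oscillates by at most \<open>c\<close> in the last one, which costs a factor
  \<open>exp (l\<^sup>2 * c\<^sup>2 / 8)\<close>; the average over the last coordinate inherits the
  difference condition in the others.\<close>

lemma bounded_differences_mgf:
  fixes D :: "'a measure" and f :: "(nat \<Rightarrow> 'a) \<Rightarrow> real"
  assumes D: "prob_space D" and l: "0 < l"
    and "f \<in> borel_measurable (\<Pi>\<^sub>M i\<in>{..<n}. D)"
    and "\<And>x. x \<in> space (\<Pi>\<^sub>M i\<in>{..<n}. D) \<Longrightarrow> \<bar>f x\<bar> \<le> K"
    and "\<And>x i t. x \<in> space (\<Pi>\<^sub>M i\<in>{..<n}. D) \<Longrightarrow> i < n \<Longrightarrow> t \<in> space D \<Longrightarrow> f x - f (x(i := t)) \<le> c"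
  shows "(\<integral>\<^sup>+x. ennreal (exp (l * f x)) \<partial>(\<Pi>\<^sub>M i\<in>{..<n}. D))
         \<le> ennreal (exp (l * (\<integral>x. f x \<partial>(\<Pi>\<^sub>M i\<in>{..<n}. D)) + l\<^sup>2 * (real n * c\<^sup>2) / 8))"
  using assms(3-)
proof (induction n arbitrary: f)
  case 0
  interpret P: prob_space "\<Pi>\<^sub>M i\<in>{..<0::nat}. D" by (intro prob_space_PiM D)
  \<comment> \<open>The empty product has the single point \<open>\<lambda>_. undefined\<close>, so
    \<open>f\<close> is constant on it.\<close>
  define k where "k = f (\<lambda>_. undefined)"
  have k: "f x = k" if "x \<in> space (\<Pi>\<^sub>M i\<in>{..<0::nat}. D)" for x
    using that unfolding k_def by (simp add: space_PiM)
  have "(\<integral>\<^sup>+x. ennreal (exp (l * f x)) \<partial>(\<Pi>\<^sub>M i\<in>{..<0::nat}. D))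
      = (\<integral>\<^sup>+x. ennreal (exp (l * k)) \<partial>(\<Pi>\<^sub>M i\<in>{..<0::nat}. D))"
    by (intro nn_integral_cong) (simp only: k)
  then have 1: "(\<integral>\<^sup>+x. ennreal (exp (l * f x)) \<partial>(\<Pi>\<^sub>M i\<in>{..<0::nat}. D)) = ennreal (exp (l * k))"
    by (simp only: nn_integral_const P.emeasure_space_1 mult_1_right)
  have "(\<integral>x. f x \<partial>(\<Pi>\<^sub>M i\<in>{..<0::nat}. D)) = (\<integral>x. k \<partial>(\<Pi>\<^sub>M i\<in>{..<0::nat}. D))"
    by (intro Bochner_Integration.integral_cong refl) (simp only: k)
  then have 2: "(\<integral>x. f x \<partial>(\<Pi>\<^sub>M i\<in>{..<0::nat}. D)) = k"
    by (simp only: lebesgue_integral_const P.prob_space scaleR_one)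
  show ?case unfolding 1 2 by simp
next
  case (Suc n)
  let ?P = "\<Pi>\<^sub>M i\<in>{..<n}. D" and ?Q = "\<Pi>\<^sub>M i\<in>{..<Suc n}. D"
  interpret D: prob_space D by fact
  interpret P: prob_space ?P by (intro prob_space_PiM D)
  interpret Q: prob_space ?Q by (intro prob_space_PiM D)
  interpret PD: pair_prob_space ?P D by standard
  interpret product_sigma_finite "\<lambda>_::nat. D" by standard
  have Q: "?Q = (\<Pi>\<^sub>M i\<in>insert n {..<n}. D)" by (simp add: lessThan_Suc)
  note f = Suc.prems(1)
  have upd: "x(n := y) \<in> space ?Q" if "x \<in> space ?P" "y \<in> space D" for x y
    using that by (auto simp: space_PiM PiE_iff extensional_def less_Suc_eq)
  have upd_meas [measurable]: "(\<lambda>(x, y). x(n := y)) \<in> ?P \<Otimes>\<^sub>M D \<rightarrow>\<^sub>M ?Q"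
    unfolding Q by (rule measurable_add_dim)
  have F: "(\<lambda>u. f ((\<lambda>(x, y). x(n := y)) u)) \<in> borel_measurable (?P \<Otimes>\<^sub>M D)"
    by (rule measurable_compose[OF upd_meas f])
  then have [measurable]: "(\<lambda>(x, y). f (x(n := y))) \<in> borel_measurable (?P \<Otimes>\<^sub>M D)"
    by (simp add: split_beta')
  define g where "g x = (\<integral>y. f (x(n := y)) \<partial>D)" for x
  have fy: "(\<lambda>y. f (x(n := y))) \<in> borel_measurable D" if "x \<in> space ?P" for x
    using that by measurable
  have int_y: "integrable D (\<lambda>y. f (x(n := y)))" if "x \<in> space ?P" for x
    using Suc.prems(2) upd[OF that] fy[OF that] by (intro D.integrable_const_bound[where B = K]) auto
  have f_int: "integrable ?Q f"
    using Suc.prems(1,2) by (intro Q.integrable_const_bound[where B = K]) auto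
  have g_meas: "g \<in> borel_measurable ?P" unfolding g_def[abs_def] by measurable
  have g_bound: "\<bar>g x\<bar> \<le> K" if "x \<in> space ?P" for x
  proof -
    have "\<bar>g x\<bar> \<le> (\<integral>y. \<bar>f (x(n := y))\<bar> \<partial>D)" unfolding g_def by (rule integral_abs_bound)
    also have "\<dots> \<le> (\<integral>y. K \<partial>D)"
      using Suc.prems(2) upd[OF that] int_y[OF that] by (intro integral_mono) auto
    finally show ?thesis by (simp add: D.prob_space)
  qed
  have g_diff: "g x - g (x(i := t)) \<le> c" if "x \<in> space ?P" "i < n" "t \<in> space D" for x i t
    unfolding g_def
  proof (rule integral_diff_le_of_pointwise[OF D])
    have x': "x(i := t) \<in> space ?P"
      using that by (auto simp: space_PiM PiE_iff extensional_def)
    show "integrable D (\<lambda>y. f (x(n := y)))" "integrable D (\<lambda>y. f (x(i := t, n := y)))"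
      using int_y that x' by auto
    fix y assume y: "y \<in> space D"
    \<comment> \<open>As \<open>i < n\<close>, the two updates act on different coordinates and
      commute, so the difference condition at \<open>i\<close> applies for every fixed last
      coordinate.\<close>
    have twist: "x(n := y, i := t) = x(i := t, n := y)"
      using that by (intro fun_upd_twist) simp
    show "f (x(n := y)) - f (x(i := t, n := y)) \<le> c"
      using Suc.prems(3)[OF upd[OF that(1) y] less_SucI[OF that(2)] that(3)] unfolding twist .
  qed
  have "(\<integral>\<^sup>+x. ennreal (exp (l * f x)) \<partial>?Q) = (\<integral>\<^sup>+x. \<integral>\<^sup>+y. ennreal (exp (l * f (x(n := y)))) \<partial>D \<partial>?P)"
    using f unfolding Q by (intro product_nn_integral_insert) auto
  also have "\<dots> \<le> (\<integral>\<^sup>+x. ennreal (exp (l\<^sup>2 * c\<^sup>2 / 8)) * ennreal (exp (l * g x)) \<partial>?P)"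
  proof (rule nn_integral_mono)
    fix x assume x: "x \<in> space ?P"
    have "f (x(n := y)) - f (x(n := y')) \<le> c" if "y \<in> space D" "y' \<in> space D" for y y'
      using Suc.prems(3)[OF upd[OF x that(1)] lessI that(2)] unfolding fun_upd_upd .
    then have "(\<integral>\<^sup>+y. ennreal (exp (l * f (x(n := y)))) \<partial>D) \<le> ennreal (exp (l * g x + l\<^sup>2 * c\<^sup>2 / 8))"
      unfolding g_def by (intro D.Hoeffding_mgf_oscillation fy x l)
    also have "\<dots> = ennreal (exp (l\<^sup>2 * c\<^sup>2 / 8)) * ennreal (exp (l * g x))"
      by (simp add: ennreal_mult[symmetric] exp_add mult.commute)
    finally show "(\<integral>\<^sup>+y. ennreal (exp (l * f (x(n := y)))) \<partial>D) \<le> \<dots>" .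
  qed
  also have "\<dots> = ennreal (exp (l\<^sup>2 * c\<^sup>2 / 8)) * (\<integral>\<^sup>+x. ennreal (exp (l * g x)) \<partial>?P)"
    using g_meas by (intro nn_integral_cmult) measurable
  also have "\<dots> \<le> ennreal (exp (l\<^sup>2 * c\<^sup>2 / 8))
      * ennreal (exp (l * (\<integral>x. g x \<partial>?P) + l\<^sup>2 * (real n * c\<^sup>2) / 8))"
    by (intro mult_left_mono Suc.IH g_meas g_bound g_diff) auto
  also have "(\<integral>x. g x \<partial>?P) = (\<integral>x. f x \<partial>?Q)"
    unfolding g_def Q using f_int[unfolded Q] by (intro product_integral_insert[symmetric]) auto
  also have "ennreal (exp (l\<^sup>2 * c\<^sup>2 / 8)) * ennreal (exp (l * (\<integral>x. f x \<partial>?Q) + l\<^sup>2 * (real n * c\<^sup>2) / 8))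
      = ennreal (exp (l * (\<integral>x. f x \<partial>?Q) + l\<^sup>2 * (real (Suc n) * c\<^sup>2) / 8))"
    by (simp add: ennreal_mult[symmetric] exp_add[symmetric] field_simps)
  finally show ?case .
qed

text \<open>Training and test points live in different spaces, so the one-sample bound is used
  twice: on the test points at a fixed training sample, then on the average over the test
  points.\<close>

lemma bounded_differences_mgf_pair:
  fixes D :: "'a measure" and E :: "'b measure" and f :: "(nat \<Rightarrow> 'a) \<times> (nat \<Rightarrow> 'b) \<Rightarrow> real"
  defines "P \<equiv> \<lambda>n. \<Pi>\<^sub>M i\<in>{..<n}. D" and "Q \<equiv> \<lambda>m. \<Pi>\<^sub>M i\<in>{..<m}. E"
  assumes D: "prob_space D" and E: "prob_space E" and l: "0 < l"
    and f [measurable]: "f \<in> borel_measurable (P n \<Otimes>\<^sub>M Q m)"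
    and bound: "\<And>x y. x \<in> space (P n) \<Longrightarrow> y \<in> space (Q m) \<Longrightarrow> \<bar>f (x, y)\<bar> \<le> K"
    and c: "\<And>x y i t. x \<in> space (P n) \<Longrightarrow> y \<in> space (Q m) \<Longrightarrow> i < n \<Longrightarrow> t \<in> space D \<Longrightarrow>
              f (x, y) - f (x(i := t), y) \<le> c"
    and d: "\<And>x y i t. x \<in> space (P n) \<Longrightarrow> y \<in> space (Q m) \<Longrightarrow> i < m \<Longrightarrow> t \<in> space E \<Longrightarrow>
              f (x, y) - f (x, y(i := t)) \<le> d"
  shows "(\<integral>\<^sup>+u. ennreal (exp (l * f u)) \<partial>(P n \<Otimes>\<^sub>M Q m))
         \<le> ennreal (exp (l * (\<integral>u. f u \<partial>(P n \<Otimes>\<^sub>M Q m)) + l\<^sup>2 * (real n * c\<^sup>2 + real m * d\<^sup>2) / 8))"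
proof -
  interpret P: prob_space "P n" unfolding P_def by (intro prob_space_PiM D)
  interpret Q: prob_space "Q m" unfolding Q_def by (intro prob_space_PiM E)
  interpret PD: pair_prob_space "P n" "Q m" by standard
  define g where "g x = (\<integral>y. f (x, y) \<partial>Q m)" for x
  have int_y: "integrable (Q m) (\<lambda>y. f (x, y))" if "x \<in> space (P n)" for x
    using bound that by (intro Q.integrable_const_bound[where B = K]) auto
  have f_int: "integrable (P n \<Otimes>\<^sub>M Q m) f"
    using bound by (intro PD.integrable_const_bound[where B = K]) (auto simp: space_pair_measure)
  have g_meas: "g \<in> borel_measurable (P n)" unfolding g_def[abs_def] by measurable
  have g_bound: "\<bar>g x\<bar> \<le> K" if "x \<in> space (P n)" for x
  proof -
    have "\<bar>g x\<bar> \<le> (\<integral>y. \<bar>f (x, y)\<bar> \<partial>Q m)" unfolding g_def by (rule integral_abs_bound)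
    also have "\<dots> \<le> (\<integral>y. K \<partial>Q m)"
      using bound[OF that] int_y[OF that] by (intro integral_mono) auto
    finally show ?thesis by (simp add: Q.prob_space)
  qed
  have g_diff: "g x - g (x(i := t)) \<le> c" if "x \<in> space (P n)" "i < n" "t \<in> space D" for x i t
    unfolding g_def
  proof (rule integral_diff_le_of_pointwise[OF Q.prob_space_axioms])
    have x': "x(i := t) \<in> space (P n)"
      using that by (auto simp: P_def space_PiM PiE_iff extensional_def)
    show "integrable (Q m) (\<lambda>y. f (x, y))" "integrable (Q m) (\<lambda>y. f (x(i := t), y))"
      using int_y that x' by auto
  qed (use c that in auto)
  have "(\<integral>\<^sup>+u. ennreal (exp (l * f u)) \<partial>(P n \<Otimes>\<^sub>M Q m))
      = (\<integral>\<^sup>+x. \<integral>\<^sup>+y. ennreal (exp (l * f (x, y))) \<partial>Q m \<partial>P n)"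
    by (rule Q.nn_integral_fst[symmetric]) measurable
  also have "\<dots> \<le> (\<integral>\<^sup>+x. ennreal (exp (l\<^sup>2 * (real m * d\<^sup>2) / 8)) * ennreal (exp (l * g x)) \<partial>P n)"
  proof (rule nn_integral_mono)
    fix x assume x: "x \<in> space (P n)"
    have "(\<integral>\<^sup>+y. ennreal (exp (l * f (x, y))) \<partial>Q m) \<le> ennreal (exp (l * g x + l\<^sup>2 * (real m * d\<^sup>2) / 8))"
    proof -
      have "(\<lambda>y. f (x, y)) \<in> borel_measurable (Q m)" using x by measurable
      moreover have "\<bar>f (x, y)\<bar> \<le> K" if "y \<in> space (Q m)" for y
        using bound[OF x that] .
      moreover have "f (x, y) - f (x, y(i := t)) \<le> d"
        if "y \<in> space (Q m)" "i < m" "t \<in> space E" for y i t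
        using d[OF x that] .
      ultimately show ?thesis
        unfolding g_def Q_def by (rule bounded_differences_mgf[OF E l])
    qed
    also have "\<dots> = ennreal (exp (l\<^sup>2 * (real m * d\<^sup>2) / 8)) * ennreal (exp (l * g x))"
      by (simp add: ennreal_mult[symmetric] exp_add mult.commute)
    finally show "(\<integral>\<^sup>+y. ennreal (exp (l * f (x, y))) \<partial>Q m) \<le> \<dots>" .
  qed
  also have "\<dots> = ennreal (exp (l\<^sup>2 * (real m * d\<^sup>2) / 8)) * (\<integral>\<^sup>+x. ennreal (exp (l * g x)) \<partial>P n)"
    using g_meas by (intro nn_integral_cmult) measurable
  also have "\<dots> \<le> ennreal (exp (l\<^sup>2 * (real m * d\<^sup>2) / 8))
      * ennreal (exp (l * (\<integral>x. g x \<partial>P n) + l\<^sup>2 * (real n * c\<^sup>2) / 8))"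
    using bounded_differences_mgf[OF D l g_meas[unfolded P_def] g_bound[unfolded P_def]
        g_diff[unfolded P_def]]
    unfolding P_def by (intro mult_left_mono) auto
  also have "(\<integral>x. g x \<partial>P n) = (\<integral>u. f u \<partial>(P n \<Otimes>\<^sub>M Q m))"
    unfolding g_def by (rule PD.integral_fst'[OF f_int])
  also have "ennreal (exp (l\<^sup>2 * (real m * d\<^sup>2) / 8))
      * ennreal (exp (l * (\<integral>u. f u \<partial>(P n \<Otimes>\<^sub>M Q m)) + l\<^sup>2 * (real n * c\<^sup>2) / 8))
      = ennreal (exp (l * (\<integral>u. f u \<partial>(P n \<Otimes>\<^sub>M Q m)) + l\<^sup>2 * (real n * c\<^sup>2 + real m * d\<^sup>2) / 8))"
    by (simp add: ennreal_mult[symmetric] exp_add[symmetric] field_simps)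
  finally show ?thesis .
qed

lemma McDiarmid_pair:
  fixes D :: "'a measure" and E :: "'b measure" and f :: "(nat \<Rightarrow> 'a) \<times> (nat \<Rightarrow> 'b) \<Rightarrow> real"
  defines "P \<equiv> \<lambda>n. \<Pi>\<^sub>M i\<in>{..<n}. D" and "Q \<equiv> \<lambda>m. \<Pi>\<^sub>M i\<in>{..<m}. E"
  assumes D: "prob_space D" and E: "prob_space E"
    and f [measurable]: "f \<in> borel_measurable (P n \<Otimes>\<^sub>M Q m)"
    and bound: "\<And>x y. x \<in> space (P n) \<Longrightarrow> y \<in> space (Q m) \<Longrightarrow> \<bar>f (x, y)\<bar> \<le> K"
    and c: "\<And>x y i t. x \<in> space (P n) \<Longrightarrow> y \<in> space (Q m) \<Longrightarrow> i < n \<Longrightarrow> t \<in> space D \<Longrightarrow>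
              f (x, y) - f (x(i := t), y) \<le> c"
    and d: "\<And>x y i t. x \<in> space (P n) \<Longrightarrow> y \<in> space (Q m) \<Longrightarrow> i < m \<Longrightarrow> t \<in> space E \<Longrightarrow>
              f (x, y) - f (x, y(i := t)) \<le> d"
    and V: "0 < real n * c\<^sup>2 + real m * d\<^sup>2" and t: "0 < t"
  shows "measure (P n \<Otimes>\<^sub>M Q m)
           {u \<in> space (P n \<Otimes>\<^sub>M Q m). (\<integral>u. f u \<partial>(P n \<Otimes>\<^sub>M Q m)) + t \<le> f u}
         \<le> exp (- 2 * t\<^sup>2 / (real n * c\<^sup>2 + real m * d\<^sup>2))"
proof -
  interpret P: prob_space "P n" unfolding P_def by (intro prob_space_PiM D)
  interpret Q: prob_space "Q m" unfolding Q_def by (intro prob_space_PiM E)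
  interpret PQ: pair_prob_space "P n" "Q m" by standard
  let ?R = "P n \<Otimes>\<^sub>M Q m"
  define V where "V = real n * c\<^sup>2 + real m * d\<^sup>2"
  have V0: "0 < V" using V unfolding V_def .
  \<comment> \<open>The minimizer of the Chernoff exponent
    \<open>- l * t + l\<^sup>2 * V / 8\<close>, with minimum
    \<open>- 2 * t\<^sup>2 / V\<close>.\<close>
  define l where "l = 4 * t / V"
  have l: "0 < l" unfolding l_def using t V0 by simp
  let ?m = "\<integral>u. f u \<partial>?R"
  have "ennreal (measure ?R {u \<in> space ?R. ?m + t \<le> f u}) = emeasure ?R {u \<in> space ?R. ?m + t \<le> f u}"
    by (simp add: PQ.emeasure_eq_measure)
  also have "\<dots> \<le> ennreal (exp (- l * (?m + t))) * (\<integral>\<^sup>+u\<in>space ?R. ennreal (exp (l * f u)) \<partial>?R)"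
    by (intro Chernoff_ineq_nn_integral_ge l) auto
  also have "(\<integral>\<^sup>+u\<in>space ?R. ennreal (exp (l * f u)) \<partial>?R) = (\<integral>\<^sup>+u. ennreal (exp (l * f u)) \<partial>?R)"
    by (intro nn_integral_cong) auto
  also have "ennreal (exp (- l * (?m + t))) * \<dots>
      \<le> ennreal (exp (- l * (?m + t))) * ennreal (exp (l * ?m + l\<^sup>2 * V / 8))"
    unfolding V_def using bounded_differences_mgf_pair[OF D E l, of f n m K c d] f bound c d
    by (intro mult_left_mono) (auto simp: P_def Q_def)
  also have "\<dots> = ennreal (exp (- l * (?m + t) + (l * ?m + l\<^sup>2 * V / 8)))"
    by (simp add: ennreal_mult[symmetric] exp_add[symmetric])
  also have "- l * (?m + t) + (l * ?m + l\<^sup>2 * V / 8) = - 2 * t\<^sup>2 / V"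
    using V0 unfolding l_def by (simp add: field_simps power2_eq_square)
  finally show ?thesis unfolding V_def by (subst (asm) ennreal_le_iff) simp_all
qed

section \<open>Covariate shift\<close>

lemma (in prob_space) square_expectation_le:
  fixes f :: "'a \<Rightarrow> real"
  assumes "integrable M f" "integrable M (\<lambda>x. (f x)\<^sup>2)"
  shows "(\<integral>x. f x \<partial>M)\<^sup>2 \<le> (\<integral>x. (f x)\<^sup>2 \<partial>M)"
  using variance_eq[OF assms] variance_positive[of f] by linarith

lemma (in prob_space) integrable_of_square_integrable:
  fixes f :: "'a \<Rightarrow> real"
  assumes [measurable]: "f \<in> borel_measurable M" and "integrable M (\<lambda>x. (f x)\<^sup>2)"
  shows "integrable M f"
proof (rule Bochner_Integration.integrable_bound[where f = "\<lambda>x. 1 + (f x)\<^sup>2"])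
  show "integrable M (\<lambda>x. 1 + (f x)\<^sup>2)" using assms by auto
  have "\<bar>t\<bar> \<le> 1 + t\<^sup>2" for t :: real
  proof -
    have "0 \<le> (\<bar>t\<bar> - 1 / 2)\<^sup>2" by simp
    then have "\<bar>t\<bar> \<le> t\<^sup>2 + 1 / 4" by (simp add: power2_eq_square algebra_simps)
    then show ?thesis by simp
  qed
  then show "AE x in M. norm (f x) \<le> norm (1 + (f x)\<^sup>2)" by simp
qed simp

text \<open>
  The risk under the reweighted law splits as \<open>E[l r] = E[l g] + E[l (r - g)]\<close>; the second summand
  is controlled by Cauchy--Schwarz, and \<open>(a + b)\<^sup>2 \<le> 2 a\<^sup>2 + 2 b\<^sup>2\<close> produces the factor \<open>1/2\<close>.
\<close>

lemma (in prob_space) half_square_reweighted_le: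
  fixes l u g r :: "'a \<Rightarrow> real"
  assumes [measurable]: "l \<in> borel_measurable M" "u \<in> borel_measurable M"
      "g \<in> borel_measurable M" "r \<in> borel_measurable M"
    and l: "\<And>x. x \<in> space M \<Longrightarrow> 0 \<le> l x" "\<And>x. x \<in> space M \<Longrightarrow> l x \<le> m"
    and u: "\<And>x. x \<in> space M \<Longrightarrow> l x \<le> u x" "\<And>x. x \<in> space M \<Longrightarrow> u x \<le> A"
    and g: "\<And>x. x \<in> space M \<Longrightarrow> 0 \<le> g x" "\<And>x. x \<in> space M \<Longrightarrow> g x \<le> B"
    and r: "\<And>x. x \<in> space M \<Longrightarrow> 0 \<le> r x" "integrable M (\<lambda>x. (r x)\<^sup>2)"
  shows "1 / 2 * (\<integral>x. r x * l x \<partial>M)\<^sup>2 \<le> (\<integral>x. u x * g x \<partial>M)\<^sup>2 + m\<^sup>2 * (\<integral>x. (g x - r x)\<^sup>2 \<partial>M)"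
proof -
  obtain x0 where x0: "x0 \<in> space M" using not_empty by blast
  have m0: "0 \<le> m" and A0: "0 \<le> A" and B0: "0 \<le> B"
    using l[OF x0] u[OF x0] g[OF x0] by linarith+
  have ug: "\<bar>u x * g x\<bar> \<le> A * B" if "x \<in> space M" for x
    using l(1)[OF that] u[OF that] g[OF that] by (simp add: abs_mult mult_mono)
  have ug_int: "integrable M (\<lambda>x. u x * g x)"
    using ug by (intro integrable_const_bound[where B = "A * B"]) auto
  have r_int: "integrable M r" by (rule integrable_of_square_integrable[OF assms(4) r(2)])
  have rl_int: "integrable M (\<lambda>x. r x * l x)"
  proof (rule Bochner_Integration.integrable_bound[where f = "\<lambda>x. m * r x"])
    show "AE x in M. norm (r x * l x) \<le> norm (m * r x)"
      using l r(1) m0 by (intro AE_I2) (auto simp: abs_mult mult.commute[of m] intro!: mult_left_mono)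
  qed (use r_int in auto)
  have g_int: "integrable M g" "integrable M (\<lambda>x. (g x)\<^sup>2)"
  proof -
    show "integrable M g" using g by (intro integrable_const_bound[where B = B]) auto
    show "integrable M (\<lambda>x. (g x)\<^sup>2)"
      using g by (intro integrable_const_bound[where B = "B\<^sup>2"]) (auto intro!: power_mono AE_I2)
  qed
  have gr_int: "integrable M (\<lambda>x. g x * r x)"
  proof (rule Bochner_Integration.integrable_bound[where f = "\<lambda>x. B * r x"])
    show "AE x in M. norm (g x * r x) \<le> norm (B * r x)"
      using g r(1) B0 by (intro AE_I2) (auto simp: abs_mult intro!: mult_right_mono)
  qed (use r_int in auto)
  have sq_int: "integrable M (\<lambda>x. (g x - r x)\<^sup>2)"
  proof -
    have "(\<lambda>x. (g x - r x)\<^sup>2) = (\<lambda>x. (g x)\<^sup>2 - 2 * (g x * r x) + (r x)\<^sup>2)"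
      by (simp add: fun_eq_iff power2_diff)
    then show ?thesis
      using g_int gr_int r(2)
      by (simp only:) (intro Bochner_Integration.integrable_add Bochner_Integration.integrable_diff
          integrable_mult_right)
  qed
  have abs_int: "integrable M (\<lambda>x. \<bar>g x - r x\<bar>)" using g_int r_int by auto
  let ?a = "\<integral>x. u x * g x \<partial>M" and ?b = "\<integral>x. \<bar>g x - r x\<bar> \<partial>M" and ?R = "\<integral>x. r x * l x \<partial>M"
  have "?R \<le> (\<integral>x. u x * g x + m * \<bar>g x - r x\<bar> \<partial>M)"
  proof (rule integral_mono)
    show "integrable M (\<lambda>x. r x * l x)" by (rule rl_int)
    show "integrable M (\<lambda>x. u x * g x + m * \<bar>g x - r x\<bar>)" using ug_int abs_int by auto
    fix x assume x: "x \<in> space M"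
    have "r x * l x = l x * g x + l x * (r x - g x)" by (simp add: algebra_simps)
    also have "\<dots> \<le> u x * g x + m * \<bar>g x - r x\<bar>"
    proof (intro add_mono mult_right_mono u x g)
      have "l x * (r x - g x) \<le> l x * \<bar>g x - r x\<bar>" using l[OF x] by (intro mult_left_mono) auto
      also have "\<dots> \<le> m * \<bar>g x - r x\<bar>" using l[OF x] by (intro mult_right_mono) auto
      finally show "l x * (r x - g x) \<le> m * \<bar>g x - r x\<bar>" .
    qed
    finally show "r x * l x \<le> u x * g x + m * \<bar>g x - r x\<bar>" .
  qed
  also have "\<dots> = ?a + m * ?b" using ug_int abs_int by simp
  finally have R: "?R \<le> ?a + m * ?b" .
  \<comment> \<open>The bound on \<open>?R\<close> may be squared because the risk is
    nonnegative.\<close>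
  have "0 \<le> ?R" using l r by (intro integral_nonneg_AE AE_I2) auto
  with R have "?R\<^sup>2 \<le> (?a + m * ?b)\<^sup>2" by (intro power_mono)
  also have "\<dots> \<le> 2 * ?a\<^sup>2 + 2 * (m * ?b)\<^sup>2"
    using zero_le_power2[of "?a - m * ?b"] by (simp add: power2_diff power2_sum)
  also have "(m * ?b)\<^sup>2 = m\<^sup>2 * ?b\<^sup>2" by (rule power_mult_distrib)
  \<comment> \<open>Cauchy-Schwarz against the constant 1, in the form that a variance is
    nonnegative.\<close>
  also have "?b\<^sup>2 \<le> (\<integral>x. (g x - r x)\<^sup>2 \<partial>M)"
    using square_expectation_le[OF abs_int] sq_int by simp
  finally show ?thesis by (simp add: mult_left_mono)
qed

section \<open>Marginals of the joint law and change of measure\<close>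

context
  fixes \<mu> :: "'a measure" and \<nu> :: "'b measure" and p :: "'a \<Rightarrow> real" and c :: "'a \<Rightarrow> 'b \<Rightarrow> real"
  assumes sf: "sigma_finite_measure \<mu>" "sigma_finite_measure \<nu>"
    and p: "prob_density \<mu> p" and c: "conditional_density \<mu> \<nu> p c"
begin

lemma density_measurable: "p \<in> borel_measurable \<mu>"
    "(\<lambda>(x, y). ennreal (p x * c x y)) \<in> borel_measurable (\<mu> \<Otimes>\<^sub>M \<nu>)"
proof -
  show [measurable]: "p \<in> borel_measurable \<mu>" using p unfolding prob_density_def by blast
  have "(\<lambda>(x, y). c x y) \<in> borel_measurable (\<mu> \<Otimes>\<^sub>M \<nu>)"
    using c unfolding conditional_density_def by blast
  then have [measurable]: "(\<lambda>z. c (fst z) (snd z)) \<in> borel_measurable (\<mu> \<Otimes>\<^sub>M \<nu>)"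
    by (simp add: split_beta')
  show "(\<lambda>(x, y). ennreal (p x * c x y)) \<in> borel_measurable (\<mu> \<Otimes>\<^sub>M \<nu>)"
    unfolding split_beta' by measurable
qed

lemma sets_input_dist: "sets (input_dist \<mu> p) = sets \<mu>"
  unfolding input_dist_def by simp

lemma space_joint_dist: "space (joint_dist \<mu> \<nu> p c) = space \<mu> \<times> space \<nu>"
  unfolding joint_dist_def by (simp add: space_pair_measure)

lemma prob_space_input_dist: "prob_space (input_dist \<mu> p)"
proof
  have [measurable]: "p \<in> borel_measurable \<mu>" by (rule density_measurable)
  have "emeasure (density \<mu> (\<lambda>x. ennreal (p x))) (space \<mu>) = (\<integral>\<^sup>+x. ennreal (p x) \<partial>\<mu>)"
    by (subst emeasure_density) (auto intro!: nn_integral_cong)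
  then show "emeasure (input_dist \<mu> p) (space (input_dist \<mu> p)) = 1"
    using p unfolding input_dist_def prob_density_def by simp
qed

text \<open>The conditional density integrates to 1 over the labels. The identity makes the joint
  law a probability measure and lets functions of the input be integrated under either law.\<close>

lemma distr_fst_joint_dist: "distr (joint_dist \<mu> \<nu> p c) (input_dist \<mu> p) fst = input_dist \<mu> p"
proof (rule measure_eqI)
  interpret N: sigma_finite_measure \<nu> by fact
  note [measurable] = density_measurable
  fix A assume "A \<in> sets (distr (joint_dist \<mu> \<nu> p c) (input_dist \<mu> p) fst)"
  then have A [measurable]: "A \<in> sets \<mu>" by (simp add: sets_input_dist)
  have fst: "fst \<in> joint_dist \<mu> \<nu> p c \<rightarrow>\<^sub>M input_dist \<mu> p"
    unfolding joint_dist_def input_dist_def by simp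
  have "emeasure (distr (joint_dist \<mu> \<nu> p c) (input_dist \<mu> p) fst) A
      = emeasure (joint_dist \<mu> \<nu> p c) (A \<times> space \<nu>)"
  proof (subst emeasure_distr[OF fst])
    show "A \<in> sets (input_dist \<mu> p)" using A by (simp add: sets_input_dist)
    have "fst -` A \<inter> space (joint_dist \<mu> \<nu> p c) = A \<times> space \<nu>"
      using sets.sets_into_space[OF A] by (auto simp: space_joint_dist)
    then show "emeasure (joint_dist \<mu> \<nu> p c) (fst -` A \<inter> space (joint_dist \<mu> \<nu> p c))
        = emeasure (joint_dist \<mu> \<nu> p c) (A \<times> space \<nu>)" by simp
  qed
  also have "\<dots> = (\<integral>\<^sup>+z. (case z of (x, y) \<Rightarrow> ennreal (p x * c x y)) * indicator (A \<times> space \<nu>) z \<partial>(\<mu> \<Otimes>\<^sub>M \<nu>))"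
    unfolding joint_dist_def by (subst emeasure_density) (auto intro: density_measurable)
  also have "\<dots> = (\<integral>\<^sup>+x. \<integral>\<^sup>+y. ennreal (p x * c x y) * indicator (A \<times> space \<nu>) (x, y) \<partial>\<nu> \<partial>\<mu>)"
    by (subst N.nn_integral_fst[symmetric]) (auto intro: density_measurable)
  also have "\<dots> = (\<integral>\<^sup>+x. ennreal (p x) * indicator A x \<partial>\<mu>)"
  proof (rule nn_integral_cong)
    fix x assume x: "x \<in> space \<mu>"
    show "(\<integral>\<^sup>+y. ennreal (p x * c x y) * indicator (A \<times> space \<nu>) (x, y) \<partial>\<nu>)
        = ennreal (p x) * indicator A x"
    \<comment> \<open>Where \<open>p x = 0\<close> the conditional density is unconstrained, but the
      factor \<open>p x\<close> annihilates it.\<close>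
    proof (cases "0 < p x")
      case False
      then have "p x = 0" using p x unfolding prob_density_def by force
      then show ?thesis by simp
    next
      case True
      then have cx: "prob_density \<nu> (c x)" using c x unfolding conditional_density_def by blast
      have "(\<integral>\<^sup>+y. ennreal (p x * c x y) * indicator (A \<times> space \<nu>) (x, y) \<partial>\<nu>)
          = (\<integral>\<^sup>+y. (ennreal (p x) * indicator A x) * ennreal (c x y) \<partial>\<nu>)"
        using cx True unfolding prob_density_def
        by (intro nn_integral_cong) (auto simp: ennreal_mult indicator_def)
      also have "\<dots> = (ennreal (p x) * indicator A x) * (\<integral>\<^sup>+y. ennreal (c x y) \<partial>\<nu>)"
        using cx unfolding prob_density_def by (intro nn_integral_cmult) auto
      finally show ?thesis using cx unfolding prob_density_def by simp
    qed
  qed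
  also have "\<dots> = emeasure (input_dist \<mu> p) A"
    unfolding input_dist_def by (subst emeasure_density) (auto intro: density_measurable)
  finally show "emeasure (distr (joint_dist \<mu> \<nu> p c) (input_dist \<mu> p) fst) A
      = emeasure (input_dist \<mu> p) A" .
qed simp

lemma measurable_fst_joint_dist: "fst \<in> joint_dist \<mu> \<nu> p c \<rightarrow>\<^sub>M input_dist \<mu> p"
  unfolding joint_dist_def input_dist_def by simp

lemma prob_space_joint_dist: "prob_space (joint_dist \<mu> \<nu> p c)"
proof -
  interpret prob_space "input_dist \<mu> p" by (rule prob_space_input_dist)
  have "prob_space (distr (joint_dist \<mu> \<nu> p c) (input_dist \<mu> p) fst)"
    unfolding distr_fst_joint_dist by (rule prob_space_axioms)
  then show ?thesis
    by (rule prob_space_distrD[OF measurable_fst_joint_dist])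
qed

end

text \<open>Equal supports make \<open>importance\<close> a density of the test inputs with respect
  to the training inputs. Equal conditionals on the common support make the same factor work for the
  joint laws.\<close>

lemma
  assumes "covariate_shift \<mu> \<nu> ptr ctr pte cte"
  shows input_dist_shift:
      "input_dist \<mu> pte = density (input_dist \<mu> ptr) (\<lambda>x. ennreal (importance ptr pte x))"
    and joint_dist_shift:
      "sigma_finite_measure \<mu> \<Longrightarrow> sigma_finite_measure \<nu> \<Longrightarrow> joint_dist \<mu> \<nu> pte cte
         = density (joint_dist \<mu> \<nu> ptr ctr) (\<lambda>(x, y). ennreal (importance ptr pte x))"
    and importance_nonneg: "\<And>x. x \<in> space \<mu> \<Longrightarrow> 0 \<le> importance ptr pte x"
    and importance_measurable: "importance ptr pte \<in> borel_measurable \<mu>"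
proof -
  have tr: "prob_density \<mu> ptr" "conditional_density \<mu> \<nu> ptr ctr"
    and te: "prob_density \<mu> pte" "conditional_density \<mu> \<nu> pte cte"
    and supp: "{x \<in> space \<mu>. 0 < ptr x} = {x \<in> space \<mu>. 0 < pte x}"
    and cond: "\<And>x y. x \<in> space \<mu> \<Longrightarrow> 0 < ptr x \<Longrightarrow> y \<in> space \<nu> \<Longrightarrow> ctr x y = cte x y"
    using assms unfolding covariate_shift_def by blast+
  have [measurable]: "ptr \<in> borel_measurable \<mu>" "pte \<in> borel_measurable \<mu>"
    using tr(1) te(1) unfolding prob_density_def by blast+
  have p0: "0 \<le> ptr x" "0 \<le> pte x" if "x \<in> space \<mu>" for x
    using tr(1) te(1) that unfolding prob_density_def by blast+
  show r0: "\<And>x. x \<in> space \<mu> \<Longrightarrow> 0 \<le> importance ptr pte x"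
    unfolding importance_def using p0 by simp
  show r_meas [measurable]: "importance ptr pte \<in> borel_measurable \<mu>"
    unfolding importance_def[abs_def] by measurable
  \<comment> \<open>Where \<open>ptr x = 0\<close>, equality of the supports gives
    \<open>pte x = 0\<close>, so the identity holds whatever value the quotient takes there.\<close>
  have eq: "ptr x * importance ptr pte x = pte x" if "x \<in> space \<mu>" for x
  proof (cases "0 < ptr x")
    case False
    then have "ptr x = 0" "pte x = 0" using p0[OF that] supp that by fastforce+
    then show ?thesis by simp
  qed (simp add: importance_def)
  show "input_dist \<mu> pte = density (input_dist \<mu> ptr) (\<lambda>x. ennreal (importance ptr pte x))"
    unfolding input_dist_def
    by (subst density_density_eq)
       (auto intro!: density_cong simp: ennreal_mult[symmetric] p0 r0 eq)
  assume sf: "sigma_finite_measure \<mu>" "sigma_finite_measure \<nu>"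
  note d [measurable] = density_measurable(2)[OF sf tr] density_measurable(2)[OF sf te]
  have "pte x * cte x y = ptr x * ctr x y * importance ptr pte x"
    if "x \<in> space \<mu>" "y \<in> space \<nu>" for x y
  proof (cases "0 < ptr x")
    case True
    then show ?thesis using eq[OF that(1)] cond[OF that(1) _ that(2)] by (simp add: algebra_simps)
  next
    case False
    then have "ptr x = 0" "pte x = 0" using p0[OF that(1)] supp that by fastforce+
    then show ?thesis by simp
  qed
  then show "joint_dist \<mu> \<nu> pte cte
         = density (joint_dist \<mu> \<nu> ptr ctr) (\<lambda>(x, y). ennreal (importance ptr pte x))"
    unfolding joint_dist_def
    by (subst density_density_eq)
       (auto intro!: density_cong AE_I2 simp: ennreal_mult''[symmetric] r0 space_pair_measure)
qed

section \<open>Uniform deviation of the empirical objective\<close>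

text \<open>Among the \<open>n^2\<close> products in the expanded square, those of different
  coordinates factor by independence into the squared expectation, and each of the \<open>n\<close>
  diagonal ones is at most \<open>B^2\<close>.\<close>

lemma integral_square_mean_le:
  fixes u :: "'a \<Rightarrow> real"
  assumes D: "prob_space D" and n: "0 < n" and u [measurable]: "u \<in> borel_measurable D"
    and bound: "\<And>x. x \<in> space D \<Longrightarrow> \<bar>u x\<bar> \<le> B"
  shows "(\<integral>x. ((\<Sum>i<n. u (x i)) / real n)\<^sup>2 \<partial>(\<Pi>\<^sub>M i\<in>{..<n}. D)) \<le> (\<integral>x. u x \<partial>D)\<^sup>2 + B\<^sup>2 / real n"
proof -
  let ?P = "\<Pi>\<^sub>M i\<in>{..<n}. D" and ?a = "\<integral>x. u x \<partial>D"
  interpret D: prob_space D by fact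
  interpret PM: prob_space ?P by (intro prob_space_PiM D)
  interpret product_sigma_finite "\<lambda>_::nat. D" by standard
  have u_int: "integrable D u" using bound by (intro D.integrable_const_bound[where B = B]) auto
  have bP: "\<bar>u (x i)\<bar> \<le> B" if "x \<in> space ?P" "i < n" for x i
    using bound that by (auto simp: space_PiM PiE_iff)
  have B0: "0 \<le> B" using bound D.not_empty by fastforce
  have bPP: "\<bar>u (x i) * u (x j)\<bar> \<le> B\<^sup>2" if "x \<in> space ?P" "i < n" "j < n" for x i j
    using mult_mono[OF bP[OF that(1,2)] bP[OF that(1,3)]] B0
    by (simp add: abs_mult power2_eq_square)
  have int: "integrable ?P (\<lambda>x. u (x i) * u (x j))" if "i < n" "j < n" for i j
    using bPP that by (intro PM.integrable_const_bound[where B = "B\<^sup>2"]) auto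
  have term_le: "(\<integral>x. u (x i) * u (x j) \<partial>?P) \<le> ?a\<^sup>2 + (if i = j then B\<^sup>2 else 0)"
    if "i < n" "j < n" for i j
  proof (cases "i = j")
    case True
    have "(\<integral>x. u (x i) * u (x j) \<partial>?P) \<le> (\<integral>x. B\<^sup>2 \<partial>?P)"
      using bPP that int by (intro integral_mono) (auto dest: abs_le_D1)
    then show ?thesis using True by (simp add: PM.prob_space add_increasing)
  next
    case False
    \<comment> \<open>The two factors are padded with ones to a product over all coordinates, the
      form in which the integral of a product splits.\<close>
    have "(\<integral>x. u (x i) * u (x j) \<partial>?P) = (\<integral>x. (\<Prod>k<n. if k \<in> {i, j} then u (x k) else 1) \<partial>?P)"
      using that False
      by (intro Bochner_Integration.integral_cong refl)
         (subst prod.inter_restrict[symmetric], auto simp: Int_absorb1)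
    also have "\<dots> = (\<Prod>k<n. \<integral>t. (if k \<in> {i, j} then u t else 1) \<partial>D)"
    proof (rule product_integral_prod[where f = "\<lambda>k t. if k \<in> {i, j} then u t else 1"])
      fix k assume "k \<in> {..<n}"
      show "integrable D (\<lambda>t. if k \<in> {i, j} then u t else 1)"
        using u_int by (cases "k \<in> {i, j}") (simp_all only: if_True if_False D.integrable_const)
    qed simp
    also have "\<dots> = (\<Prod>k<n. if k \<in> {i, j} then ?a else 1)"
      by (intro prod.cong refl) (auto simp: D.prob_space)
    also have "\<dots> = ?a * ?a"
      using that False by (subst prod.inter_restrict[symmetric]) (auto simp: Int_absorb1)
    finally show ?thesis using False by (simp add: power2_eq_square)
  qed
  have "(\<integral>x. ((\<Sum>i<n. u (x i)) / real n)\<^sup>2 \<partial>?P)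
      = (\<integral>x. (\<Sum>i<n. \<Sum>j<n. u (x i) * u (x j)) / (real n)\<^sup>2 \<partial>?P)"
    by (simp add: power_divide power2_eq_square sum_product)
  also have "\<dots> = (\<integral>x. (\<Sum>i<n. \<Sum>j<n. u (x i) * u (x j)) \<partial>?P) / (real n)\<^sup>2"
    by simp
  also have "(\<integral>x. (\<Sum>i<n. \<Sum>j<n. u (x i) * u (x j)) \<partial>?P)
      = (\<Sum>i<n. \<Sum>j<n. \<integral>x. u (x i) * u (x j) \<partial>?P)"
    using int
    by (subst Bochner_Integration.integral_sum)
       (auto intro!: sum.cong Bochner_Integration.integral_sum)
  also have "(\<Sum>i<n. \<Sum>j<n. \<integral>x. u (x i) * u (x j) \<partial>?P) / (real n)\<^sup>2
      \<le> (\<Sum>i<n. \<Sum>j<n. ?a\<^sup>2 + (if i = j then B\<^sup>2 else 0)) / (real n)\<^sup>2"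
    using term_le by (intro divide_right_mono sum_mono) auto
  also have "(\<Sum>i<n. \<Sum>j<n. ?a\<^sup>2 + (if i = j then B\<^sup>2 else 0)) = (real n)\<^sup>2 * ?a\<^sup>2 + real n * B\<^sup>2"
    by (simp add: sum.distrib power2_eq_square algebra_simps)
  also have "\<dots> / (real n)\<^sup>2 = ?a\<^sup>2 + B\<^sup>2 / real n"
    using n by (simp add: field_simps power2_eq_square)
  finally show ?thesis .
qed

lemma sum_fun_upd_mean:
  fixes h :: "'a \<Rightarrow> real" and n :: nat
  assumes "i < n"
  shows "(\<Sum>j<n. h ((x(i := t)) j)) = (\<Sum>j<n. h (x j)) + (h t - h (x i))"
proof -
  have "(\<Sum>j<n. h ((x(i := t)) j)) = (\<Sum>j<n. h (x j) + (if j = i then h t - h (x i) else 0))"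
    by (intro sum.cong) auto
  then show ?thesis using assms by (simp add: sum.distrib)
qed

lemma mean_in_interval:
  fixes h :: "'a \<Rightarrow> real"
  assumes "0 < n" "\<And>i. i < n \<Longrightarrow> 0 \<le> h (x i)" "\<And>i. i < n \<Longrightarrow> h (x i) \<le> B"
  shows "0 \<le> (\<Sum>i<n. h (x i)) / real n" "(\<Sum>i<n. h (x i)) / real n \<le> B"
proof -
  show "0 \<le> (\<Sum>i<n. h (x i)) / real n" using assms by (auto intro!: divide_nonneg_nonneg sum_nonneg)
  have "(\<Sum>i<n. h (x i)) \<le> real n * B" using sum_mono[of "{..<n}" "\<lambda>i. h (x i)" "\<lambda>_. B"] assms by simp
  then show "(\<Sum>i<n. h (x i)) / real n \<le> B" using assms(1) by (simp add: field_simps)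
qed

lemma (in prob_space) integral_in_interval:
  fixes h :: "'a \<Rightarrow> real"
  assumes "h \<in> borel_measurable M" "\<And>x. x \<in> space M \<Longrightarrow> 0 \<le> h x" "\<And>x. x \<in> space M \<Longrightarrow> h x \<le> B"
  shows "integrable M h" "0 \<le> (\<integral>x. h x \<partial>M)" "(\<integral>x. h x \<partial>M) \<le> B"
proof -
  show i: "integrable M h" using assms by (intro integrable_const_bound[where B = B]) auto
  show "0 \<le> (\<integral>x. h x \<partial>M)" using assms by (intro integral_nonneg_AE AE_I2)
  have "(\<integral>x. h x \<partial>M) \<le> (\<integral>x. B \<partial>M)" using assms i by (intro integral_mono) auto
  then show "(\<integral>x. h x \<partial>M) \<le> B" by (simp add: prob_space)
qed

lemma (in pair_prob_space)
  fixes f :: "'a \<Rightarrow> real" and g :: "'b \<Rightarrow> real"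
  shows integral_pair_fst: "f \<in> borel_measurable M1 \<Longrightarrow> (\<integral>u. f (fst u) \<partial>(M1 \<Otimes>\<^sub>M M2)) = (\<integral>x. f x \<partial>M1)"
    and integral_pair_snd: "g \<in> borel_measurable M2 \<Longrightarrow> (\<integral>u. g (snd u) \<partial>(M1 \<Otimes>\<^sub>M M2)) = (\<integral>y. g y \<partial>M2)"
proof -
  have "distr (M1 \<Otimes>\<^sub>M M2) M1 fst = M1" by (rule M2.distr_pair_fst)
  then show "f \<in> borel_measurable M1 \<Longrightarrow> (\<integral>u. f (fst u) \<partial>(M1 \<Otimes>\<^sub>M M2)) = (\<integral>x. f x \<partial>M1)"
    using integral_distr[of fst "M1 \<Otimes>\<^sub>M M2" M1 f] by simp
  have "distr (M1 \<Otimes>\<^sub>M M2) M2 snd = M2"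
    by (intro measure_eqI)
       (auto simp: emeasure_distr M2.emeasure_pair_measure_Times M1.emeasure_space_1
         space_pair_measure Times_Int_Times sets.sets_into_space[THEN Int_absorb2]
         vimage_snd)
  then show "g \<in> borel_measurable M2 \<Longrightarrow> (\<integral>u. g (snd u) \<partial>(M1 \<Otimes>\<^sub>M M2)) = (\<integral>y. g y \<partial>M2)"
    using integral_distr[of snd "M1 \<Otimes>\<^sub>M M2" M2 g] by simp
qed

lemma sqrt_mult_divide: "0 < x \<Longrightarrow> sqrt x * (2 * (a / x)) = 2 * a / sqrt x"
proof -
  assume "0 < x"
  then obtain y where "x = y * y" "0 < y" "sqrt x = y"
    by (metis real_sqrt_gt_zero real_sqrt_mult_self less_imp_le abs_of_pos)
  then show ?thesis by (simp add: field_simps)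
qed

text \<open>Reduces the objective to three bounded families, so that the concentration argument is
  free of losses, densities and importance. It is applied with \<open>k = (f, g)\<close>,
  \<open>u\<close> the weighted loss, \<open>v\<close> the square of \<open>g\<close>,
  \<open>w\<close> the function \<open>g\<close> and \<open>\<kappa>\<close> the squared loss bound.
  Here \<open>m\<close> counts the test points.\<close>

locale empirical_objective =
  fixes D :: "'z measure" and E :: "'x measure" and n m :: nat and I :: "'k set"
    and u v :: "'k \<Rightarrow> 'z \<Rightarrow> real" and w :: "'k \<Rightarrow> 'x \<Rightarrow> real" and Bu Bv Bw \<kappa> C :: real
  assumes D: "prob_space D" and E: "prob_space E" and n: "0 < n" and m: "0 < m" and I: "I \<noteq> {}"
    and meas: "\<And>k. k \<in> I \<Longrightarrow> u k \<in> borel_measurable D" "\<And>k. k \<in> I \<Longrightarrow> v k \<in> borel_measurable D"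
      "\<And>k. k \<in> I \<Longrightarrow> w k \<in> borel_measurable E"
    and u: "\<And>k z. k \<in> I \<Longrightarrow> z \<in> space D \<Longrightarrow> 0 \<le> u k z" "\<And>k z. k \<in> I \<Longrightarrow> z \<in> space D \<Longrightarrow> u k z \<le> Bu"
    and v: "\<And>k z. k \<in> I \<Longrightarrow> z \<in> space D \<Longrightarrow> 0 \<le> v k z" "\<And>k z. k \<in> I \<Longrightarrow> z \<in> space D \<Longrightarrow> v k z \<le> Bv"
    and w: "\<And>k z. k \<in> I \<Longrightarrow> z \<in> space E \<Longrightarrow> 0 \<le> w k z" "\<And>k z. k \<in> I \<Longrightarrow> z \<in> space E \<Longrightarrow> w k z \<le> Bw"
    and \<kappa>: "0 \<le> \<kappa>"
begin

definition "P = (\<Pi>\<^sub>M i\<in>{..<n}. D)"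
definition "Q = (\<Pi>\<^sub>M i\<in>{..<m}. E)"

definition objective :: "'k \<Rightarrow> real" where
  "objective k = (\<integral>z. u k z \<partial>D)\<^sup>2 + \<kappa> * ((\<integral>z. v k z \<partial>D) - 2 * (\<integral>z. w k z \<partial>E) + C)"

definition empirical :: "'k \<Rightarrow> (nat \<Rightarrow> 'z) \<times> (nat \<Rightarrow> 'x) \<Rightarrow> real" where
  "empirical k S = ((\<Sum>i<n. u k (fst S i)) / real n)\<^sup>2
     + \<kappa> * ((\<Sum>i<n. v k (fst S i)) / real n - 2 * ((\<Sum>i<m. w k (snd S i)) / real m) + C)"

sublocale D: prob_space D by (rule D)
sublocale E: prob_space E by (rule E)
sublocale PS: prob_space P unfolding P_def by (intro prob_space_PiM D)
sublocale QS: prob_space Q unfolding Q_def by (intro prob_space_PiM E)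
sublocale PQ: pair_prob_space P Q ..

lemma space_P: "x \<in> space P \<Longrightarrow> i < n \<Longrightarrow> x i \<in> space D"
  unfolding P_def by (auto simp: space_PiM)

lemma space_Q: "y \<in> space Q \<Longrightarrow> i < m \<Longrightarrow> y i \<in> space E"
  unfolding Q_def by (auto simp: space_PiM)

lemma upd_P: "x \<in> space P \<Longrightarrow> i < n \<Longrightarrow> t \<in> space D \<Longrightarrow> x(i := t) \<in> space P"
  unfolding P_def by (auto simp: space_PiM PiE_iff extensional_def)

lemma upd_Q: "x \<in> space Q \<Longrightarrow> i < m \<Longrightarrow> t \<in> space E \<Longrightarrow> x(i := t) \<in> space Q"
  unfolding Q_def by (auto simp: space_PiM PiE_iff extensional_def)

lemma bounds_nonneg: "0 \<le> Bu" "0 \<le> Bv" "0 \<le> Bw"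
proof -
  obtain k where k: "k \<in> I" using I by blast
  obtain z z' where z: "z \<in> space D" "z' \<in> space E" using D.not_empty E.not_empty by blast
  show "0 \<le> Bu" "0 \<le> Bv" "0 \<le> Bw"
    using u[OF k z(1)] v[OF k z(1)] w[OF k z(2)] by linarith+
qed

lemma mean_u: "k \<in> I \<Longrightarrow> x \<in> space P \<Longrightarrow> 0 \<le> (\<Sum>i<n. u k (x i)) / real n"
    "k \<in> I \<Longrightarrow> x \<in> space P \<Longrightarrow> (\<Sum>i<n. u k (x i)) / real n \<le> Bu"
  using mean_in_interval[OF n, of "u k" x Bu] u space_P by auto

lemma mean_v: "k \<in> I \<Longrightarrow> x \<in> space P \<Longrightarrow> 0 \<le> (\<Sum>i<n. v k (x i)) / real n"
    "k \<in> I \<Longrightarrow> x \<in> space P \<Longrightarrow> (\<Sum>i<n. v k (x i)) / real n \<le> Bv"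
  using mean_in_interval[OF n, of "v k" x Bv] v space_P by auto

lemma mean_w: "k \<in> I \<Longrightarrow> y \<in> space Q \<Longrightarrow> 0 \<le> (\<Sum>i<m. w k (y i)) / real m"
    "k \<in> I \<Longrightarrow> y \<in> space Q \<Longrightarrow> (\<Sum>i<m. w k (y i)) / real m \<le> Bw"
  using mean_in_interval[OF m, of "w k" y Bw] w space_Q by auto

lemma integral_u: assumes "k \<in> I"
  shows "integrable D (u k)" "0 \<le> (\<integral>z. u k z \<partial>D)" "(\<integral>z. u k z \<partial>D) \<le> Bu"
  using D.integral_in_interval[OF meas(1) u] assms by auto

lemma integral_v: assumes "k \<in> I"
  shows "integrable D (v k)" "0 \<le> (\<integral>z. v k z \<partial>D)" "(\<integral>z. v k z \<partial>D) \<le> Bv"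
  using D.integral_in_interval[OF meas(2) v] assms by auto

lemma integral_w: assumes "k \<in> I"
  shows "integrable E (w k)" "0 \<le> (\<integral>z. w k z \<partial>E)" "(\<integral>z. w k z \<partial>E) \<le> Bw"
  using E.integral_in_interval[OF meas(3) w] assms by auto

text \<open>A crude bound, since both quantities under each difference lie in the same interval. It
  serves finiteness and integrability only and leaves no trace in the final constants.\<close>

lemma objective_minus_empirical_bound:
  assumes k: "k \<in> I" and x: "x \<in> space P" and y: "y \<in> space Q"
  shows "\<bar>objective k - empirical k (x, y)\<bar> \<le> Bu\<^sup>2 + \<kappa> * (Bv + 2 * Bw)"
proof -
  have "\<bar>s\<^sup>2 - t\<^sup>2\<bar> \<le> Bu\<^sup>2" if "0 \<le> s" "s \<le> Bu" "0 \<le> t" "t \<le> Bu" for s t :: real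
    using power_mono[OF that(2,1), of 2] power_mono[OF that(4,3), of 2] zero_le_power2[of s] zero_le_power2[of t]
    by linarith
  then have 1: "\<bar>(\<integral>z. u k z \<partial>D)\<^sup>2 - ((\<Sum>i<n. u k (x i)) / real n)\<^sup>2\<bar> \<le> Bu\<^sup>2"
    using integral_u[OF k] mean_u[OF k x] by blast
  have "\<bar>((\<integral>z. v k z \<partial>D) - (\<Sum>i<n. v k (x i)) / real n) - 2 * ((\<integral>z. w k z \<partial>E) - (\<Sum>i<m. w k (y i)) / real m)\<bar>
      \<le> Bv + 2 * Bw" (is "\<bar>?d\<bar> \<le> _")
  proof -
    have "\<bar>(s - t) - 2 * (s' - t')\<bar> \<le> Bv + 2 * Bw"
      if "0 \<le> s" "s \<le> Bv" "0 \<le> t" "t \<le> Bv" "0 \<le> s'" "s' \<le> Bw" "0 \<le> t'" "t' \<le> Bw"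
      for s t s' t' :: real
      unfolding abs_le_iff using that by auto
    then show ?thesis
      using integral_v[OF k] mean_v[OF k x] integral_w[OF k] mean_w[OF k y] by blast
  qed
  then have 2: "\<bar>\<kappa> * ?d\<bar> \<le> \<kappa> * (Bv + 2 * Bw)"
    using \<kappa> by (simp add: abs_mult mult_left_mono)
  have "objective k - empirical k (x, y)
      = ((\<integral>z. u k z \<partial>D)\<^sup>2 - ((\<Sum>i<n. u k (x i)) / real n)\<^sup>2) + \<kappa> * ?d"
    unfolding objective_def empirical_def by (simp add: algebra_simps)
  then show ?thesis using 1 2 by linarith
qed

text \<open>Values of \<open>u\<close> lie in \<open>[0, Bu]\<close>, so one exchanged point moves
  their mean by at most \<open>Bu / n\<close>; factoring the difference of squares multiplies this
  by at most \<open>2 * Bu\<close>.\<close>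

lemma empirical_change_train:
  assumes k: "k \<in> I" and x: "x \<in> space P" and i: "i < n" and t: "t \<in> space D"
  shows "\<bar>empirical k (x(i := t), y) - empirical k (x, y)\<bar> \<le> (2 * Bu\<^sup>2 + \<kappa> * Bv) / real n"
proof -
  let ?x' = "x(i := t)"
  have x': "?x' \<in> space P" by (rule upd_P[OF x i t])
  define a b where "a = (\<Sum>j<n. u k (x j)) / real n" and "b = (\<Sum>j<n. u k (?x' j)) / real n"
  define c d where "c = (\<Sum>j<n. v k (x j)) / real n" and "d = (\<Sum>j<n. v k (?x' j)) / real n"
  have ab: "0 \<le> a" "a \<le> Bu" "0 \<le> b" "b \<le> Bu"
    unfolding a_def b_def using mean_u[OF k x] mean_u[OF k x'] by auto
  have xi: "x i \<in> space D" by (rule space_P[OF x i])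
  have "b - a = (u k t - u k (x i)) / real n"
    unfolding a_def b_def sum_fun_upd_mean[OF i] by (simp add: add_divide_distrib)
  moreover have "\<bar>u k t - u k (x i)\<bar> \<le> Bu" using u[OF k t] u[OF k xi] by linarith
  ultimately have ba: "\<bar>b - a\<bar> \<le> Bu / real n" by (simp add: divide_right_mono)
  have "d - c = (v k t - v k (x i)) / real n"
    unfolding c_def d_def sum_fun_upd_mean[OF i] by (simp add: add_divide_distrib)
  moreover have "\<bar>v k t - v k (x i)\<bar> \<le> Bv" using v[OF k t] v[OF k xi] by linarith
  ultimately have dc: "\<bar>d - c\<bar> \<le> Bv / real n" by (simp add: divide_right_mono)
  have "\<bar>b\<^sup>2 - a\<^sup>2\<bar> = \<bar>b + a\<bar> * \<bar>b - a\<bar>"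
    by (simp add: abs_mult[symmetric] power2_eq_square algebra_simps)
  also have "\<dots> \<le> (2 * Bu) * (Bu / real n)"
    using ab ba by (intro mult_mono) auto
  finally have sq: "\<bar>b\<^sup>2 - a\<^sup>2\<bar> \<le> 2 * Bu\<^sup>2 / real n" by (simp add: power2_eq_square)
  have "\<bar>\<kappa> * (d - c)\<bar> \<le> \<kappa> * (Bv / real n)"
    using dc \<kappa> by (simp add: abs_mult mult_left_mono del: times_divide_eq_right)
  moreover have "empirical k (?x', y) - empirical k (x, y) = (b\<^sup>2 - a\<^sup>2) + \<kappa> * (d - c)"
    unfolding empirical_def a_def b_def c_def d_def by (simp add: algebra_simps)
  ultimately show ?thesis using sq by (simp add: add_divide_distrib)
qed

lemma empirical_change_test:
  assumes k: "k \<in> I" and y: "y \<in> space Q" and i: "i < m" and t: "t \<in> space E"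
  shows "\<bar>empirical k (x, y(i := t)) - empirical k (x, y)\<bar> \<le> 2 * \<kappa> * Bw / real m"
proof -
  let ?y' = "y(i := t)"
  define c d where "c = (\<Sum>j<m. w k (y j)) / real m" and "d = (\<Sum>j<m. w k (?y' j)) / real m"
  have yi: "y i \<in> space E" by (rule space_Q[OF y i])
  have "d - c = (w k t - w k (y i)) / real m"
    unfolding c_def d_def sum_fun_upd_mean[OF i] by (simp add: add_divide_distrib)
  moreover have "\<bar>w k t - w k (y i)\<bar> \<le> Bw" using w[OF k t] w[OF k yi] by linarith
  ultimately have dc: "\<bar>d - c\<bar> \<le> Bw / real m" by (simp add: divide_right_mono)
  have "empirical k (x, ?y') - empirical k (x, y) = - (2 * \<kappa>) * (d - c)"
    unfolding empirical_def c_def d_def by (simp add: algebra_simps)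
  also have "\<bar>\<dots>\<bar> \<le> 2 * \<kappa> * (Bw / real m)"
    using dc \<kappa> by (simp add: abs_mult mult_left_mono del: times_divide_eq_right)
  finally show ?thesis by simp
qed

lemma empirical_measurable: "k \<in> I \<Longrightarrow> empirical k \<in> borel_measurable (P \<Otimes>\<^sub>M Q)"
proof -
  assume k: "k \<in> I"
  note [measurable] = meas[OF k]
  show ?thesis unfolding empirical_def[abs_def] P_def Q_def by measurable
qed

text \<open>The means of \<open>v\<close> and \<open>w\<close> are unbiased. All excess comes from
  squaring the mean of \<open>u\<close>, whose bias is the variance of an average.\<close>

lemma integral_empirical_le:
  assumes k: "k \<in> I"
  shows "(\<integral>S. empirical k S \<partial>(P \<Otimes>\<^sub>M Q)) \<le> objective k + Bu\<^sup>2 / real n"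
    and "integrable (P \<Otimes>\<^sub>M Q) (empirical k)"
proof -
  note [measurable] = meas[OF k]
  define a where "a x = ((\<Sum>i<n. u k (x i)) / real n)\<^sup>2" for x
  define b where "b x = (\<Sum>i<n. v k (x i)) / real n" for x
  define c where "c y = (\<Sum>i<m. w k (y i)) / real m" for y
  have [measurable]: "a \<in> borel_measurable P" "b \<in> borel_measurable P" "c \<in> borel_measurable Q"
    unfolding a_def[abs_def] b_def[abs_def] c_def[abs_def] P_def Q_def by measurable
  have "\<bar>a x\<bar> \<le> Bu\<^sup>2" "\<bar>b x\<bar> \<le> Bv" if "x \<in> space P" for x
    using mean_u[OF k that] mean_v[OF k that] unfolding a_def b_def by (auto intro: power_mono)
  then have ab: "integrable (P \<Otimes>\<^sub>M Q) (\<lambda>S. a (fst S))" "integrable (P \<Otimes>\<^sub>M Q) (\<lambda>S. b (fst S))"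
    by - (rule PQ.integrable_const_bound[where B = "Bu\<^sup>2"], auto simp: space_pair_measure,
        rule PQ.integrable_const_bound[where B = Bv], auto simp: space_pair_measure)
  have "\<bar>c y\<bar> \<le> Bw" if "y \<in> space Q" for y
    using mean_w[OF k that] unfolding c_def by auto
  then have c: "integrable (P \<Otimes>\<^sub>M Q) (\<lambda>S. c (snd S))"
    by (auto intro!: PQ.integrable_const_bound[where B = Bw] simp: space_pair_measure)
  have emp: "empirical k = (\<lambda>S. a (fst S) + \<kappa> * (b (fst S) - 2 * c (snd S) + C))"
    unfolding empirical_def[abs_def] a_def b_def c_def ..
  show "integrable (P \<Otimes>\<^sub>M Q) (empirical k)" unfolding emp using ab c by auto
  have b_eq: "(\<integral>x. b x \<partial>P) = (\<integral>z. v k z \<partial>D)"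
  proof -
    have "integrable P (\<lambda>x. v k (x i))" if "i < n" for i
      using v[OF k] space_P that unfolding P_def
      by (intro PS.integrable_const_bound[unfolded P_def, where B = Bv]) (auto simp: P_def)
    moreover have "(\<integral>x. v k (x i) \<partial>P) = (\<integral>z. v k z \<partial>D)" if "i < n" for i
      unfolding P_def using that by (intro integral_PiM_component D) auto
    ultimately show ?thesis unfolding b_def using n by simp
  qed
  have c_eq: "(\<integral>y. c y \<partial>Q) = (\<integral>z. w k z \<partial>E)"
  proof -
    have "integrable Q (\<lambda>x. w k (x i))" if "i < m" for i
      using w[OF k] space_Q that unfolding Q_def
      by (intro QS.integrable_const_bound[unfolded Q_def, where B = Bw]) (auto simp: Q_def)
    moreover have "(\<integral>x. w k (x i) \<partial>Q) = (\<integral>z. w k z \<partial>E)" if "i < m" for i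
      unfolding Q_def using that by (intro integral_PiM_component E) auto
    ultimately show ?thesis unfolding c_def using m by simp
  qed
  have a_le: "(\<integral>x. a x \<partial>P) \<le> (\<integral>z. u k z \<partial>D)\<^sup>2 + Bu\<^sup>2 / real n"
    unfolding a_def P_def using u[OF k] by (intro integral_square_mean_le D n) auto
  have "(\<integral>S. empirical k S \<partial>(P \<Otimes>\<^sub>M Q))
      = (\<integral>S. a (fst S) \<partial>(P \<Otimes>\<^sub>M Q))
        + \<kappa> * ((\<integral>S. b (fst S) \<partial>(P \<Otimes>\<^sub>M Q)) - 2 * (\<integral>S. c (snd S) \<partial>(P \<Otimes>\<^sub>M Q)) + C)"
    unfolding emp using ab c by (simp add: PQ.prob_space)
  also have "\<dots> = (\<integral>x. a x \<partial>P) + \<kappa> * ((\<integral>z. v k z \<partial>D) - 2 * (\<integral>z. w k z \<partial>E) + C)"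
    by (simp add: PQ.integral_pair_fst PQ.integral_pair_snd b_eq c_eq)
  also have "\<dots> \<le> objective k + Bu\<^sup>2 / real n"
    unfolding objective_def using a_le by simp
  finally show "(\<integral>S. empirical k S \<partial>(P \<Otimes>\<^sub>M Q)) \<le> objective k + Bu\<^sup>2 / real n" .
qed

section \<open>Supremum of the deviations\<close>

definition "deviation S = (SUP k\<in>I. objective k - empirical k S)"

context
  fixes x y assumes x: "x \<in> space P" and y: "y \<in> space Q"
begin

lemma deviation_bdd_above: "bdd_above ((\<lambda>k. objective k - empirical k (x, y)) ` I)"
  using objective_minus_empirical_bound[OF _ x y] by (intro bdd_aboveI2) (rule abs_le_D1)

lemma deviation_upper: "k \<in> I \<Longrightarrow> objective k - empirical k (x, y) \<le> deviation (x, y)"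
  unfolding deviation_def by (intro cSUP_upper deviation_bdd_above)

lemma abs_deviation_le: "\<bar>deviation (x, y)\<bar> \<le> Bu\<^sup>2 + \<kappa> * (Bv + 2 * Bw)"
proof -
  obtain k where k: "k \<in> I" using I by blast
  have "deviation (x, y) \<le> Bu\<^sup>2 + \<kappa> * (Bv + 2 * Bw)"
    unfolding deviation_def using I objective_minus_empirical_bound[OF _ x y]
    by (intro cSUP_least) (auto dest: abs_le_D1)
  moreover have "- (Bu\<^sup>2 + \<kappa> * (Bv + 2 * Bw)) \<le> deviation (x, y)"
    using objective_minus_empirical_bound[OF k x y] deviation_upper[OF k] by linarith
  ultimately show ?thesis by linarith
qed

text \<open>Transfers the measurability assumed for the extended supremum to the real-valued
  \<open>deviation\<close>, which enters McDiarmid's inequality.\<close>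

lemma ereal_deviation:
  "(SUP k\<in>I. ereal (objective k - empirical k (x, y))) = ereal (deviation (x, y))"
proof -
  let ?s = "SUP k\<in>I. ereal (objective k - empirical k (x, y))"
  obtain k where k: "k \<in> I" using I by blast
  have "?s \<le> ereal (Bu\<^sup>2 + \<kappa> * (Bv + 2 * Bw))"
    using objective_minus_empirical_bound[OF _ x y]
    by (intro SUP_least) (metis abs_le_D1 ereal_less_eq(3))
  moreover have "ereal (objective k - empirical k (x, y)) \<le> ?s" using k by (rule SUP_upper)
  ultimately have "\<bar>?s\<bar> \<noteq> \<infinity>" by auto
  then show ?thesis unfolding deviation_def by (rule ereal_SUP[symmetric])
qed

end

lemma deviation_change:
  assumes "x \<in> space P" "y \<in> space Q" "x' \<in> space P" "y' \<in> space Q"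
    and "\<And>k. k \<in> I \<Longrightarrow> \<bar>empirical k (x', y') - empirical k (x, y)\<bar> \<le> c"
  shows "deviation (x, y) - deviation (x', y') \<le> c"
proof -
  have "deviation (x, y) \<le> deviation (x', y') + c"
    unfolding deviation_def[of "(x, y)"]
  proof (rule cSUP_least[OF I])
    fix k assume k: "k \<in> I"
    show "objective k - empirical k (x, y) \<le> deviation (x', y') + c"
      using deviation_upper[OF assms(3,4) k] assms(5)[OF k] by linarith
  qed
  then show ?thesis by simp
qed

text \<open>
  The supremum of the deviations and the empirical objective at the fixed competitor \<open>k0\<close> enter one
  single application of McDiarmid's inequality, so that no union bound is needed.
\<close>

theorem uniform_deviation:
  assumes sup_meas: "(\<lambda>S. SUP k\<in>I. ereal (objective k - empirical k S)) \<in> borel_measurable (P \<Otimes>\<^sub>M Q)"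
    and U_meas: "U1 \<in> borel_measurable P" "U2 \<in> borel_measurable P" "U3 \<in> borel_measurable Q"
    and U_bound: "\<And>x. x \<in> space P \<Longrightarrow> \<bar>U1 x\<bar> \<le> b1" "\<And>x. x \<in> space P \<Longrightarrow> \<bar>U2 x\<bar> \<le> b2"
      "\<And>y. y \<in> space Q \<Longrightarrow> \<bar>U3 y\<bar> \<le> b3"
    and U1: "\<And>k x. k \<in> I \<Longrightarrow> x \<in> space P \<Longrightarrow> \<bar>(\<integral>z. u k z \<partial>D) - (\<Sum>i<n. u k (x i)) / real n\<bar> \<le> U1 x"
    and U2: "\<And>k x. k \<in> I \<Longrightarrow> x \<in> space P \<Longrightarrow> (\<integral>z. v k z \<partial>D) - (\<Sum>i<n. v k (x i)) / real n \<le> U2 x"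
    and U3: "\<And>k y. k \<in> I \<Longrightarrow> y \<in> space Q \<Longrightarrow> (\<Sum>i<m. w k (y i)) / real m - (\<integral>z. w k z \<partial>E) \<le> U3 y"
    and k0: "k0 \<in> I" and Bu: "0 < Bu" and \<delta>: "0 < \<delta>" "\<delta> < 1"
  shows "\<exists>A\<in>sets (P \<Otimes>\<^sub>M Q). 1 - \<delta> \<le> measure (P \<Otimes>\<^sub>M Q) A \<and> (\<forall>S\<in>A. \<forall>k\<in>I.
     objective k - empirical k S + empirical k0 S
       \<le> objective k0 + 2 * Bu * (\<integral>x. U1 x \<partial>P) + \<kappa> * ((\<integral>x. U2 x \<partial>P) + 2 * (\<integral>y. U3 y \<partial>Q))
         + sqrt (ln (1 / \<delta>) / 2) * (2 * (2 * Bu\<^sup>2 + \<kappa> * Bv) / sqrt (real n) + 4 * \<kappa> * Bw / sqrt (real m))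
         + Bu\<^sup>2 / real n)"
proof -
  let ?R = "P \<Otimes>\<^sub>M Q"
  have dev_meas [measurable]: "deviation \<in> borel_measurable ?R"
  proof -
    have "(\<lambda>S. real_of_ereal (SUP k\<in>I. ereal (objective k - empirical k S))) \<in> borel_measurable ?R"
      using sup_meas by measurable
    then show ?thesis
      by (rule measurable_cong[THEN iffD1, rotated])
         (auto simp: space_pair_measure ereal_deviation)
  qed
  note emp_meas [measurable] = empirical_measurable[OF k0]
  define \<phi> where "\<phi> = (\<lambda>S. deviation S + empirical k0 S)"
  have \<phi>_meas: "\<phi> \<in> borel_measurable ?R" unfolding \<phi>_def by measurable
  define K where "K = Bu\<^sup>2 + \<kappa> * (Bv + 2 * Bw)"
  have emp_bound: "\<bar>empirical k0 (x, y)\<bar> \<le> K + \<bar>objective k0\<bar>" if "x \<in> space P" "y \<in> space Q" for x y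
    using objective_minus_empirical_bound[OF k0 that] unfolding K_def by linarith
  have \<phi>_bound: "\<bar>\<phi> (x, y)\<bar> \<le> K + (K + \<bar>objective k0\<bar>)" if "x \<in> space P" "y \<in> space Q" for x y
    using abs_deviation_le[OF that] emp_bound[OF that] unfolding \<phi>_def K_def by linarith
  define c0 d0 where "c0 = (2 * Bu\<^sup>2 + \<kappa> * Bv) / real n" and "d0 = 2 * \<kappa> * Bw / real m"
  \<comment> \<open>Both summands of \<open>\<phi>\<close> react to an exchanged point, hence twice
    the increment of the empirical objective.\<close>
  have \<phi>_c: "\<phi> (x, y) - \<phi> (x(i := t), y) \<le> 2 * c0"
    if "x \<in> space P" "y \<in> space Q" "i < n" "t \<in> space D" for x y i t
    using deviation_change[OF that(1,2) upd_P[OF that(1,3,4)] that(2)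
        empirical_change_train[OF _ that(1,3,4), folded c0_def]]
      empirical_change_train[OF k0 that(1,3,4), of y, folded c0_def]
    unfolding \<phi>_def by linarith
  have \<phi>_d: "\<phi> (x, y) - \<phi> (x, y(i := t)) \<le> 2 * d0"
    if "x \<in> space P" "y \<in> space Q" "i < m" "t \<in> space E" for x y i t
    using deviation_change[OF that(1,2) that(1) upd_Q[OF that(2,3,4)]
        empirical_change_test[OF _ that(2,3,4), folded d0_def]]
      empirical_change_test[OF k0 that(2,3,4), of x, folded d0_def]
    unfolding \<phi>_def by linarith
  define V where "V = real n * (2 * c0)\<^sup>2 + real m * (2 * d0)\<^sup>2"
  have c0: "0 < c0" unfolding c0_def using Bu n \<kappa> bounds_nonneg by (simp add: add_pos_nonneg)
  have d0: "0 \<le> d0" unfolding d0_def using \<kappa> bounds_nonneg by simp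
  have V: "0 < V" unfolding V_def using c0 n by (simp add: add_pos_nonneg)
  \<comment> \<open>Chosen so that the McDiarmid exponent \<open>- 2 * t\<^sup>2 / V\<close> equals
    \<open>- ln (1 / \<delta>)\<close>.\<close>
  define t where "t = sqrt (ln (1 / \<delta>) / 2 * V)"
  have ln: "0 < ln (1 / \<delta>)" using \<delta> by simp
  have t: "0 < t" unfolding t_def using ln V by simp
  let ?m = "\<integral>S. \<phi> S \<partial>?R"
  have "measure ?R {S \<in> space ?R. ?m + t \<le> \<phi> S} \<le> exp (- 2 * t\<^sup>2 / V)"
    using McDiarmid_pair[OF D E \<phi>_meas[unfolded P_def Q_def] \<phi>_bound[unfolded P_def Q_def]
        \<phi>_c[unfolded P_def Q_def] \<phi>_d[unfolded P_def Q_def]] V t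
    unfolding V_def P_def Q_def by blast
  also have "- 2 * t\<^sup>2 / V = - ln (1 / \<delta>)"
    unfolding t_def using ln V by simp
  also have "exp (- ln (1 / \<delta>)) = \<delta>" using \<delta> by (simp add: ln_div)
  finally have tail: "measure ?R {S \<in> space ?R. ?m + t \<le> \<phi> S} \<le> \<delta>" .
  define A where "A = {S \<in> space ?R. \<phi> S < ?m + t}"
  have A: "A \<in> sets ?R" unfolding A_def using \<phi>_meas by measurable
  have "measure ?R A = 1 - measure ?R {S \<in> space ?R. ?m + t \<le> \<phi> S}"
  proof -
    have "{S \<in> space ?R. ?m + t \<le> \<phi> S} = space ?R - A" unfolding A_def by auto
    then show ?thesis using PQ.prob_compl[OF A] by simp
  qed
  then have prob: "1 - \<delta> \<le> measure ?R A" using tail by simp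

  \<comment> \<open>Subadditivity of the square root separates the two sample sizes;
    \<open>n\<close> increments of order \<open>1 / n\<close> contribute order
    \<open>1 / sqrt n\<close>.\<close>
  have tle: "t \<le> sqrt (ln (1 / \<delta>) / 2)
      * (2 * (2 * Bu\<^sup>2 + \<kappa> * Bv) / sqrt (real n) + 4 * \<kappa> * Bw / sqrt (real m))"
  proof -
    have "sqrt V \<le> sqrt (real n * (2 * c0)\<^sup>2) + sqrt (real m * (2 * d0)\<^sup>2)"
      unfolding V_def by (intro sqrt_add_le_add_sqrt) auto
    also have "sqrt (real n * (2 * c0)\<^sup>2) = sqrt (real n) * (2 * c0)"
      using c0 by (simp add: real_sqrt_mult)
    also have "sqrt (real m * (2 * d0)\<^sup>2) = sqrt (real m) * (2 * d0)"
      using d0 by (simp add: real_sqrt_mult)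
    also have "sqrt (real n) * (2 * c0) = 2 * (2 * Bu\<^sup>2 + \<kappa> * Bv) / sqrt (real n)"
      unfolding c0_def using n by (simp only: sqrt_mult_divide of_nat_0_less_iff)
    also have "sqrt (real m) * (2 * d0) = 4 * \<kappa> * Bw / sqrt (real m)"
      unfolding d0_def using m sqrt_mult_divide[of "real m" "2 * \<kappa> * Bw"] by simp
    finally show ?thesis
      unfolding t_def real_sqrt_mult using ln by (intro mult_left_mono) auto
  qed

  \<comment> \<open>A measurable majorant of \<open>deviation\<close>, linear in \<open>U1\<close>,
    \<open>U2\<close> and \<open>U3\<close>, so its integral is expressed by theirs.\<close>
  define W where "W = (\<lambda>S. 2 * Bu * U1 (fst S) + \<kappa> * (U2 (fst S) + 2 * U3 (snd S)))"
  have U_int: "integrable ?R (\<lambda>S. U1 (fst S))" "integrable ?R (\<lambda>S. U2 (fst S))" "integrable ?R (\<lambda>S. U3 (snd S))"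
    using U_meas U_bound
    by - (rule PQ.integrable_const_bound[where B = b1], auto simp: space_pair_measure,
        rule PQ.integrable_const_bound[where B = b2], auto simp: space_pair_measure,
        rule PQ.integrable_const_bound[where B = b3], auto simp: space_pair_measure)
  have W_int: "integrable ?R W" unfolding W_def using U_int by auto
  have W_eq: "(\<integral>S. W S \<partial>?R) = 2 * Bu * (\<integral>x. U1 x \<partial>P) + \<kappa> * ((\<integral>x. U2 x \<partial>P) + 2 * (\<integral>y. U3 y \<partial>Q))"
    unfolding W_def using U_int
    by (simp add: PQ.integral_pair_fst[OF U_meas(1)] PQ.integral_pair_fst[OF U_meas(2)]
        PQ.integral_pair_snd[OF U_meas(3)])
  have dev_W: "deviation (x, y) \<le> W (x, y)" if x: "x \<in> space P" and y: "y \<in> space Q" for x y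
    unfolding deviation_def
  proof (rule cSUP_least[OF I])
    fix k assume k: "k \<in> I"
    define a b where "a = (\<integral>z. u k z \<partial>D)" and "b = (\<Sum>i<n. u k (x i)) / real n"
    have ab: "0 \<le> a" "a \<le> Bu" "0 \<le> b" "b \<le> Bu" "\<bar>a - b\<bar> \<le> U1 x"
      unfolding a_def b_def using integral_u[OF k] mean_u[OF k x] U1[OF k x] by auto
    have "a\<^sup>2 - b\<^sup>2 = (a + b) * (a - b)" by (simp add: power2_eq_square algebra_simps)
    also have "\<dots> \<le> (a + b) * U1 x" using ab by (intro mult_left_mono) auto
    \<comment> \<open>Replacing \<open>a + b\<close> by its upper bound requires \<open>U1 x\<close>
      to be nonnegative, which holds because it bounds an absolute value; here the two-sided control
      of \<open>u\<close> is used.\<close>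
    also have "\<dots> \<le> 2 * Bu * U1 x" using ab by (intro mult_right_mono) auto
    finally have 1: "a\<^sup>2 - b\<^sup>2 \<le> 2 * Bu * U1 x" .
    let ?d = "((\<integral>z. v k z \<partial>D) - (\<Sum>i<n. v k (x i)) / real n)
        + 2 * ((\<Sum>i<m. w k (y i)) / real m - (\<integral>z. w k z \<partial>E))"
    have 2: "\<kappa> * ?d \<le> \<kappa> * (U2 x + 2 * U3 y)"
      using U2[OF k x] U3[OF k y] \<kappa> by (intro mult_left_mono) auto
    have "objective k - empirical k (x, y) = (a\<^sup>2 - b\<^sup>2) + \<kappa> * ?d"
      unfolding objective_def empirical_def a_def b_def by (simp add: algebra_simps)
    then show "objective k - empirical k (x, y) \<le> W (x, y)"
      unfolding W_def using 1 2 by simp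
  qed
  have dev_int: "integrable ?R deviation"
    using abs_deviation_le by (intro PQ.integrable_const_bound[where B = K])
      (auto simp: space_pair_measure K_def)
  have "(\<integral>S. deviation S \<partial>?R) \<le> (\<integral>S. W S \<partial>?R)"
    using dev_int W_int dev_W by (intro integral_mono) (auto simp: space_pair_measure)
  moreover have "?m = (\<integral>S. deviation S \<partial>?R) + (\<integral>S. empirical k0 S \<partial>?R)"
    unfolding \<phi>_def using dev_int integral_empirical_le(2)[OF k0] by simp
  ultimately have m_le: "?m \<le> (\<integral>S. W S \<partial>?R) + objective k0 + Bu\<^sup>2 / real n"
    using integral_empirical_le(1)[OF k0] by simp
  \<comment> \<open>The event is fixed before \<open>k\<close>, so the bound may be read at an index
    that depends on \<open>S\<close>, as the empirical minimizer does.\<close>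
  show ?thesis
  proof (intro bexI[OF _ A] conjI prob ballI)
    fix S k assume "S \<in> A" and k: "k \<in> I"
    then obtain x y where S: "S = (x, y)" "x \<in> space P" "y \<in> space Q" "\<phi> S < ?m + t"
      unfolding A_def by (auto simp: space_pair_measure)
    have "objective k - empirical k S + empirical k0 S \<le> \<phi> S"
      unfolding \<phi>_def S(1) using deviation_upper[OF S(2,3) k] by simp
    then show "objective k - empirical k S + empirical k0 S
       \<le> objective k0 + 2 * Bu * (\<integral>x. U1 x \<partial>P) + \<kappa> * ((\<integral>x. U2 x \<partial>P) + 2 * (\<integral>y. U3 y \<partial>Q))
         + sqrt (ln (1 / \<delta>) / 2) * (2 * (2 * Bu\<^sup>2 + \<kappa> * Bv) / sqrt (real n) + 4 * \<kappa> * Bw / sqrt (real m))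
         + Bu\<^sup>2 / real n"
      using S(4) m_le tle unfolding W_eq by linarith
  qed
qed

end

section \<open>Complexity of squares and products\<close>

lemma symmetrized_bound:
  assumes "\<And>g x. g \<in> H \<Longrightarrow> x \<in> X \<Longrightarrow> \<bar>g x\<bar> \<le> (B :: real)" "g \<in> symmetrized H" "x \<in> X"
  shows "\<bar>g x\<bar> \<le> B"
  using assms unfolding symmetrized_def by auto

lemma symmetrized_measurable:
  assumes "\<And>g. g \<in> H \<Longrightarrow> g \<in> borel_measurable D" "g \<in> symmetrized H"
  shows "g \<in> borel_measurable D"
  using assms unfolding symmetrized_def by auto

text \<open>Pointwise in the sample this is the Lipschitz bound for squaring. Enlarging
  \<open>H\<close> to its symmetrized class then expresses the result in the complexity that appears
  in the final bound.\<close>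

lemma integral_rad_mean_square_le:
  assumes D: "prob_space D" and n: "0 < n" and H: "H \<noteq> {}" and B: "0 \<le> B"
    and bound: "\<And>g x. g \<in> H \<Longrightarrow> x \<in> space D \<Longrightarrow> \<bar>g x\<bar> \<le> B"
    and meas: "rademacher_measurable n D {\<lambda>x. (g x)\<^sup>2 | g. g \<in> H}"
      "rademacher_measurable n D (symmetrized H)"
  shows "(\<integral>x. rad_mean n {\<lambda>x. (g x)\<^sup>2 | g. g \<in> H} x \<partial>(\<Pi>\<^sub>M i\<in>{..<n}. D))
         \<le> 2 * B * (\<integral>x. rad_mean n (symmetrized H) x \<partial>(\<Pi>\<^sub>M i\<in>{..<n}. D))"
proof -
  let ?P = "\<Pi>\<^sub>M i\<in>{..<n}. D" and ?S = "{\<lambda>x. (g x)\<^sup>2 | g. g \<in> H}"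
  have S: "?S = (\<lambda>g x. (g x)\<^sup>2) ` H" by auto
  have ne: "?S \<noteq> {}" "symmetrized H \<noteq> {}" using H unfolding symmetrized_def by auto
  have sb: "\<bar>g x\<bar> \<le> B" if "g \<in> symmetrized H" "x \<in> space D" for g x
    by (rule symmetrized_bound[where H = H and X = "space D"]) (use bound that in auto)
  have Sb: "\<bar>h x\<bar> \<le> B\<^sup>2" if "h \<in> ?S" "x \<in> space D" for h x
    using that bound B by (auto simp: abs_le_square_iff[symmetric])
  have int: "integrable ?P (rad_mean n ?S)" "integrable ?P (rad_mean n (symmetrized H))"
    using rademacher_eq_integral(1)[OF D meas(1) ne(1)] rademacher_bounded_finite[OF D meas(1) ne(1) n, of "B\<^sup>2"] Sb
      rademacher_eq_integral(1)[OF D meas(2) ne(2)] rademacher_bounded_finite[OF D meas(2) ne(2) n, of B] sb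
    by blast+
  have "(\<integral>x. rad_mean n ?S x \<partial>?P) \<le> (\<integral>x. 2 * B * rad_mean n (symmetrized H) x \<partial>?P)"
  proof (rule integral_mono)
    fix x assume x: "x \<in> space ?P"
    then have xi: "x i \<in> space D" if "i < n" for i using that by (auto simp: space_PiM)
    have bS: "bounded_on ?S (\<lambda>h. h (x i))" if "i < n" for i
      using Sb xi[OF that] by (intro bounded_onI[of _ _ "B\<^sup>2"]) auto
    have bs: "bounded_on (symmetrized H) (\<lambda>h. h (x i))" if "i < n" for i
      using sb xi[OF that] by (intro bounded_onI[of _ _ B]) auto
    have "rad_avg n ?S (\<lambda>_. 0) (\<lambda>h i. h (x i)) = rad_avg n H (\<lambda>_. 0) (\<lambda>g i. (g (x i))\<^sup>2)"
      unfolding S rad_avg_image ..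
    also have "\<dots> \<le> 2 * B * rad_avg n H (\<lambda>_. 0) (\<lambda>g i. g (x i))"
      using H B bound xi by (intro rad_avg_square) auto
    also have "\<dots> \<le> 2 * B * rad_avg n (symmetrized H) (\<lambda>_. 0) (\<lambda>g i. g (x i))"
    proof (intro mult_left_mono)
      have "id ` H \<subseteq> symmetrized H" unfolding symmetrized_def by auto
      from rad_avg_subset[OF H this, where c = "\<lambda>_. 0" and a = "\<lambda>g i. g (x i)" and n = n, OF bs]
      show "rad_avg n H (\<lambda>_. 0) (\<lambda>g i. g (x i)) \<le> rad_avg n (symmetrized H) (\<lambda>_. 0) (\<lambda>g i. g (x i))"
        by simp
    qed (use B in simp)
    finally have "rad_avg n ?S (\<lambda>_. 0) (\<lambda>h i. h (x i)) / real n
        \<le> 2 * B * rad_avg n (symmetrized H) (\<lambda>_. 0) (\<lambda>g i. g (x i)) / real n"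
      by (rule divide_right_mono) simp
    then show "rad_mean n ?S x \<le> 2 * B * rad_mean n (symmetrized H) x"
      using rad_mean_eq_rad_avg(1)[OF n ne(1) bS] rad_mean_eq_rad_avg(1)[OF n ne(2) bs] by simp
  qed (use int in auto)
  then show ?thesis by simp
qed

text \<open>Forgetting labels turns a labelled sample into an input sample of the correct law;
  \<open>compose\<close> applies \<open>fst\<close> coordinatewise and keeps the result
  extensional.\<close>

lemma distr_PiM_fst:
  fixes n :: nat
  assumes "prob_space J" "prob_space D" "fst \<in> J \<rightarrow>\<^sub>M D" "distr J D fst = D"
  shows "distr (\<Pi>\<^sub>M i\<in>{..<n}. J) (\<Pi>\<^sub>M i\<in>{..<n}. D) (compose {..<n} fst) = (\<Pi>\<^sub>M i\<in>{..<n}. D)"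
    and "compose {..<n} fst \<in> (\<Pi>\<^sub>M i\<in>{..<n}. J) \<rightarrow>\<^sub>M (\<Pi>\<^sub>M i\<in>{..<n}. D)"
proof -
  show "distr (\<Pi>\<^sub>M i\<in>{..<n}. J) (\<Pi>\<^sub>M i\<in>{..<n}. D) (compose {..<n} fst) = (\<Pi>\<^sub>M i\<in>{..<n}. D)"
    using distr_PiM_finite_prob_space'[of "{..<n}" "\<lambda>_. J" "\<lambda>_. D" fst] assms by simp
  have "(\<lambda>x. \<lambda>i\<in>{..<n}. fst (x i)) \<in> (\<Pi>\<^sub>M i\<in>{..<n}. J) \<rightarrow>\<^sub>M (\<Pi>\<^sub>M i\<in>{..<n}. D)"
  proof (rule measurable_restrict)
    fix i assume "i \<in> {..<n}"
    then have "(\<lambda>x. x i) \<in> (\<Pi>\<^sub>M i\<in>{..<n}. J) \<rightarrow>\<^sub>M J" by simp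
    then show "(\<lambda>x. fst (x i)) \<in> (\<Pi>\<^sub>M i\<in>{..<n}. J) \<rightarrow>\<^sub>M D"
      by (rule measurable_compose[OF _ assms(3)])
  qed
  then show "compose {..<n} fst \<in> (\<Pi>\<^sub>M i\<in>{..<n}. J) \<rightarrow>\<^sub>M (\<Pi>\<^sub>M i\<in>{..<n}. D)"
    unfolding compose_def .
qed

text \<open>The product class lives on labelled samples, the classes on the right on inputs. At
  almost every labelled sample the two sides are compared at the projected inputs, and the law of
  the projection carries the integral of the right side over to input samples.\<close>

lemma integral_rad_mean_product_le:
  fixes J :: "('a \<times> 'b) measure" and D :: "'a measure" and \<phi> :: "real \<Rightarrow> 'b \<Rightarrow> real"
  assumes J: "prob_space J" and D: "prob_space D" and fst: "fst \<in> J \<rightarrow>\<^sub>M D" "distr J D fst = D"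
    and n: "0 < n" and F: "F \<noteq> {}" and H: "H \<noteq> {}" and L: "0 \<le> L" and A: "0 \<le> A" and B: "0 \<le> B"
    and \<phi>: "\<And>f z. f \<in> F \<Longrightarrow> z \<in> space J \<Longrightarrow> \<bar>\<phi> (f (fst z)) (snd z)\<bar> \<le> A"
    and lip: "\<And>f f' z. f \<in> F \<Longrightarrow> f' \<in> F \<Longrightarrow> z \<in> space J \<Longrightarrow>
       \<bar>\<phi> (f (fst z)) (snd z) - \<phi> (f' (fst z)) (snd z)\<bar> \<le> L * \<bar>f (fst z) - f' (fst z)\<bar>"
    and bound: "\<And>g x. g \<in> H \<Longrightarrow> x \<in> space D \<Longrightarrow> \<bar>g x\<bar> \<le> B"
    and meas: "rademacher_measurable n D F" "rademacher_measurable n D H"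
      "rademacher_measurable n J {\<lambda>(x, y). \<phi> (f x) y * g x | f g. f \<in> F \<and> g \<in> H}"
    and fin: "rademacher n D F \<noteq> \<infinity>"
  shows "(\<integral>z. rad_mean n {\<lambda>(x, y). \<phi> (f x) y * g x | f g. f \<in> F \<and> g \<in> H} z \<partial>(\<Pi>\<^sub>M i\<in>{..<n}. J))
      \<le> (A + B) * (L * (\<integral>x. rad_mean n F x \<partial>(\<Pi>\<^sub>M i\<in>{..<n}. D)) + (\<integral>x. rad_mean n H x \<partial>(\<Pi>\<^sub>M i\<in>{..<n}. D)))"
proof -
  let ?PJ = "\<Pi>\<^sub>M i\<in>{..<n}. J" and ?P = "\<Pi>\<^sub>M i\<in>{..<n}. D"
  let ?K = "{\<lambda>(x, y). \<phi> (f x) y * g x | f g. f \<in> F \<and> g \<in> H}"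
  let ?\<pi> = "compose {..<n} fst"
  note \<pi> = distr_PiM_fst[OF J D fst, of n]
  have K: "?K = (\<lambda>k (x, y). \<phi> (fst k x) y * snd k x) ` (F \<times> H)"
  proof (intro subset_antisym subsetI)
    fix h assume "h \<in> ?K"
    then obtain f g where "f \<in> F" "g \<in> H" "h = (\<lambda>(x, y). \<phi> (f x) y * g x)" by blast
    then show "h \<in> (\<lambda>k (x, y). \<phi> (fst k x) y * snd k x) ` (F \<times> H)"
      by (intro image_eqI[of _ _ "(f, g)"]) auto
  next
    fix h assume "h \<in> (\<lambda>k (x, y). \<phi> (fst k x) y * snd k x) ` (F \<times> H)"
    then obtain k where "k \<in> F \<times> H" "h = (\<lambda>(x, y). \<phi> (fst k x) y * snd k x)" by blast
    then show "h \<in> ?K" by (auto simp: mem_Times_iff)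
  qed
  have neK: "?K \<noteq> {}" using F H unfolding K by auto
  have fst_space: "fst z \<in> space D" if "z \<in> space J" for z using measurable_space[OF fst(1) that] .
  have Kb: "\<bar>h z\<bar> \<le> A * B" if "h \<in> ?K" "z \<in> space J" for h z
  proof -
    obtain f g where fg: "f \<in> F" "g \<in> H" "h = (\<lambda>(x, y). \<phi> (f x) y * g x)" using \<open>h \<in> ?K\<close> by blast
    then have "\<bar>h z\<bar> = \<bar>\<phi> (f (fst z)) (snd z)\<bar> * \<bar>g (fst z)\<bar>"
      by (simp add: split_beta abs_mult)
    also have "\<dots> \<le> A * B"
      using \<phi>[OF fg(1) that(2)] bound[OF fg(2) fst_space[OF that(2)]] A by (intro mult_mono) auto
    finally show ?thesis .
  qed
  have finH: "rademacher n D H \<noteq> \<infinity>" using rademacher_bounded_finite[OF D meas(2) H n, of B] bound by blast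
  have intK: "integrable ?PJ (rad_mean n ?K)"
    using rademacher_eq_integral(1)[OF J meas(3) neK] rademacher_bounded_finite[OF J meas(3) neK n, of "A * B"] Kb by blast
  have intF: "integrable ?P (rad_mean n F)" by (rule rademacher_eq_integral(1)[OF D meas(1) F fin])
  have intH: "integrable ?P (rad_mean n H)" by (rule rademacher_eq_integral(1)[OF D meas(2) H finH])
  define R where "R x = (A + B) * (L * rad_mean n F x + rad_mean n H x)" for x
  have intR: "integrable ?P R" unfolding R_def[abs_def] using intF intH by auto
  \<comment> \<open>\<open>F\<close> is known to be bounded only along almost every input sample;
    the projection pulls this back to labelled samples.\<close>
  have "AE x in distr ?PJ ?P ?\<pi>. \<forall>i<n. bounded_on F (\<lambda>f. f (x i))"
    unfolding \<pi>(1) by (rule rademacher_AE[OF D meas(1) F n fin])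
  then have ae: "AE z in ?PJ. \<forall>i<n. bounded_on F (\<lambda>f. f (?\<pi> z i))"
    by (rule AE_distrD[OF \<pi>(2)])
  have "(\<integral>z. rad_mean n ?K z \<partial>?PJ) \<le> (\<integral>z. R (?\<pi> z) \<partial>?PJ)"
  proof (rule integral_mono_AE[OF intK])
    show "integrable ?PJ (\<lambda>z. R (?\<pi> z))"
      using intR by (intro integrable_distr[OF \<pi>(2)]) (simp only: \<pi>(1))
    show "AE z in ?PJ. rad_mean n ?K z \<le> R (?\<pi> z)"
      using ae AE_space
    proof eventually_elim
      case (elim z)
      have zi: "z i \<in> space J" if "i < n" for i using elim(2) that by (auto simp: space_PiM)
      have \<pi>i: "?\<pi> z i = fst (z i)" if "i < n" for i using that by (simp add: compose_def)
      have bF: "bounded_on F (\<lambda>f. f (?\<pi> z i))" if "i < n" for i using elim(1) that by blast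
      have bH: "bounded_on H (\<lambda>g. g (?\<pi> z i))" if "i < n" for i
        using bound fst_space[OF zi[OF that]] \<pi>i[OF that] by (intro bounded_onI[of _ _ B]) auto
      have bK: "bounded_on ?K (\<lambda>h. h (z i))" if "i < n" for i
        using Kb zi[OF that] by (intro bounded_onI[of _ _ "A * B"]) auto
      \<comment> \<open>Reindexing by pairs turns the class of products into a family on
        \<open>F \<times> H\<close> whose factors depend on one component each.\<close>
      have "rad_avg n ?K (\<lambda>_. 0) (\<lambda>h i. h (z i))
          = rad_avg n (F \<times> H) (\<lambda>_. 0) (\<lambda>k i. \<phi> (fst k (fst (z i))) (snd (z i)) * snd k (?\<pi> z i))"
        unfolding K rad_avg_image by (intro rad_avg_cong) (simp_all add: split_beta \<pi>i)
      also have "\<dots> \<le> (A + B) * (L * rad_avg n F (\<lambda>_. 0) (\<lambda>f i. f (?\<pi> z i))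
            + rad_avg n H (\<lambda>_. 0) (\<lambda>g i. g (?\<pi> z i)))"
      proof (rule rad_avg_product_class[OF F H L A B, where \<phi> = "\<lambda>f i. \<phi> (f (fst (z i))) (snd (z i))"])
        show "\<bar>\<phi> (f (fst (z i))) (snd (z i)) - \<phi> (f' (fst (z i))) (snd (z i))\<bar>
            \<le> L * \<bar>f (?\<pi> z i) - f' (?\<pi> z i)\<bar>" if "f \<in> F" "f' \<in> F" "i < n" for f f' i
          unfolding \<pi>i[OF that(3)] by (rule lip[OF that(1,2) zi[OF that(3)]])
        show "\<bar>g (?\<pi> z i)\<bar> \<le> B" if "g \<in> H" "i < n" for g i
          unfolding \<pi>i[OF that(2)] by (rule bound[OF that(1) fst_space[OF zi[OF that(2)]]])
      qed (use \<phi> zi bF in auto)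
      finally have "rad_avg n ?K (\<lambda>_. 0) (\<lambda>h i. h (z i)) / real n
          \<le> (A + B) * (L * rad_avg n F (\<lambda>_. 0) (\<lambda>f i. f (?\<pi> z i))
            + rad_avg n H (\<lambda>_. 0) (\<lambda>g i. g (?\<pi> z i))) / real n"
        by (rule divide_right_mono) simp
      moreover have "rad_mean n ?K z = rad_avg n ?K (\<lambda>_. 0) (\<lambda>h i. h (z i)) / real n"
        "rad_mean n F (?\<pi> z) = rad_avg n F (\<lambda>_. 0) (\<lambda>f i. f (?\<pi> z i)) / real n"
        "rad_mean n H (?\<pi> z) = rad_avg n H (\<lambda>_. 0) (\<lambda>g i. g (?\<pi> z i)) / real n"
        using bK bF bH by (intro rad_mean_eq_rad_avg n neK F H; blast)+
      ultimately show ?case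
        unfolding R_def by (simp only: times_divide_eq_right add_divide_distrib[symmetric])
    qed
  qed
  also have "(\<integral>z. R (?\<pi> z) \<partial>?PJ) = (\<integral>x. R x \<partial>?P)"
    using integral_distr[OF \<pi>(2), of R] borel_measurable_integrable[OF intR] by (simp add: \<pi>(1))
  also have "\<dots> = (A + B) * (L * (\<integral>x. rad_mean n F x \<partial>?P) + (\<integral>x. rad_mean n H x \<partial>?P))"
    unfolding R_def using intF intH by simp
  finally show ?thesis .
qed

section \<open>The generalization bound\<close>

text \<open>The factor 8 is 4 + 4. Products contribute 2MG from linearizing the squared mean, 2 from
  symmetrization and M + G from polarization. Squares contribute 2 from symmetrization and 2G from
  contraction, and 4 m^2 G is at most 4MG(M + G). For the test sample, the coefficient 2 of the
  cross term meets the 2 of symmetrization. The increments give 2(2 + 1) = 6 and, by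
  \<open>G \<le> G\<^sup>2\<close>, 4 as multiples of M^2 G^2, both covered by 10.\<close>

lemma deviation_constants_le:
  fixes M G L m RP R2 RF RG RT s a b :: real
  assumes m: "0 \<le> m" "m \<le> M" and G: "1 \<le> G" and L: "0 \<le> L"
    and RP: "RP \<le> (M + G) * (L * RF + RG)" and R2: "R2 \<le> 2 * G * RG"
    and nonneg: "0 \<le> RF" "0 \<le> RG" "0 \<le> RT" "0 \<le> s" "0 < a" "0 < b"
  shows "2 * (M * G) * (2 * RP) + m\<^sup>2 * (2 * R2 + 2 * (2 * RT))
      + s * (2 * (2 * (M * G)\<^sup>2 + m\<^sup>2 * G\<^sup>2) / a + 4 * m\<^sup>2 * G / b)
    \<le> 8 * M * G * (M + G) * (L * RF + RG) + 4 * M\<^sup>2 * RT + 10 * M\<^sup>2 * G\<^sup>2 * s * (1 / a + 1 / b)"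
proof -
  have M: "0 \<le> M" and G0: "0 \<le> G" using m G by auto
  have m2: "m\<^sup>2 \<le> M\<^sup>2" using m by (intro power_mono) auto
  let ?X = "L * RF + RG"
  have X: "RG \<le> ?X" "0 \<le> ?X" using L nonneg by auto
  have 1: "2 * (M * G) * (2 * RP) \<le> 4 * (M * G) * ((M + G) * ?X)"
    using mult_left_mono[OF RP, of "4 * (M * G)"] M G0 by simp
  have "m\<^sup>2 * (2 * R2) \<le> M\<^sup>2 * (2 * (2 * G * RG))"
    using m2 R2 G0 nonneg
    by (intro order_trans[OF mult_left_mono mult_right_mono]) auto
  also have "\<dots> = 4 * (M * G) * (M * RG)" by (simp add: power2_eq_square)
  also have "\<dots> \<le> 4 * (M * G) * ((M + G) * ?X)"
    using M G0 X nonneg by (intro mult_left_mono mult_mono) auto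
  finally have 2: "m\<^sup>2 * (2 * R2) \<le> 4 * (M * G) * ((M + G) * ?X)" .
  have 3: "m\<^sup>2 * (2 * (2 * RT)) \<le> 4 * M\<^sup>2 * RT"
    using mult_right_mono[OF m2, of "4 * RT"] nonneg by simp
  let ?K = "M\<^sup>2 * G\<^sup>2"
  have mG: "m\<^sup>2 * G\<^sup>2 \<le> ?K" using m2 by (intro mult_right_mono) auto
  have "G \<le> G\<^sup>2" using G by (simp add: self_le_power)
  then have mG1: "m\<^sup>2 * G \<le> ?K" using m2 G0 by (intro mult_mono) auto
  have K: "0 \<le> ?K" by simp
  have "2 * (2 * (M * G)\<^sup>2 + m\<^sup>2 * G\<^sup>2) \<le> 10 * ?K"
  proof -
    have "2 * (2 * (M * G)\<^sup>2 + m\<^sup>2 * G\<^sup>2) = 4 * ?K + 2 * (m\<^sup>2 * G\<^sup>2)"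
      by (simp add: power_mult_distrib)
    then show ?thesis using mG K by linarith
  qed
  then have "2 * (2 * (M * G)\<^sup>2 + m\<^sup>2 * G\<^sup>2) / a \<le> (10 * ?K) / a"
    using nonneg by (intro divide_right_mono) auto
  moreover have "4 * m\<^sup>2 * G \<le> 10 * ?K" using mG1 K by (simp only: mult.assoc)
  then have "4 * m\<^sup>2 * G / b \<le> (10 * ?K) / b"
    using nonneg by (intro divide_right_mono) auto
  ultimately have "s * (2 * (2 * (M * G)\<^sup>2 + m\<^sup>2 * G\<^sup>2) / a + 4 * m\<^sup>2 * G / b)
      \<le> s * ((10 * ?K) / a + (10 * ?K) / b)"
    using nonneg by (intro mult_left_mono add_mono) auto
  also have "\<dots> = 10 * M\<^sup>2 * G\<^sup>2 * s * (1 / a + 1 / b)" by (simp add: algebra_simps)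
  finally have 4: "s * (2 * (2 * (M * G)\<^sup>2 + m\<^sup>2 * G\<^sup>2) / a + 4 * m\<^sup>2 * G / b)
      \<le> 10 * M\<^sup>2 * G\<^sup>2 * s * (1 / a + 1 / b)" .
  have "8 * M * G * (M + G) * ?X = 4 * (M * G) * ((M + G) * ?X) + 4 * (M * G) * ((M + G) * ?X)"
    by (simp add: algebra_simps)
  then show ?thesis using 1 2 3 4 by (simp only: distrib_left[of "m\<^sup>2"])
qed

theorem theorem3:
  fixes X :: "(real ^ 'd) set" and Y :: "real set"
    and \<mu> :: "(real ^ 'd) measure" and \<nu> :: "real measure"
    and ptr pte :: "real ^ 'd \<Rightarrow> real"
    and ctr cte :: "real ^ 'd \<Rightarrow> real \<Rightarrow> real"
    and l lUB :: "real \<Rightarrow> real \<Rightarrow> real"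
    and F Gp :: "(real ^ 'd \<Rightarrow> real) set"
    and m M L G \<delta> :: real
    and ntr nte :: nat
    and fhat ghat :: "(real ^ 'd, real) sample \<Rightarrow> (real ^ 'd \<Rightarrow> real)"
    and fmin gmin :: "real ^ 'd \<Rightarrow> real"
  assumes \<mu>: "reference_measure X \<mu>" and \<nu>: "reference_measure Y \<nu>"
    and shift: "covariate_shift \<mu> \<nu> ptr ctr pte cte"
    and r2_integrable: "integrable (input_dist \<mu> ptr) (\<lambda>x. (importance ptr pte x)\<^sup>2)"
    and l_measurable: "(\<lambda>(t, y). l t y) \<in> borel_measurable (borel \<Otimes>\<^sub>M restrict_space borel Y)"
    and lUB_measurable: "(\<lambda>(t, y). lUB t y) \<in> borel_measurable (borel \<Otimes>\<^sub>M restrict_space borel Y)"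
    and l_nonneg: "\<And>t y. y \<in> Y \<Longrightarrow> 0 \<le> l t y"
    and l_le_lUB: "\<And>t y. y \<in> Y \<Longrightarrow> l t y \<le> lUB t y"
    and F_measurable: "\<And>f. f \<in> F \<Longrightarrow> f \<in> borel_measurable (restrict_space borel X)"
    and G_measurable: "\<And>g. g \<in> Gp \<Longrightarrow> g \<in> borel_measurable (restrict_space borel X)"
    and G_nonneg: "\<And>g x. g \<in> Gp \<Longrightarrow> x \<in> X \<Longrightarrow> 0 \<le> g x"
    and l_bound: "\<And>f x y. f \<in> F \<Longrightarrow> x \<in> X \<Longrightarrow> y \<in> Y \<Longrightarrow> l (f x) y \<le> m"
    and M: "m \<le> M" and L: "0 < L" and G: "1 \<le> G"
    and lUB_bound: "\<And>f x y. f \<in> F \<Longrightarrow> x \<in> X \<Longrightarrow> y \<in> Y \<Longrightarrow> lUB (f x) y \<le> M"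
    and lUB_lipschitz:
      "\<And>y'. y' \<in> Y \<Longrightarrow> L-lipschitz_on {f x | f x. f \<in> F \<and> x \<in> X} (\<lambda>y. lUB y y')"
    and G_bound: "\<And>g x. g \<in> Gp \<Longrightarrow> x \<in> X \<Longrightarrow> g x \<le> G"
    and ntr: "0 < ntr" and nte: "0 < nte"
    (* measurability of the suprema *)
    and "rademacher_measurable ntr (input_dist \<mu> ptr) F"
    and "rademacher_measurable ntr (input_dist \<mu> ptr) (symmetrized Gp)"
    and "rademacher_measurable nte (input_dist \<mu> pte) (symmetrized Gp)"
    and "rademacher_measurable ntr (input_dist \<mu> ptr) {\<lambda>x. (g x)\<^sup>2 | g. g \<in> Gp}"
    and "rademacher_measurable ntr (joint_dist \<mu> \<nu> ptr ctr)
           {\<lambda>(x, y). lUB (f x) y * g x | f g. f \<in> F \<and> g \<in> symmetrized Gp}"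
    and "(\<lambda>S. SUP (f, g)\<in>F \<times> Gp. ereal (J_UB \<mu> \<nu> ptr ctr pte m lUB f g
                                     - J_UB_emp \<mu> ptr pte m lUB ntr nte f g S))
           \<in> borel_measurable (sample_dist \<mu> \<nu> ptr ctr pte ntr nte)"
    (* existence of the minimizers *)
    and J_min: "is_arg_min (\<lambda>(f, g). J_UB \<mu> \<nu> ptr ctr pte m lUB f g)
                  (\<lambda>(f, g). f \<in> F \<and> g \<in> Gp) (fmin, gmin)"
    and J_emp_min: "\<And>S. S \<in> space (sample_dist \<mu> \<nu> ptr ctr pte ntr nte) \<Longrightarrow>
          is_arg_min (\<lambda>(f, g). J_UB_emp \<mu> ptr pte m lUB ntr nte f g S)
            (\<lambda>(f, g). f \<in> F \<and> g \<in> Gp) (fhat S, ghat S)"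
    and \<delta>: "0 < \<delta>" "\<delta> \<le> 1"
  shows "with_prob_at_least (sample_dist \<mu> \<nu> ptr ctr pte ntr nte) (1 - \<delta>)
    (\<lambda>S. ereal (1 / 2 * (test_risk \<mu> \<nu> pte cte l (fhat S))\<^sup>2)
       \<le> ereal (J_UB \<mu> \<nu> ptr ctr pte m lUB fmin gmin)
         + ereal (8 * M * G * (M + G))
           * (ereal L * rademacher ntr (input_dist \<mu> ptr) F
              + rademacher ntr (input_dist \<mu> ptr) (symmetrized Gp))
         + ereal (4 * M\<^sup>2) * rademacher nte (input_dist \<mu> pte) (symmetrized Gp)
         + ereal (10 * M\<^sup>2 * G\<^sup>2 * sqrt (ln (1 / \<delta>) / 2)
                  * (1 / sqrt (real ntr) + 1 / sqrt (real nte)))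
         + ereal (M\<^sup>2 * G\<^sup>2 / real ntr))"
proof -
  let ?Dtr = "input_dist \<mu> ptr" and ?Dte = "input_dist \<mu> pte" and ?J = "joint_dist \<mu> \<nu> ptr ctr"
  let ?S = "sample_dist \<mu> \<nu> ptr ctr pte ntr nte" and ?r = "importance ptr pte"
  let ?sG = "symmetrized Gp"
  note rad_F = assms(21) and rad_tr = assms(22) and rad_te = assms(23) and rad_sq = assms(24)
    and rad_prod = assms(25) and sup_meas = assms(26)
  have sf: "sigma_finite_measure \<mu>" "sigma_finite_measure \<nu>"
    and sets: "sets \<mu> = sets (restrict_space borel X)" "sets \<nu> = sets (restrict_space borel Y)"
    using \<mu> \<nu> unfolding reference_measure_def by auto
  have space: "space \<mu> = X" "space \<nu> = Y"
    using space_reference_measure[OF \<mu>] space_reference_measure[OF \<nu>] .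
  have tr: "prob_density \<mu> ptr" "conditional_density \<mu> \<nu> ptr ctr"
    and te: "prob_density \<mu> pte" "conditional_density \<mu> \<nu> pte cte"
    using shift unfolding covariate_shift_def by blast+
  have Dtr: "prob_space ?Dtr" and Dte: "prob_space ?Dte"
    by (rule prob_space_input_dist[OF sf tr], rule prob_space_input_dist[OF sf te])
  have J: "prob_space ?J" by (rule prob_space_joint_dist[OF sf tr])
  interpret Dtr: prob_space ?Dtr by (rule Dtr)
  interpret J: prob_space ?J by (rule J)
  have fst_meas [measurable]: "fst \<in> ?J \<rightarrow>\<^sub>M ?Dtr" and fst_distr: "distr ?J ?Dtr fst = ?Dtr"
    by (rule measurable_fst_joint_dist[OF sf tr], rule distr_fst_joint_dist[OF sf tr])
  have spaces: "space ?Dtr = X" "space ?Dte = X" "space ?J = X \<times> Y"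
    unfolding input_dist_def joint_dist_def by (simp_all add: space_pair_measure space)
  have sets_D: "sets ?Dtr = sets \<mu>" "sets ?Dte = sets \<mu>" "sets ?J = sets (\<mu> \<Otimes>\<^sub>M \<nu>)"
    unfolding input_dist_def joint_dist_def by simp_all
  have nonempty: "X \<noteq> {}" "Y \<noteq> {}" using J.not_empty unfolding spaces by auto
  have fmin: "fmin \<in> F" and gmin: "gmin \<in> Gp"
    using J_min unfolding is_arg_min_def by auto
  have F_ne: "F \<noteq> {}" and Gp_ne: "Gp \<noteq> {}" and sG_ne: "?sG \<noteq> {}"
    using fmin gmin unfolding symmetrized_def by auto
  have hat: "fhat S \<in> F" "ghat S \<in> Gp"
      "J_UB_emp \<mu> ptr pte m lUB ntr nte (fhat S) (ghat S) S \<le> J_UB_emp \<mu> ptr pte m lUB ntr nte fmin gmin S"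
    if "S \<in> space ?S" for S
    using J_emp_min[OF that] fmin gmin unfolding is_arg_min_def by (auto simp: not_less)
  \<comment> \<open>\<open>m\<close> bounds a nonnegative loss at some point, and a point exists
    because the joint law is a probability measure.\<close>
  have m0: "0 \<le> m" using nonempty l_nonneg l_bound fmin by (meson all_not_in_conv order_trans)
  then have M0: "0 \<le> M" using M by simp
  have G0: "0 \<le> G" using G by simp
  have F_meas: "f \<in> borel_measurable ?Dtr" if "f \<in> F" for f
    using F_measurable[OF that] measurable_cong_sets[OF trans[OF sets_D(1) sets(1)] refl, of borel] by blast
  have Gp_meas: "g \<in> borel_measurable ?Dtr" "g \<in> borel_measurable ?Dte" if "g \<in> Gp" for g
    using G_measurable[OF that] measurable_cong_sets[OF trans[OF sets_D(1) sets(1)] refl, of borel]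
      measurable_cong_sets[OF trans[OF sets_D(2) sets(1)] refl, of borel] by blast+
  have snd_meas: "snd \<in> ?J \<rightarrow>\<^sub>M restrict_space borel Y"
    using measurable_snd[of \<mu> \<nu>] measurable_cong_sets[OF sets_D(3) sets(2)[symmetric]] by blast
  have loss_meas: "(\<lambda>z. h (f (fst z)) (snd z)) \<in> borel_measurable ?J"
    if "f \<in> F" "(\<lambda>(t, y). h t y) \<in> borel_measurable (borel \<Otimes>\<^sub>M restrict_space borel Y)"
    for h :: "real \<Rightarrow> real \<Rightarrow> real" and f
  proof -
    have "(\<lambda>z. (f (fst z), snd z)) \<in> ?J \<rightarrow>\<^sub>M borel \<Otimes>\<^sub>M restrict_space borel Y"
      by (intro measurable_Pair measurable_compose[OF fst_meas] F_meas that(1) snd_meas)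
    from measurable_compose[OF this that(2)] show ?thesis by simp
  qed
  have g_fst_meas: "(\<lambda>z. g (fst z)) \<in> borel_measurable ?J" if "g \<in> Gp" for g
    by (rule measurable_compose[OF fst_meas Gp_meas(1)[OF that]])
  have lUB_nonneg: "0 \<le> lUB t y" if "y \<in> Y" for t y
    using l_nonneg[OF that] l_le_lUB[OF that] by (rule order_trans)
  have r_meas: "?r \<in> borel_measurable ?Dtr"
    using importance_measurable[OF shift] by (simp add: measurable_cong_sets[OF sets_D(1) refl])
  have r_nonneg: "0 \<le> ?r x" if "x \<in> X" for x
    using importance_nonneg[OF shift] that unfolding space by blast
  have to_J: "(\<integral>z. \<phi> (fst z) \<partial>?J) = (\<integral>x. \<phi> x \<partial>?Dtr)" if "\<phi> \<in> borel_measurable ?Dtr"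
    for \<phi> :: "real ^ 'd \<Rightarrow> real"
    using integral_distr[OF fst_meas that] by (simp add: fst_distr)

  \<comment> \<open>Population bound on the test risk\<close>
  have risk: "1 / 2 * (test_risk \<mu> \<nu> pte cte l f)\<^sup>2 \<le> J_UB \<mu> \<nu> ptr ctr pte m lUB f g"
    if f: "f \<in> F" and g: "g \<in> Gp" for f g
  proof -
    have lm: "(\<lambda>z. l (f (fst z)) (snd z)) \<in> borel_measurable ?J" by (rule loss_meas[OF f l_measurable])
    have rm: "(\<lambda>z. ?r (fst z)) \<in> borel_measurable ?J" by (rule measurable_compose[OF fst_meas r_meas])
    \<comment> \<open>Change of measure makes the test risk a training expectation weighted by the
      importance.\<close>
    have "test_risk \<mu> \<nu> pte cte l f
        = (\<integral>z. l (f (fst z)) (snd z) \<partial>density ?J (\<lambda>z. ennreal (?r (fst z))))"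
      unfolding test_risk_def joint_dist_shift[OF shift sf] by (simp add: split_beta')
    also have "\<dots> = (\<integral>z. ?r (fst z) *\<^sub>R l (f (fst z)) (snd z) \<partial>?J)"
      using lm rm r_nonneg by (intro integral_density AE_I2) (auto simp: spaces)
    finally have risk: "test_risk \<mu> \<nu> pte cte l f = (\<integral>z. ?r (fst z) * l (f (fst z)) (snd z) \<partial>?J)"
      by simp
    have sq_eq: "(\<integral>z. (g (fst z) - ?r (fst z))\<^sup>2 \<partial>?J) = (\<integral>x. (g x - ?r x)\<^sup>2 \<partial>?Dtr)"
      using Gp_meas(1)[OF g] r_meas by (intro to_J[of "\<lambda>x. (g x - ?r x)\<^sup>2"]) measurable
    have r2: "integrable ?J (\<lambda>z. (?r (fst z))\<^sup>2)"
      using integrable_distr[OF fst_meas, of "\<lambda>x. (?r x)\<^sup>2"] r2_integrable by (simp add: fst_distr)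
    have "1 / 2 * (\<integral>z. ?r (fst z) * l (f (fst z)) (snd z) \<partial>?J)\<^sup>2
        \<le> (\<integral>z. lUB (f (fst z)) (snd z) * g (fst z) \<partial>?J)\<^sup>2
          + m\<^sup>2 * (\<integral>z. (g (fst z) - ?r (fst z))\<^sup>2 \<partial>?J)"
      by (rule J.half_square_reweighted_le[OF lm loss_meas[OF f lUB_measurable] g_fst_meas[OF g] rm,
            where A = M and B = G])
         (use f g l_nonneg l_bound l_le_lUB lUB_bound G_nonneg G_bound r_nonneg r2 in \<open>auto simp: spaces\<close>)
    then show ?thesis unfolding risk sq_eq J_UB_def by (simp add: split_beta')
  qed

  \<comment> \<open>The tail bound needs positive increments and a positive deviation
    \<open>t\<close>, so two degenerate cases are split off. With \<open>M = 0\<close> the loss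
    vanishes and the left side is 0, while a zero coefficient annihilates even an infinite
    complexity. With \<open>\<delta> = 1\<close> the required probability is 0 and the empty event
    serves.\<close>
  consider "M = 0" | "\<delta> = 1" | "0 < M" "\<delta> < 1" using M0 \<delta> by linarith
  then show ?thesis
  proof cases
    case 1
    have S: "prob_space ?S"
      unfolding sample_dist_def by (intro prob_space_pair prob_space_PiM J Dte)
    have "1 / 2 * (test_risk \<mu> \<nu> pte cte l f)\<^sup>2 = 0" if "f \<in> F" for f
    proof -
      have "l (f x) y = 0" if "x \<in> X" "y \<in> Y" for x y
        using l_bound[OF \<open>f \<in> F\<close> that] l_nonneg[OF that(2), of "f x"] M 1 by linarith
      then have "test_risk \<mu> \<nu> pte cte l f = (\<integral>z. 0 \<partial>joint_dist \<mu> \<nu> pte cte)"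
        unfolding test_risk_def
        by (intro Bochner_Integration.integral_cong) (auto simp: joint_dist_def space_pair_measure space)
      then show ?thesis by simp
    qed
    moreover have "0 \<le> J_UB \<mu> \<nu> ptr ctr pte m lUB fmin gmin" unfolding J_UB_def by simp
    ultimately show ?thesis
      unfolding with_prob_at_least_def using hat(1) \<delta> prob_space.prob_space[OF S] 1
      by (intro bexI[of _ "space ?S"]) (auto simp: zero_ereal_def[symmetric])
  next
    case 2
    then show ?thesis unfolding with_prob_at_least_def by (intro bexI[of _ "{}"]) auto
  next
    case 3

    \<comment> \<open>Reduction to the abstract empirical objective\<close>
    define u where "u = (\<lambda>(f, g) z. lUB (f (fst z)) (snd z) * g (fst z :: real ^ 'd))"
    \<comment> \<open>The square of \<open>g\<close> is read at the input of a labelled point, so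
      that both training terms are functions of the same sample.\<close>
    define v where "v = (\<lambda>(f :: real ^ 'd \<Rightarrow> real, g) z :: (real ^ 'd) \<times> real. (g (fst z))\<^sup>2 :: real)"
    define w where "w = (\<lambda>(f :: real ^ 'd \<Rightarrow> real, g) x :: real ^ 'd. g x :: real)"
    define C where "C = (\<integral>x. (?r x)\<^sup>2 \<partial>?Dtr)"
    have u_bd: "0 \<le> lUB (f x) y * g x \<and> lUB (f x) y * g x \<le> M * G"
      if "f \<in> F" "g \<in> Gp" "x \<in> X" "y \<in> Y" for f g x y
      using lUB_nonneg[OF that(4)] lUB_bound[OF that(1,3,4)] G_nonneg[OF that(2,3)] G_bound[OF that(2,3)] M0
      by (auto intro!: mult_mono)
    have v_bd: "(g x)\<^sup>2 \<le> G\<^sup>2" if "g \<in> Gp" "x \<in> X" for g x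
      using G_nonneg[OF that] G_bound[OF that] by (intro power_mono)
    interpret O: empirical_objective ?J ?Dte ntr nte "F \<times> Gp" u v w "M * G" "G\<^sup>2" G "m\<^sup>2" C
    proof (rule empirical_objective.intro)
      show "prob_space ?J" "prob_space ?Dte" "0 < ntr" "0 < nte" "0 \<le> m\<^sup>2" "F \<times> Gp \<noteq> {}"
        using J Dte ntr nte F_ne Gp_ne by simp_all
      fix k assume k: "k \<in> F \<times> Gp"
      obtain f g where fg: "k = (f, g)" "f \<in> F" "g \<in> Gp" using k by auto
      note [measurable] = loss_meas[OF fg(2) lUB_measurable] g_fst_meas[OF fg(3)]
      show "u k \<in> borel_measurable ?J" "v k \<in> borel_measurable ?J"
        unfolding fg(1) u_def v_def prod.case by measurable
      show "w k \<in> borel_measurable ?Dte" unfolding fg(1) w_def prod.case using Gp_meas(2)[OF fg(3)] by simp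
      show "0 \<le> u k z" "u k z \<le> M * G" "0 \<le> v k z" "v k z \<le> G\<^sup>2" if "z \<in> space ?J" for z
        using u_bd[OF fg(2,3)] v_bd[OF fg(3)] that unfolding spaces fg(1) u_def v_def by auto
      show "0 \<le> w k z" "w k z \<le> G" if "z \<in> space ?Dte" for z
        using G_nonneg G_bound fg that unfolding spaces fg(1) w_def by auto
    qed
    have S_eq: "?S = O.P \<Otimes>\<^sub>M O.Q" unfolding sample_dist_def O.P_def O.Q_def ..
    have objective: "O.objective (f, g) = J_UB \<mu> \<nu> ptr ctr pte m lUB f g" if fg: "f \<in> F" "g \<in> Gp" for f g
    proof -
      note [measurable] = Gp_meas(1)[OF fg(2)] r_meas
      have gb: "0 \<le> g x" "g x \<le> G" if "x \<in> X" for x using G_nonneg G_bound fg that by auto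
      have r_int: "integrable ?Dtr ?r" by (rule Dtr.integrable_of_square_integrable[OF r_meas r2_integrable])
      have g2_int: "integrable ?Dtr (\<lambda>x. (g x)\<^sup>2)"
        using v_bd[OF fg(2)] by (intro Dtr.integrable_const_bound[where B = "G\<^sup>2"] AE_I2) (auto simp: spaces)
      have gr_int: "integrable ?Dtr (\<lambda>x. ?r x * g x)"
      proof (rule Bochner_Integration.integrable_bound[where f = "\<lambda>x. G * ?r x"])
        show "AE x in ?Dtr. norm (?r x * g x) \<le> norm (G * ?r x)"
          using gb r_nonneg G0 by (intro AE_I2) (auto simp: spaces abs_mult mult.commute[of G] intro!: mult_left_mono)
      qed (use r_int in auto)
      \<comment> \<open>The cross term of the expanded square is an expectation under the test law,
        which the unlabelled test points estimate.\<close>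
      have w_eq: "(\<integral>x. g x \<partial>?Dte) = (\<integral>x. ?r x * g x \<partial>?Dtr)"
        unfolding input_dist_shift[OF shift] using r_nonneg
        by (subst integral_density) (auto intro!: AE_I2 simp: spaces)
      have "(\<integral>x. (g x - ?r x)\<^sup>2 \<partial>?Dtr) = (\<integral>x. (g x)\<^sup>2 - 2 * (?r x * g x) + (?r x)\<^sup>2 \<partial>?Dtr)"
        by (intro Bochner_Integration.integral_cong refl) (simp add: power2_diff)
      also have "\<dots> = (\<integral>x. (g x)\<^sup>2 \<partial>?Dtr) - 2 * (\<integral>x. g x \<partial>?Dte) + C"
        unfolding C_def w_eq using g2_int gr_int r2_integrable by simp
      finally show ?thesis
        unfolding O.objective_def J_UB_def unfolding u_def v_def w_def
        using to_J[of "\<lambda>x. (g x)\<^sup>2"] by (simp add: split_beta')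
    qed
    have empirical: "O.empirical (f, g) S = J_UB_emp \<mu> ptr pte m lUB ntr nte f g S" for f g S
      unfolding O.empirical_def J_UB_emp_def unfolding u_def v_def w_def C_def by simp
    have O_sup: "(\<lambda>S. SUP k\<in>F \<times> Gp. ereal (O.objective k - O.empirical k S)) \<in> borel_measurable (O.P \<Otimes>\<^sub>M O.Q)"
    proof -
      have "(SUP k\<in>F \<times> Gp. ereal (O.objective k - O.empirical k S))
          = (SUP (f, g)\<in>F \<times> Gp. ereal (J_UB \<mu> \<nu> ptr ctr pte m lUB f g - J_UB_emp \<mu> ptr pte m lUB ntr nte f g S))" for S
        by (intro SUP_cong refl) (auto simp: objective empirical)
      then show ?thesis using sup_meas unfolding S_eq by simp
    qed

    \<comment> \<open>Measurable majorants for products, squares and test means\<close>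
    let ?Prod = "{\<lambda>(x, y). lUB (f x) y * g x | f g. f \<in> F \<and> g \<in> ?sG}" and ?Sq = "{\<lambda>x. (g x)\<^sup>2 | g. g \<in> Gp}"
    have sG_bd: "\<bar>g x\<bar> \<le> G" if "g \<in> ?sG" "x \<in> X" for g x
      by (rule symmetrized_bound[where H = Gp and X = X])
         (use that G_nonneg G_bound in \<open>auto simp: abs_le_iff intro: order_trans[of _ 0]\<close>)
    have lUB_abs: "\<bar>lUB (f x) y\<bar> \<le> M" if "f \<in> F" "x \<in> X" "y \<in> Y" for f x y
      using lUB_nonneg lUB_bound that by auto
    have Prod_ne: "?Prod \<noteq> {}" and Sq_ne: "?Sq \<noteq> {}" using F_ne sG_ne Gp_ne by auto

    have Prod_meas: "?Prod \<subseteq> borel_measurable ?J"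
    proof
      fix h assume "h \<in> ?Prod"
      then obtain f g where fg: "f \<in> F" "g \<in> ?sG" "h = (\<lambda>(x, y). lUB (f x) y * g x)"
        using \<open>h \<in> ?Prod\<close> by blast
      note [measurable] = loss_meas[OF fg(1) lUB_measurable]
      have "g \<in> borel_measurable ?Dtr" by (rule symmetrized_measurable[OF Gp_meas(1) fg(2)])
      then have [measurable]: "(\<lambda>z. g (fst z)) \<in> borel_measurable ?J" by (rule measurable_compose[OF fst_meas])
      show "h \<in> borel_measurable ?J" unfolding fg(3) split_beta' by measurable
    qed
    have Prod_bd: "\<forall>h\<in>?Prod. \<forall>z\<in>space ?J. \<bar>h z\<bar> \<le> M * G"
    proof (intro ballI)
      fix h z assume "h \<in> ?Prod" "z \<in> space ?J"
      obtain f g where fg: "f \<in> F" "g \<in> ?sG" "h = (\<lambda>(x, y). lUB (f x) y * g x)"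
        using \<open>h \<in> ?Prod\<close> by blast
      obtain x y where z: "z = (x, y)" "x \<in> X" "y \<in> Y" using \<open>z \<in> space ?J\<close> unfolding spaces by blast
      have "\<bar>lUB (f x) y\<bar> * \<bar>g x\<bar> \<le> M * G"
        using lUB_abs[OF fg(1) z(2,3)] sG_bd[OF fg(2) z(2)] M0 by (intro mult_mono) auto
      then show "\<bar>h z\<bar> \<le> M * G" unfolding fg(3) z(1) by (simp add: abs_mult)
    qed
    obtain U1 where U1: "U1 \<in> borel_measurable O.P" "\<And>x. x \<in> space O.P \<Longrightarrow> \<bar>U1 x\<bar> \<le> 2 * (M * G)"
      "\<And>x h. x \<in> space O.P \<Longrightarrow> h \<in> ?Prod \<Longrightarrow> (\<integral>t. h t \<partial>?J) - (\<Sum>i<ntr. h (x i)) / real ntr \<le> U1 x"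
      "(\<integral>x. U1 x \<partial>O.P) = 2 * (\<integral>x. rad_mean ntr ?Prod x \<partial>O.P)"
      using symmetrization[OF J rad_prod Prod_ne ntr Prod_meas Prod_bd] unfolding O.P_def by blast

    have Sq_meas: "?Sq \<subseteq> borel_measurable ?Dtr"
      using Gp_meas(1) by auto
    have Sq_bd: "\<forall>h\<in>?Sq. \<forall>x\<in>space ?Dtr. \<bar>h x\<bar> \<le> G\<^sup>2"
      using v_bd unfolding spaces by auto
    let ?PD = "\<Pi>\<^sub>M i\<in>{..<ntr}. ?Dtr"
    obtain V2 where V2: "V2 \<in> borel_measurable ?PD" "\<And>x. x \<in> space ?PD \<Longrightarrow> \<bar>V2 x\<bar> \<le> 2 * G\<^sup>2"
      "\<And>x h. x \<in> space ?PD \<Longrightarrow> h \<in> ?Sq \<Longrightarrow> (\<integral>t. h t \<partial>?Dtr) - (\<Sum>i<ntr. h (x i)) / real ntr \<le> V2 x"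
      "(\<integral>x. V2 x \<partial>?PD) = 2 * (\<integral>x. rad_mean ntr ?Sq x \<partial>?PD)"
      using symmetrization[OF Dtr rad_sq Sq_ne ntr Sq_meas Sq_bd] by blast
    let ?\<pi> = "compose {..<ntr} fst :: (nat \<Rightarrow> (real ^ 'd) \<times> real) \<Rightarrow> nat \<Rightarrow> real ^ 'd"
    note \<pi> = distr_PiM_fst[OF J Dtr fst_meas fst_distr, of ntr, folded O.P_def]
    \<comment> \<open>Squares of \<open>g\<close> involve inputs only, so their majorant is built on
      input samples and pulled back along the projection that forgets labels.\<close>
    define U2 where "U2 = (\<lambda>z. V2 (?\<pi> z))"
    have U2: "U2 \<in> borel_measurable O.P" "\<And>z. z \<in> space O.P \<Longrightarrow> \<bar>U2 z\<bar> \<le> 2 * G\<^sup>2"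
      "(\<integral>z. U2 z \<partial>O.P) = 2 * (\<integral>x. rad_mean ntr ?Sq x \<partial>?PD)"
      unfolding U2_def
      using measurable_compose[OF \<pi>(2) V2(1)] V2(2)[OF measurable_space[OF \<pi>(2)]]
        integral_distr[OF \<pi>(2) V2(1)] V2(4) by (simp_all add: \<pi>(1))

    have sG_meas: "?sG \<subseteq> borel_measurable ?Dte"
      using symmetrized_measurable[OF Gp_meas(2)] by blast
    have sG_bd': "\<forall>h\<in>?sG. \<forall>x\<in>space ?Dte. \<bar>h x\<bar> \<le> G"
      using sG_bd unfolding spaces by blast
    obtain U3 where U3: "U3 \<in> borel_measurable O.Q" "\<And>x. x \<in> space O.Q \<Longrightarrow> \<bar>U3 x\<bar> \<le> 2 * G"
      "\<And>x h. x \<in> space O.Q \<Longrightarrow> h \<in> ?sG \<Longrightarrow> (\<integral>t. h t \<partial>?Dte) - (\<Sum>i<nte. h (x i)) / real nte \<le> U3 x"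
      "(\<integral>x. U3 x \<partial>O.Q) = 2 * (\<integral>x. rad_mean nte ?sG x \<partial>O.Q)"
      using symmetrization[OF Dte rad_te sG_ne nte sG_meas sG_bd'] unfolding O.Q_def by blast

    have dev_u: "\<bar>(\<integral>z. u k z \<partial>?J) - (\<Sum>i<ntr. u k (x i)) / real ntr\<bar> \<le> U1 x"
      if k: "k \<in> F \<times> Gp" and x: "x \<in> space O.P" for k x
    proof -
      obtain f g where fg: "k = (f, g)" "f \<in> F" "g \<in> Gp" using k by auto
      \<comment> \<open>With both \<open>g\<close> and \<open>- g\<close> available, the one-sided
        majorant bounds the deviation of \<open>u k\<close> in absolute value.\<close>
      have sG: "g \<in> ?sG" "(\<lambda>x. - g x) \<in> ?sG" using fg(3) unfolding symmetrized_def by auto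
      have mem: "(\<lambda>(x, y). lUB (f x) y * h x) \<in> ?Prod" if "h \<in> ?sG" for h
        using fg(2) that by blast
      have "u k = (\<lambda>(x, y). lUB (f x) y * g x)"
        "(\<lambda>z. - u k z) = (\<lambda>(x, y). lUB (f x) y * - g x)"
        unfolding fg(1) u_def by auto
      then have "u k \<in> ?Prod" "(\<lambda>z. - u k z) \<in> ?Prod"
        using mem[OF sG(1)] mem[OF sG(2)] by (simp_all only:)
      from U1(3)[OF x this(1)] U1(3)[OF x this(2)] show ?thesis
        by (simp add: sum_negf abs_le_iff)
    qed
    have dev_v: "(\<integral>z. v k z \<partial>?J) - (\<Sum>i<ntr. v k (x i)) / real ntr \<le> U2 x"
      if k: "k \<in> F \<times> Gp" and x: "x \<in> space O.P" for k x
    proof -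
      obtain f g where fg: "k = (f, g)" "f \<in> F" "g \<in> Gp" using k by auto
      have h: "(\<lambda>x. (g x)\<^sup>2) \<in> ?Sq" using fg by auto
      have "(\<integral>z. v k z \<partial>?J) = (\<integral>x. (g x)\<^sup>2 \<partial>?Dtr)"
        unfolding fg(1) v_def prod.case using subsetD[OF Sq_meas h] by (rule to_J)
      moreover have "(\<Sum>i<ntr. v k (x i)) = (\<Sum>i<ntr. (g (?\<pi> x i))\<^sup>2)"
        unfolding fg(1) v_def by (intro sum.cong) (auto simp: compose_def)
      ultimately show ?thesis
        unfolding U2_def using V2(3)[OF measurable_space[OF \<pi>(2) x] h] by simp
    qed
    \<comment> \<open>\<open>w\<close> enters the objective with a minus sign, so its deviation is
      bounded in the opposite direction, by applying the majorant to \<open>- g\<close>.\<close>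
    have dev_w: "(\<Sum>i<nte. w k (y i)) / real nte - (\<integral>z. w k z \<partial>?Dte) \<le> U3 y"
      if k: "k \<in> F \<times> Gp" and y: "y \<in> space O.Q" for k y
    proof -
      obtain f g where fg: "k = (f, g)" "f \<in> F" "g \<in> Gp" using k by auto
      have "(\<lambda>x. - g x) \<in> ?sG" using fg unfolding symmetrized_def by auto
      from U3(3)[OF y this] show ?thesis unfolding fg(1) w_def by (simp add: sum_negf)
    qed

    \<comment> \<open>From integrals back to complexities\<close>
    define RG where "RG = (\<integral>x. rad_mean ntr ?sG x \<partial>?PD)"
    define RT where "RT = (\<integral>x. rad_mean nte ?sG x \<partial>O.Q)"
    have sG_bd_tr: "\<bar>h x\<bar> \<le> G" if "h \<in> ?sG" "x \<in> space ?Dtr" for h x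
      using sG_bd that unfolding spaces by blast
    have RG: "rademacher ntr ?Dtr ?sG = ereal RG"
      unfolding RG_def using rademacher_bounded_finite[OF Dtr rad_tr sG_ne ntr, of G] sG_bd_tr
      by (intro rademacher_eq_integral(2)[OF Dtr rad_tr sG_ne]) blast
    have RT: "rademacher nte ?Dte ?sG = ereal RT"
      unfolding RT_def O.Q_def using rademacher_bounded_finite[OF Dte rad_te sG_ne nte, of G] sG_bd'
      by (intro rademacher_eq_integral(2)[OF Dte rad_te sG_ne]) blast
    have RG0: "0 \<le> RG" using rademacher_nonneg[OF Dtr rad_tr sG_ne] unfolding RG by simp
    have RT0: "0 \<le> RT" using rademacher_nonneg[OF Dte rad_te sG_ne] unfolding RT by simp
    define RP where "RP = (\<integral>z. rad_mean ntr ?Prod z \<partial>O.P)"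
    define R2 where "R2 = (\<integral>x. rad_mean ntr ?Sq x \<partial>?PD)"
    have R2: "R2 \<le> 2 * G * RG"
      unfolding R2_def RG_def
      by (rule integral_rad_mean_square_le[OF Dtr ntr Gp_ne G0 _ rad_sq rad_tr])
         (use G_nonneg G_bound in \<open>auto simp: spaces\<close>)

    have MG: "0 < M * G" using 3 G by simp
    have "\<exists>A\<in>sets (O.P \<Otimes>\<^sub>M O.Q). 1 - \<delta> \<le> measure (O.P \<Otimes>\<^sub>M O.Q) A \<and> (\<forall>S\<in>A. \<forall>k\<in>F \<times> Gp.
       O.objective k - O.empirical k S + O.empirical (fmin, gmin) S
         \<le> O.objective (fmin, gmin) + 2 * (M * G) * (\<integral>x. U1 x \<partial>O.P)
           + m\<^sup>2 * ((\<integral>x. U2 x \<partial>O.P) + 2 * (\<integral>y. U3 y \<partial>O.Q))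
           + sqrt (ln (1 / \<delta>) / 2) * (2 * (2 * (M * G)\<^sup>2 + m\<^sup>2 * G\<^sup>2) / sqrt (real ntr)
             + 4 * m\<^sup>2 * G / sqrt (real nte)) + (M * G)\<^sup>2 / real ntr)"
      by (rule O.uniform_deviation[OF O_sup U1(1) U2(1) U3(1) U1(2) U2(2) U3(2) dev_u dev_v dev_w])
         (use fmin gmin MG \<delta> 3 in auto)
    then obtain A where A: "A \<in> sets ?S" "1 - \<delta> \<le> measure ?S A"
      and A_le: "\<And>S k. S \<in> A \<Longrightarrow> k \<in> F \<times> Gp \<Longrightarrow> O.objective k - O.empirical k S + O.empirical (fmin, gmin) S
         \<le> O.objective (fmin, gmin) + 2 * (M * G) * (2 * RP) + m\<^sup>2 * (2 * R2 + 2 * (2 * RT))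
           + sqrt (ln (1 / \<delta>) / 2) * (2 * (2 * (M * G)\<^sup>2 + m\<^sup>2 * G\<^sup>2) / sqrt (real ntr)
             + 4 * m\<^sup>2 * G / sqrt (real nte)) + (M * G)\<^sup>2 / real ntr"
      unfolding S_eq U1(4) U2(3) U3(4) RP_def[symmetric] R2_def[symmetric] RT_def[symmetric] by blast
    show ?thesis
      unfolding with_prob_at_least_def
    proof (intro bexI[OF _ A(1)] conjI A(2) ballI)
      fix S assume S: "S \<in> A"
      then have S': "S \<in> space ?S" using sets.sets_into_space[OF A(1)] by blast
      have "1 / 2 * (test_risk \<mu> \<nu> pte cte l (fhat S))\<^sup>2 \<le> J_UB \<mu> \<nu> ptr ctr pte m lUB (fhat S) (ghat S)"
        by (rule risk[OF hat(1,2)[OF S']])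
      \<comment> \<open>What is added, the empirical objective at the population minimizer minus
        that at the empirical one, is nonnegative by empirical minimality.\<close>
      also have "\<dots> \<le> O.objective (fhat S, ghat S) - O.empirical (fhat S, ghat S) S + O.empirical (fmin, gmin) S"
        using hat[OF S'] by (simp add: objective empirical)
      also have "\<dots> \<le> O.objective (fmin, gmin) + 2 * (M * G) * (2 * RP) + m\<^sup>2 * (2 * R2 + 2 * (2 * RT))
           + sqrt (ln (1 / \<delta>) / 2) * (2 * (2 * (M * G)\<^sup>2 + m\<^sup>2 * G\<^sup>2) / sqrt (real ntr)
             + 4 * m\<^sup>2 * G / sqrt (real nte)) + (M * G)\<^sup>2 / real ntr"
        using hat(1,2)[OF S'] by (intro A_le S) auto
      finally have main: "1 / 2 * (test_risk \<mu> \<nu> pte cte l (fhat S))\<^sup>2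
          \<le> J_UB \<mu> \<nu> ptr ctr pte m lUB fmin gmin
            + (2 * (M * G) * (2 * RP) + m\<^sup>2 * (2 * R2 + 2 * (2 * RT))
              + sqrt (ln (1 / \<delta>) / 2) * (2 * (2 * (M * G)\<^sup>2 + m\<^sup>2 * G\<^sup>2) / sqrt (real ntr)
                + 4 * m\<^sup>2 * G / sqrt (real nte))) + M\<^sup>2 * G\<^sup>2 / real ntr"
        by (simp add: objective[OF fmin gmin] power_mult_distrib)
      let ?RF = "rademacher ntr ?Dtr F"
      let ?c = "10 * M\<^sup>2 * G\<^sup>2 * sqrt (ln (1 / \<delta>) / 2) * (1 / sqrt (real ntr) + 1 / sqrt (real nte))"
      show "ereal (1 / 2 * (test_risk \<mu> \<nu> pte cte l (fhat S))\<^sup>2)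
       \<le> ereal (J_UB \<mu> \<nu> ptr ctr pte m lUB fmin gmin)
         + ereal (8 * M * G * (M + G)) * (ereal L * ?RF + rademacher ntr ?Dtr ?sG)
         + ereal (4 * M\<^sup>2) * rademacher nte ?Dte ?sG + ereal ?c + ereal (M\<^sup>2 * G\<^sup>2 / real ntr)"
      \<comment> \<open>With \<open>M\<close> and \<open>G\<close> positive the coefficient of the
        complexity of \<open>F\<close> is positive, so an infinite complexity makes the right side
        infinite.\<close>
      proof (cases "?RF = \<infinity>")
        case True
        have top: "ereal c * (ereal L * \<infinity> + ereal RG) = \<infinity>" if "0 < c" for c
          using that L by simp
        have pos: "0 < 8 * M * G * (M + G)" using 3 G by (intro mult_pos_pos) auto
        show ?thesis unfolding True RG RT top[OF pos] by simp
      next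
        case False
        define RF where "RF = (\<integral>x. rad_mean ntr F x \<partial>?PD)"
        have RF: "?RF = ereal RF"
          unfolding RF_def by (rule rademacher_eq_integral(2)[OF Dtr rad_F F_ne False])
        have RF0: "0 \<le> RF" using rademacher_nonneg[OF Dtr rad_F F_ne] unfolding RF by simp
        have RP: "RP \<le> (M + G) * (L * RF + RG)"
          unfolding RP_def RF_def RG_def O.P_def
        proof (rule integral_rad_mean_product_le[OF J Dtr fst_meas fst_distr ntr F_ne sG_ne _ M0 G0 _ _ _
              rad_F rad_tr rad_prod False])
          show "\<bar>g x\<bar> \<le> G" if "g \<in> ?sG" "x \<in> space ?Dtr" for g x using sG_bd_tr[OF that] .
          show "\<bar>lUB (f (fst z)) (snd z)\<bar> \<le> M" if "f \<in> F" "z \<in> space ?J" for f z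
            using lUB_abs that unfolding spaces by auto
          fix f f' z assume f: "f \<in> F" "f' \<in> F" and z: "z \<in> space ?J"
          then have "fst z \<in> X" "snd z \<in> Y" unfolding spaces by auto
          then show "\<bar>lUB (f (fst z)) (snd z) - lUB (f' (fst z)) (snd z)\<bar> \<le> L * \<bar>f (fst z) - f' (fst z)\<bar>"
            using lipschitz_onD[OF lUB_lipschitz, of "snd z" "f (fst z)" "f' (fst z)"] f
            by (auto simp: dist_real_def)
        qed (use L in simp)
        have "2 * (M * G) * (2 * RP) + m\<^sup>2 * (2 * R2 + 2 * (2 * RT))
              + sqrt (ln (1 / \<delta>) / 2) * (2 * (2 * (M * G)\<^sup>2 + m\<^sup>2 * G\<^sup>2) / sqrt (real ntr)
                + 4 * m\<^sup>2 * G / sqrt (real nte))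
            \<le> 8 * M * G * (M + G) * (L * RF + RG) + 4 * M\<^sup>2 * RT + ?c"
          by (rule deviation_constants_le[OF m0 M G _ RP R2 RF0 RG0 RT0]) (use L ntr nte \<delta> in auto)
        from order_trans[OF main add_right_mono[OF add_left_mono[OF this]]] show ?thesis
          unfolding RF RG RT
          by (simp only: times_ereal.simps plus_ereal.simps ereal_less_eq add.assoc)
      qed
    qed
  qed
qed

end
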